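(* Let $N\ge 3$. Let $V:(0,+\infty)\to[0,+\infty)$ and $K:(0,+\infty)\to(0,+\infty)$ be continuous, and assume that there is $C>0$ such that $V(r)\le C/r^2$ for all $r\in(0,1)$. Let $q_1,q_2>1$. (i) If $\mathcal{S}_0(q_1,R_1)<\infty$ and $\mathcal{S}_\infty(q_2,R_2)<\infty$ for some $R_1,R_2>0$, then $E$ is continuously embedded into $L^{q_1}_K(\mathbb{R}^N)+L^{q_2}_K(\mathbb{R}^N)$. (ii) If $\lim_{R\to0^+}\mathcal{S}_0(q_1,R)=\lim_{R\to+\infty}\mathcal{S}_\infty(q_2,R)=0$, then $E$ is compactly embedded into $L^{q_1}_K(\mathbb{R}^N)+L^{q_2}_K(\mathbb{R}^N)$.
   Context: $f\in C^\infty(\mathbb{R},\mathbb{R})$ denotes the unique solution of the Cauchy problem $f'(t)=\frac{1}{\sqrt{1+2f(t)^2}}$ for $t\in\mathbb{R}$, $f(0)=0$. $C^\infty_{c,r}(\mathbb{R}^N)$ is the space of radial $C^\infty$ real functions with compact support in $\mathbb{R}^N$, and $D^{1,2}_r(\mathbb{R}^N)$ is its closure with respect to the norm $\|u\|_{1,2}=\left(\int_{\mathbb{R}^N}|\nabla u|^2dx\right)^{1/2}$. $E=\{u\in D^{1,2}_r(\mathbb{R}^N): \int_{\mathbb{R}^N}V(|x|)f(u)^2dx<+\infty\}$, endowed with the norm $\|u\|=\|u\|_{1,2}+\|u\|_o$, where $\|u\|_o=\inf_{k>0}\frac1k\left[1+\int_{\mathbb{R}^N}V(|x|)f(ku)^2dx\right]$;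 it is a Banach space. $B_R=\{x\in\mathbb{R}^N:|x|<R\}$. For $R>0$ and $q>1$, $$\mathcal{S}_0(q,R)=\sup_{u\in E,\,\|u\|=1}\int_{B_R}K(|x|)|u|^q\,dx,\qquad \mathcal{S}_\infty(q,R)=\sup_{u\in E,\,\|u\|=1}\int_{\mathbb{R}^N\setminus B_R}K(|x|)|u|^q\,dx$$ (values in $[0,+\infty]$). $L^q_K(\mathbb{R}^N)=L^q(\mathbb{R}^N,K(|x|)dx)$. The sum space is $L^{q_1}_K+L^{q_2}_K=\{u_1+u_2: u_1\in L^{q_1}_K(\mathbb{R}^N),\ u_2\in L^{q_2}_K(\mathbb{R}^N)\}$, a Banach space with norm $\|u\|_{L^{q_1}_K+L^{q_2}_K}=\inf_{u_1+u_2=u}\max\{\|u_1\|_{L^{q_1}_K(\mathbb{R}^N)},\|u_2\|_{L^{q_2}_K(\mathbb{R}^N)}\}$. *)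

theory Defs
  imports "HOL-Analysis.Analysis"
begin
definition solves_cauchy :: "(real \<Rightarrow> real) \<Rightarrow> bool" where
  "solves_cauchy f \<longleftrightarrow>
     f 0 = 0 \<and> (\<forall>t. (f has_real_derivative 1 / sqrt (1 + 2 * (f t)\<^sup>2)) (at t))"

definition fsol :: "real \<Rightarrow> real" where
  "fsol = (THE f. solves_cauchy f)"

text \<open>The solution is the inverse of an explicit primitive of \<open>sqrt (1 + 2 * s\<^sup>2)\<close>, so that
  the definite description above is well defined.\<close>

lemma ex1_solves_cauchy: "\<exists>!f. solves_cauchy f"
proof -
  define G :: "real \<Rightarrow> real" where
    "G s = s * sqrt (1 + 2 * s\<^sup>2) / 2 + arsinh (sqrt 2 * s) / (2 * sqrt 2)" for s
  have pos: "1 + 2 * s\<^sup>2 > 0" for s :: real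
    by (simp add: add_pos_nonneg)
  have G': "(G has_real_derivative sqrt (1 + 2 * s\<^sup>2)) (at s)" for s
  proof -
    have "(G has_real_derivative
        (sqrt (1 + 2 * s\<^sup>2) + s * (4 * s * (inverse (sqrt (1 + 2 * s\<^sup>2)) / 2))) / 2
        + (sqrt 2 * (1 / sqrt ((sqrt 2 * s)\<^sup>2 + 1))) / (2 * sqrt 2)) (at s)"
    proof -
      have r: "((\<lambda>s. sqrt (1 + 2 * s\<^sup>2)) has_real_derivative
          4 * s * (inverse (sqrt (1 + 2 * s\<^sup>2)) / 2)) (at s)"
        using pos[of s] by (auto intro!: derivative_eq_intros)
      have a: "((\<lambda>s. arsinh (sqrt 2 * s)) has_real_derivative
          sqrt 2 * (1 / sqrt ((sqrt 2 * s)\<^sup>2 + 1))) (at s)"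
        by (rule DERIV_cong[OF DERIV_chain2[OF arsinh_real_has_field_derivative]])
          (auto intro!: derivative_eq_intros)
      show ?thesis
        unfolding G_def
        by (rule DERIV_cong[OF DERIV_add[OF DERIV_cdivide[OF DERIV_mult[OF DERIV_ident r]]
              DERIV_cdivide[OF a]]]) simp
    qed
    also have "(sqrt (1 + 2 * s\<^sup>2) + s * (4 * s * (inverse (sqrt (1 + 2 * s\<^sup>2)) / 2))) / 2
        + (sqrt 2 * (1 / sqrt ((sqrt 2 * s)\<^sup>2 + 1))) / (2 * sqrt 2) = sqrt (1 + 2 * s\<^sup>2)"
    proof -
      define w where "w = sqrt (1 + 2 * s\<^sup>2)"
      have w: "w > 0" "w * w = 1 + 2 * s\<^sup>2"
        using pos[of s] by (simp_all add: w_def)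
      have "sqrt ((sqrt 2 * s)\<^sup>2 + 1) = w"
        by (simp add: w_def power_mult_distrib add.commute)
      then show ?thesis
        unfolding w_def[symmetric] using w by (simp add: field_simps power2_eq_square)
    qed
    finally show ?thesis .
  qed
  have mono: "strict_mono G"
    by (rule strict_monoI, rule DERIV_pos_imp_increasing) (use G' pos in fastforce)+
  then have inj: "inj G"
    by (rule strict_mono_imp_inj_on)
  have G0: "G 0 = 0"
    by (simp add: G_def)
  have cont: "isCont G s" for s
    using G' DERIV_isCont by blast
  have bound: "\<bar>s\<bar> / 2 \<le> \<bar>G s\<bar>" for s
  proof -
    have 1: "s / 2 \<le> G s" if "s \<ge> 0" for s
    proof -
      have "s * 1 \<le> s * sqrt (1 + 2 * s\<^sup>2)"
        by (rule mult_left_mono) (use that in auto)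
      moreover have "arsinh (sqrt 2 * s) \<ge> 0"
        using that by (cases "s = 0") (simp_all add: order_less_imp_le)
      ultimately show ?thesis
        unfolding G_def by (intro order.trans[OF _ add_increasing2[OF _ order.refl]]) auto
    qed
    have odd: "G (- s) = - G s" for s
      by (simp add: G_def arsinh_minus_real)
    show ?thesis
      using 1[of s] 1[of "- s"] odd[of s] by (cases "s \<ge> 0") auto
  qed
  have surj: "\<exists>s. G s = t" for t
  proof -
    have "G (- (2 * \<bar>t\<bar>)) \<le> t" "t \<le> G (2 * \<bar>t\<bar>)"
      using bound[of "- (2 * \<bar>t\<bar>)"] bound[of "2 * \<bar>t\<bar>"] G0
        strict_mono_less_eq[OF mono, of "- (2 * \<bar>t\<bar>)" 0]
        strict_mono_less_eq[OF mono, of 0 "2 * \<bar>t\<bar>"]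
      by linarith+
    then show ?thesis
      using IVT[of G "- (2 * \<bar>t\<bar>)" t "2 * \<bar>t\<bar>"] cont by auto
  qed
  define h where "h = inv G"
  have hG: "h (G s) = s" and Gh: "G (h t) = t" for s t
    using inj surj by (auto simp: h_def f_inv_into_f surj_def) (metis f_inv_into_f rangeI)
  have "isCont h t" for t
    using isCont_inverse_function[of 1 "h t" h G] hG cont Gh by auto
  then have "(h has_real_derivative inverse (sqrt (1 + 2 * (h t)\<^sup>2))) (at t)" for t
    using DERIV_inverse_function[of G "sqrt (1 + 2 * (h t)\<^sup>2)" h t "t - 1" "t + 1"]
      G'[of "h t"] Gh pos[of "h t"] by auto
  moreover have "h 0 = 0"
    using hG[of 0] G0 by simp
  ultimately have "solves_cauchy h"
    by (simp add: solves_cauchy_def divide_inverse)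
  moreover have "f = h" if f: "solves_cauchy f" for f
  proof
    fix t
    have "((\<lambda>t. G (f t) - t) has_real_derivative 0) (at t)" for t
    proof -
      have "((\<lambda>t. G (f t) - t) has_real_derivative
          sqrt (1 + 2 * (f t)\<^sup>2) * (1 / sqrt (1 + 2 * (f t)\<^sup>2)) - 1) (at t)"
        using f by (intro DERIV_diff DERIV_chain2[OF G'] DERIV_ident) (auto simp: solves_cauchy_def)
      then show ?thesis
        using pos[of "f t"] by simp
    qed
    then have "G (f t) - t = G (f 0) - 0"
      by (intro DERIV_isconst_all) auto
    then show "f t = h t"
      using f G0 hG by (metis solves_cauchy_def diff_zero eq_iff_diff_eq_0)
  qed
  ultimately show ?thesis by blast
qed

lemma solves_cauchy_fsol: "solves_cauchy fsol"
  unfolding fsol_def by (rule theI'[OF ex1_solves_cauchy])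

text \<open>A function is \<open>C\<^sup>\<infinity>\<close> iff it and all its iterated directional derivatives are
  (Frechet) differentiable everywhere.\<close>

fun iter_deriv :: "'a::euclidean_space list \<Rightarrow> ('a \<Rightarrow> real) \<Rightarrow> 'a \<Rightarrow> real" where
  "iter_deriv [] \<phi> = \<phi>"
| "iter_deriv (v # vs) \<phi> = (\<lambda>x. frechet_derivative (iter_deriv vs \<phi>) (at x) v)"

definition Cc_infinity :: "('a::euclidean_space \<Rightarrow> real) set" where
  "Cc_infinity = {\<phi>. (\<forall>vs x. iter_deriv vs \<phi> differentiable (at x)) \<and>
                     compact (closure {x. \<phi> x \<noteq> 0})}"

definition radial :: "('a::euclidean_space \<Rightarrow> real) \<Rightarrow> bool" where
  "radial u \<longleftrightarrow> (\<forall>x y. norm x = norm y \<longrightarrow> u x = u y)"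

definition has_weak_gradient ::
    "('a::euclidean_space \<Rightarrow> real) \<Rightarrow> ('a \<Rightarrow> 'a) \<Rightarrow> bool" where
  "has_weak_gradient u g \<longleftrightarrow>
     (\<forall>S. compact S \<longrightarrow> set_integrable lebesgue S u \<and> set_integrable lebesgue S g) \<and>
     (\<forall>\<phi>\<in>Cc_infinity. \<forall>i\<in>Basis.
        (LINT x|lebesgue. u x * frechet_derivative \<phi> (at x) i)
          = - (LINT x|lebesgue. (g x \<bullet> i) * \<phi> x))"

text \<open>Weak gradients are unique up to a null set, so quantities defined through integrals
  do not depend on the choice.\<close>

definition weak_gradient :: "('a::euclidean_space \<Rightarrow> real) \<Rightarrow> 'a \<Rightarrow> 'a" where
  "weak_gradient u = (SOME g. has_weak_gradient u g)"

text \<open>All function spaces below consist of Lebesgue measurable representatives; functions that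
  agree almost everywhere have the same norms.\<close>

definition crit_exp :: "'a::euclidean_space itself \<Rightarrow> real" where
  "crit_exp _ = 2 * real DIM('a) / (real DIM('a) - 2)"

text \<open>In dimension at least 3, \<open>D\<^sup>1\<^sup>,\<^sup>2\<close> is realised as a space of functions by the Sobolev inequality;
  integrability with the critical exponent excludes the nonzero constants, whose gradient
  vanishes.\<close>

definition D12 :: "('a::euclidean_space \<Rightarrow> real) set" where
  "D12 = {u. u \<in> borel_measurable lebesgue \<and>
             integrable lebesgue (\<lambda>x. \<bar>u x\<bar> powr crit_exp TYPE('a)) \<and>
             (\<exists>g. has_weak_gradient u g \<and> integrable lebesgue (\<lambda>x. (norm (g x))\<^sup>2))}"

definition D12_norm :: "('a::euclidean_space \<Rightarrow> real) \<Rightarrow> real" where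
  "D12_norm u = sqrt (LINT x|lebesgue. (norm (weak_gradient u x))\<^sup>2)"

definition D12_rad :: "('a::euclidean_space \<Rightarrow> real) set" where
  "D12_rad = {u \<in> D12. \<forall>\<epsilon>>0. \<exists>\<phi>\<in>Cc_infinity. radial \<phi> \<and> D12_norm (\<lambda>x. u x - \<phi> x) < \<epsilon>}"

text \<open>The potentials \<open>V\<close> and \<open>K\<close> are only meaningful on \<open>{0<..}\<close>; their values elsewhere
  affect the integrands at most at the origin.\<close>

definition V_integral :: "(real \<Rightarrow> real) \<Rightarrow> ('a::euclidean_space \<Rightarrow> real) \<Rightarrow> ennreal" where
  "V_integral V u = (\<integral>\<^sup>+ x. ennreal (V (norm x) * (fsol (u x))\<^sup>2) \<partial>lebesgue)"

definition E_space :: "(real \<Rightarrow> real) \<Rightarrow> ('a::euclidean_space \<Rightarrow> real) set" where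
  "E_space V = {u \<in> D12_rad. V_integral V u < \<infinity>}"

text \<open>The infimum is finite on \<open>E_space V\<close>, as the choice \<open>k = 1\<close> shows.\<close>

definition o_norm :: "(real \<Rightarrow> real) \<Rightarrow> ('a::euclidean_space \<Rightarrow> real) \<Rightarrow> real" where
  "o_norm V u = enn2real (INF k\<in>{0<..}. ennreal (1 / k) * (1 + V_integral V (\<lambda>x. k * u x)))"

definition E_norm :: "(real \<Rightarrow> real) \<Rightarrow> ('a::euclidean_space \<Rightarrow> real) \<Rightarrow> real" where
  "E_norm V u = D12_norm u + o_norm V u"

definition S_zero ::
    "'a::euclidean_space itself \<Rightarrow> (real \<Rightarrow> real) \<Rightarrow> (real \<Rightarrow> real) \<Rightarrow> real \<Rightarrow> real \<Rightarrow> ennreal" where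
  "S_zero _ V K q R = (SUP u\<in>{u \<in> E_space V. E_norm V u = 1}.
     \<integral>\<^sup>+ x \<in> ball (0::'a) R. ennreal (K (norm x) * \<bar>u x\<bar> powr q) \<partial>lebesgue)"

definition S_infty ::
    "'a::euclidean_space itself \<Rightarrow> (real \<Rightarrow> real) \<Rightarrow> (real \<Rightarrow> real) \<Rightarrow> real \<Rightarrow> real \<Rightarrow> ennreal" where
  "S_infty _ V K q R = (SUP u\<in>{u \<in> E_space V. E_norm V u = 1}.
     \<integral>\<^sup>+ x \<in> - ball (0::'a) R. ennreal (K (norm x) * \<bar>u x\<bar> powr q) \<partial>lebesgue)"

definition Lp_space :: "'a measure \<Rightarrow> real \<Rightarrow> ('a \<Rightarrow> real) set" where
  "Lp_space M q = {u \<in> borel_measurable M. integrable M (\<lambda>x. \<bar>u x\<bar> powr q)}"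

definition Lp_norm :: "'a measure \<Rightarrow> real \<Rightarrow> ('a \<Rightarrow> real) \<Rightarrow> real" where
  "Lp_norm M q u = (LINT x|M. \<bar>u x\<bar> powr q) powr (1 / q)"

definition weighted_measure :: "(real \<Rightarrow> real) \<Rightarrow> 'a::euclidean_space measure" where
  "weighted_measure K = density lebesgue (\<lambda>x. ennreal (K (norm x)))"

text \<open>The pointwise identity \<open>u = u\<^sub>1 + u\<^sub>2\<close> is no restriction compared with equality almost
  everywhere: a difference on a null set can be absorbed into \<open>u\<^sub>1\<close>.\<close>

definition sum_space :: "'a measure \<Rightarrow> real \<Rightarrow> real \<Rightarrow> ('a \<Rightarrow> real) set" where
  "sum_space M q1 q2 = {(\<lambda>x. u1 x + u2 x) | u1 u2. u1 \<in> Lp_space M q1 \<and> u2 \<in> Lp_space M q2}"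

definition sum_norm :: "'a measure \<Rightarrow> real \<Rightarrow> real \<Rightarrow> ('a \<Rightarrow> real) \<Rightarrow> real" where
  "sum_norm M q1 q2 u = Inf {max (Lp_norm M q1 u1) (Lp_norm M q2 u2) | u1 u2.
     u1 \<in> Lp_space M q1 \<and> u2 \<in> Lp_space M q2 \<and> u = (\<lambda>x. u1 x + u2 x)}"

definition continuously_embedded ::
    "('a \<Rightarrow> real) set \<Rightarrow> (('a \<Rightarrow> real) \<Rightarrow> real) \<Rightarrow>
     ('a \<Rightarrow> real) set \<Rightarrow> (('a \<Rightarrow> real) \<Rightarrow> real) \<Rightarrow> bool" where
  "continuously_embedded X nX Y nY \<longleftrightarrow> X \<subseteq> Y \<and> (\<exists>C. \<forall>u\<in>X. nY u \<le> C * nX u)"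

definition compactly_embedded ::
    "('a \<Rightarrow> real) set \<Rightarrow> (('a \<Rightarrow> real) \<Rightarrow> real) \<Rightarrow>
     ('a \<Rightarrow> real) set \<Rightarrow> (('a \<Rightarrow> real) \<Rightarrow> real) \<Rightarrow> bool" where
  "compactly_embedded X nX Y nY \<longleftrightarrow> continuously_embedded X nX Y nY \<and>
     (\<forall>u :: nat \<Rightarrow> 'a \<Rightarrow> real. (\<forall>n. u n \<in> X) \<and> (\<exists>B. \<forall>n. nX (u n) \<le> B) \<longrightarrow>
        (\<exists>v\<in>Y. \<exists>r. strict_mono r \<and> (\<lambda>n. nY (\<lambda>x. u (r n) x - v x)) \<longlonglongrightarrow> 0))"

end

theory Submission
  imports Defs "HOL-Complex_Analysis.Great_Picard"
begin

text \<open>The analytic core is a radial lemma for functions \<open>u\<close> in \<open>D12_rad\<close> (\<open>radial_profile\<close>): almost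
everywhere \<open>u x = W (norm x)\<close>, where in dimension \<open>N\<close>, for \<open>0 < r \<le> s\<close>, the square
\<open>(W s - W r)\<^sup>2\<close> is at most a dimensional constant times
\<open>(D12_norm u)\<^sup>2 * r ^ (3 - N) * (1 / r - 1 / s)\<close>, and \<open>(W r)\<^sup>2\<close> is at most such a constant times
\<open>(D12_norm u)\<^sup>2 * r ^ (2 - N)\<close>. Hence a ball of \<open>E_space V\<close> consists of functions that are
uniformly bounded on every annulus around the origin and whose profiles are equicontinuous there.

For the continuous embedding, split \<open>u\<close> at the sphere of radius \<open>R2\<close>. The outer part is controlled
by \<open>S_infty\<close> and the part in the ball of radius \<open>R1\<close> by \<open>S_zero\<close>, because \<open>E_norm V\<close> is positively
homogeneous. If \<open>R1 < R2\<close>, the annulus in between carries a finite measure, \<open>K\<close> is bounded on it, and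
the radial lemma bounds \<open>u\<close>. The radial lemma also handles functions of norm zero: they vanish almost
everywhere.

For the compact embedding, the Arzela--Ascoli argument yields a subsequence of a bounded sequence that
converges almost everywhere to some \<open>v\<close>. Near the origin and near infinity the \<open>K\<close>-integrals are
uniformly small by hypothesis, and Fatou's lemma transfers this to \<open>v\<close>; on the remaining annulus,
dominated convergence applies. Thus the limit is found directly in the sum space, without weak limits
in \<open>E_space V\<close>.

The radial lemma is proved for smooth radial functions by the fundamental theorem of calculus, the
Cauchy--Schwarz inequality and the image of Lebesgue measure under the norm. To pass to \<open>u\<close>, choose
smooth radial \<open>\<phi> n\<close> whose gradients converge to that of \<open>u\<close> in \<open>L\<^sup>2\<close>. By the smooth estimate they
converge uniformly away from the origin to some \<open>w\<close>. The difference \<open>u - w\<close> has vanishing gradient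
away from the origin, so its integrals over translates of a box agree; since \<open>u\<close> is in \<open>L\<^sup>p\<close> for the
critical exponent and \<open>w\<close> decays, moving the box to infinity shows that all these integrals are zero,
whence \<open>u = w\<close> almost everywhere. The identities for weak gradients that this uses are tested against
products of explicit one-dimensional bumps.\<close>

section \<open>Explicit test functions\<close>

text \<open>The functions \<open>exp (- 1 / s) / s ^ k\<close>, extended by zero, form a family whose derivatives are linear
combinations of members; this is what makes them smooth at zero.\<close>

definition flat_exp :: "nat \<Rightarrow> real \<Rightarrow> real" where
  "flat_exp k s = (if s > 0 then exp (- 1 / s) / s ^ k else 0)"

lemma flat_exp_tendsto_0: "(flat_exp k \<longlongrightarrow> 0) (at_right 0)"
proof -
  have "((\<lambda>s. inverse s ^ k / exp (inverse s)) \<longlongrightarrow> 0) (at_right (0::real))"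
    by (rule filterlim_compose[OF tendsto_power_div_exp_0 filterlim_inverse_at_top_right])
  moreover have "\<forall>\<^sub>F s in at_right 0. inverse s ^ k / exp (inverse s) = flat_exp k s"
    unfolding eventually_at_filter
    by (rule always_eventually) (auto simp: flat_exp_def exp_minus field_simps)
  ultimately show ?thesis
    by (rule Lim_transform_eventually)
qed

lemma flat_exp_has_derivative:
  "(flat_exp k has_real_derivative flat_exp (k + 2) s - real k * flat_exp (k + 1) s) (at s)"
proof -
  consider "s > 0" | "s < 0" | "s = 0" by linarith
  then show ?thesis
  proof cases
    case 1
    have "((\<lambda>s. exp (- 1 / s) / s ^ k) has_real_derivative
            flat_exp (k + 2) s - real k * flat_exp (k + 1) s) (at s)"
      using 1 by (auto intro!: derivative_eq_intros simp: flat_exp_def field_simps power2_eq_square)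
        (cases k; simp add: field_simps)
    moreover have "\<forall>\<^sub>F x in nhds s. x > 0"
      using 1 by (simp add: eventually_nhds_in_open[of "{0<..}", simplified])
    ultimately show ?thesis
      by (subst DERIV_cong_ev[OF refl _ refl]) (auto simp: flat_exp_def elim!: eventually_mono)
  next
    case 2
    have "((\<lambda>s. 0) has_real_derivative flat_exp (k + 2) s - real k * flat_exp (k + 1) s) (at s)"
      using 2 by (simp add: flat_exp_def)
    moreover have "\<forall>\<^sub>F x in nhds s. x < 0"
      using 2 by (simp add: eventually_nhds_in_open[of "{..<0}", simplified])
    ultimately show ?thesis
      by (subst DERIV_cong_ev[OF refl _ refl]) (auto simp: flat_exp_def elim!: eventually_mono)
  next
    case 3
    have "((\<lambda>h. (flat_exp k (0 + h) - flat_exp k 0) / h) \<longlongrightarrow> 0) (at 0)"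
    proof (rule filterlim_split_at)
      show "((\<lambda>h. (flat_exp k (0 + h) - flat_exp k 0) / h) \<longlongrightarrow> 0) (at_right 0)"
        using flat_exp_tendsto_0[of "Suc k"]
        by (rule Lim_transform_eventually)
          (auto simp: flat_exp_def eventually_at_filter field_simps)
      show "((\<lambda>h. (flat_exp k (0 + h) - flat_exp k 0) / h) \<longlongrightarrow> 0) (at_left 0)"
        by (rule Lim_transform_eventually[OF tendsto_const])
          (auto simp: flat_exp_def eventually_at_filter)
    qed
    then have "(flat_exp k has_real_derivative 0) (at 0)"
      by (simp add: DERIV_def)
    then show ?thesis
      using 3 by (simp add: flat_exp_def)
  qed
qed

text \<open>A class of functions that is closed under directional derivatives consists of \<open>C\<^sup>\<infinity>\<close> functions, which
avoids any induction on the order of differentiation. The rule \<open>primitive\<close> is included because the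
translation estimate for weak gradients uses antiderivatives of bumps.\<close>

inductive_set smooth_family :: "('a::euclidean_space \<Rightarrow> real) set" where
  flat: "(\<lambda>x. flat_exp k (c * (x \<bullet> i) + d)) \<in> smooth_family"
| const: "(\<lambda>x. c) \<in> smooth_family"
| add: "f \<in> smooth_family \<Longrightarrow> g \<in> smooth_family \<Longrightarrow> (\<lambda>x. f x + g x) \<in> smooth_family"
| mult: "f \<in> smooth_family \<Longrightarrow> g \<in> smooth_family \<Longrightarrow> (\<lambda>x. f x * g x) \<in> smooth_family"
| primitive: "(\<And>s. (P has_real_derivative p s) (at s)) \<Longrightarrow>
    (\<lambda>x. p (x \<bullet> i)) \<in> smooth_family \<Longrightarrow> (\<lambda>x. P (x \<bullet> i)) \<in> smooth_family"

lemma ridge_has_derivative: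
  assumes "(h has_real_derivative d) (at (x \<bullet> i))"
  shows "((\<lambda>x. h (x \<bullet> i)) has_derivative (\<lambda>v. d * (v \<bullet> i))) (at x)"
proof -
  have "((\<lambda>x. x \<bullet> i) has_derivative (\<lambda>v. v \<bullet> i)) (at x)"
    by (intro bounded_linear_imp_has_derivative bounded_linear_inner_left)
  from has_derivative_compose[OF this assms[unfolded has_field_derivative_def]]
  show ?thesis by simp
qed

lemma smooth_family_derivative:
  assumes "f \<in> smooth_family"
  shows "\<exists>D. (\<forall>x. (f has_derivative D x) (at x)) \<and> (\<forall>v. (\<lambda>x. D x v) \<in> smooth_family)"
  using assms
proof induction
  case (flat k c i d)
  have 1: "((\<lambda>s. flat_exp k (c * s + d)) has_real_derivative
      (flat_exp (k + 2) (c * s + d) - real k * flat_exp (k + 1) (c * s + d)) * c) (at s)" for s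
    by (rule DERIV_chain2[OF flat_exp_has_derivative]) (auto intro!: derivative_eq_intros)
  have "(\<lambda>x. ((flat_exp (k + 2) (c * (x \<bullet> i) + d)
      + (- real k) * flat_exp (k + 1) (c * (x \<bullet> i) + d)) * c) * (v \<bullet> i)) \<in> smooth_family" for v
    by (intro smooth_family.intros)
  then show ?case
    by (intro exI[of _ "\<lambda>x v. (flat_exp (k + 2) (c * (x \<bullet> i) + d)
      - real k * flat_exp (k + 1) (c * (x \<bullet> i) + d)) * c * (v \<bullet> i)"])
      (auto intro!: ridge_has_derivative[where h = "\<lambda>s. flat_exp k (c * s + d)"] 1[simplified])
next
  case (const c)
  then show ?case
    by (intro exI[of _ "\<lambda>x v. 0"]) (auto intro: smooth_family.const)
next
  case (add f g)
  then obtain D E where D: "\<forall>x. (f has_derivative D x) (at x)" "\<forall>v. (\<lambda>x. D x v) \<in> smooth_family"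
    and E: "\<forall>x. (g has_derivative E x) (at x)" "\<forall>v. (\<lambda>x. E x v) \<in> smooth_family" by blast
  then show ?case
    by (intro exI[of _ "\<lambda>x v. D x v + E x v"])
      (auto intro!: smooth_family.add has_derivative_add)
next
  case (mult f g)
  then obtain D E where D: "\<forall>x. (f has_derivative D x) (at x)" "\<forall>v. (\<lambda>x. D x v) \<in> smooth_family"
    and E: "\<forall>x. (g has_derivative E x) (at x)" "\<forall>v. (\<lambda>x. E x v) \<in> smooth_family" by blast
  with mult(1,2) show ?case
    by (intro exI[of _ "\<lambda>x v. f x * E x v + D x v * g x"])
      (auto intro!: smooth_family.add smooth_family.mult has_derivative_mult)
next
  case (primitive P p i)
  then show ?case
    by (intro exI[of _ "\<lambda>x v. p (x \<bullet> i) * (v \<bullet> i)"])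
      (auto intro!: smooth_family.mult smooth_family.const ridge_has_derivative)
qed

lemma smooth_family_iter_deriv:
  assumes "f \<in> smooth_family" shows "iter_deriv vs f \<in> smooth_family"
proof (induction vs)
  case (Cons v vs)
  obtain D where D: "\<forall>x. (iter_deriv vs f has_derivative D x) (at x)"
    "\<forall>v. (\<lambda>x. D x v) \<in> smooth_family"
    using smooth_family_derivative[OF Cons] by blast
  then have "frechet_derivative (iter_deriv vs f) (at x) = D x" for x
    using frechet_derivative_at by metis
  then have "iter_deriv (v # vs) f = (\<lambda>x. D x v)"
    by simp
  with D show ?case by simp
qed (use assms in simp)

lemma smooth_family_differentiable:
  "f \<in> smooth_family \<Longrightarrow> iter_deriv vs f differentiable (at x)"
  using smooth_family_derivative[OF smooth_family_iter_deriv] by (meson differentiable_def)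

lemma smooth_family_prod:
  assumes "finite A" "\<And>j. j \<in> A \<Longrightarrow> h j \<in> smooth_family"
  shows "(\<lambda>x. \<Prod>j\<in>A. h j x) \<in> smooth_family"
  using assms
proof (induction A rule: finite_induct)
  case empty
  then show ?case by (simp add: smooth_family.const)
next
  case (insert j A)
  then show ?case by (simp add: smooth_family.mult)
qed

lemma product_test_function:
  fixes a b :: "'a::euclidean_space"
  assumes "\<And>j. j \<in> Basis \<Longrightarrow> (\<lambda>x::'a. h j (x \<bullet> j)) \<in> smooth_family"
    and supp: "\<And>j s. j \<in> Basis \<Longrightarrow> s \<notin> {a \<bullet> j..b \<bullet> j} \<Longrightarrow> h j s = 0"
  shows "(\<lambda>x. \<Prod>j\<in>Basis. h j (x \<bullet> j)) \<in> Cc_infinity"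
proof -
  have "(\<lambda>x::'a. \<Prod>j\<in>Basis. h j (x \<bullet> j)) \<in> smooth_family"
    using assms by (intro smooth_family_prod) auto
  moreover have "{x. (\<Prod>j\<in>Basis. h j (x \<bullet> j)) \<noteq> 0} \<subseteq> cbox a b"
    using supp by (force simp: mem_box prod_zero_iff)
  then have "compact (closure {x. (\<Prod>j\<in>Basis. h j (x \<bullet> j)) \<noteq> 0})"
    by (simp only: compact_closure bounded_subset[OF bounded_cbox])
  ultimately show ?thesis
    unfolding Cc_infinity_def using smooth_family_differentiable by blast
qed

text \<open>A directional derivative can be computed along the line; this replaces the Leibniz rule for long
products by a one-dimensional derivative.\<close>

lemma frechet_derivative_direction:
  assumes "f differentiable (at x)" "((\<lambda>t. f (x + t *\<^sub>R v)) has_real_derivative d) (at 0)"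
  shows "frechet_derivative f (at x) v = d"
proof -
  have 1: "(f has_derivative frechet_derivative f (at x)) (at x)"
    using assms(1) by (simp add: frechet_derivative_works)
  have 2: "((\<lambda>t. x + t *\<^sub>R v) has_derivative (\<lambda>t. t *\<^sub>R v)) (at 0)"
    by (auto intro!: derivative_eq_intros)
  have "((\<lambda>t. f (x + t *\<^sub>R v)) has_derivative (\<lambda>t. frechet_derivative f (at x) (t *\<^sub>R v))) (at 0)"
    using has_derivative_compose[OF 2, of f "frechet_derivative f (at x)"] 1 by simp
  from has_derivative_unique[OF this assms(2)[unfolded has_field_derivative_def]]
  have "frechet_derivative f (at x) (1 *\<^sub>R v) = d * 1" by (rule fun_cong)
  then show ?thesis by simp
qed

lemma frechet_derivative_product:
  fixes x :: "'a::euclidean_space"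
  assumes "(\<lambda>x::'a. \<Prod>j\<in>Basis. h j (x \<bullet> j)) differentiable (at x)"
    and i: "i \<in> Basis" and h': "(h i has_real_derivative d) (at (x \<bullet> i))"
  shows "frechet_derivative (\<lambda>x. \<Prod>j\<in>Basis. h j (x \<bullet> j)) (at x) i
    = d * (\<Prod>j\<in>Basis - {i}. h j (x \<bullet> j))"
proof (rule frechet_derivative_direction[OF assms(1)])
  have "(\<Prod>j\<in>Basis. h j ((x + t *\<^sub>R i) \<bullet> j))
      = h i (x \<bullet> i + t) * (\<Prod>j\<in>Basis - {i}. h j (x \<bullet> j))" for t
  proof -
    have "(\<Prod>j\<in>Basis. h j ((x + t *\<^sub>R i) \<bullet> j))
      = h i ((x + t *\<^sub>R i) \<bullet> i) * (\<Prod>j\<in>Basis - {i}. h j ((x + t *\<^sub>R i) \<bullet> j))"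
      using i by (simp add: prod.remove)
    also have "(\<Prod>j\<in>Basis - {i}. h j ((x + t *\<^sub>R i) \<bullet> j)) = (\<Prod>j\<in>Basis - {i}. h j (x \<bullet> j))"
      using i by (intro prod.cong) (auto simp: inner_simps inner_Basis)
    finally show ?thesis using i by (simp add: inner_simps)
  qed
  moreover have "((\<lambda>t. h i (x \<bullet> i + t)) has_real_derivative d * 1) (at 0)"
    by (rule DERIV_chain2[of "h i"]) (use h' in \<open>auto intro!: derivative_eq_intros\<close>)
  then have "((\<lambda>t. h i (x \<bullet> i + t) * (\<Prod>j\<in>Basis - {i}. h j (x \<bullet> j))) has_real_derivative
      d * (\<Prod>j\<in>Basis - {i}. h j (x \<bullet> j))) (at 0)"
    using DERIV_cmult_right by fastforce
  ultimately show "((\<lambda>t. \<Prod>j\<in>Basis. h j ((x + t *\<^sub>R i) \<bullet> j)) has_real_derivative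
      d * (\<Prod>j\<in>Basis - {i}. h j (x \<bullet> j))) (at 0)"
    by simp
qed

text \<open>The parameter \<open>n\<close> steepens the bump: as \<open>n\<close> tends to infinity both factors tend to 1 inside the
interval, so the bumps converge to its indicator while staying between 0 and 1.\<close>

definition bump :: "real \<Rightarrow> real \<Rightarrow> nat \<Rightarrow> real \<Rightarrow> real" where
  "bump a b n s = flat_exp 0 (real n * (s - a)) * flat_exp 0 (real n * (b - s))"

lemma bump_smooth: "(\<lambda>x. bump a b n (x \<bullet> i)) \<in> smooth_family"
proof -
  have "(\<lambda>x. flat_exp 0 (real n * (x \<bullet> i) + (- real n * a)) *
      flat_exp 0 ((- real n) * (x \<bullet> i) + real n * b)) \<in> smooth_family"
    by (intro smooth_family.intros)
  then show ?thesis
    by (simp add: bump_def algebra_simps)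
qed

lemma flat_exp_0_bounds: "0 \<le> flat_exp 0 s" "flat_exp 0 s \<le> 1"
  by (auto simp: flat_exp_def)

lemma bump_nonneg: "0 \<le> bump a b n s" and bump_le_1: "bump a b n s \<le> 1"
  unfolding bump_def using flat_exp_0_bounds by (auto intro: mult_le_one)

lemma bump_outside: "s \<notin> {a<..<b} \<Longrightarrow> bump a b n s = 0"
  by (cases n) (auto simp: bump_def flat_exp_def zero_less_mult_iff)

lemma bump_tendsto: "(\<lambda>n. bump a b n s) \<longlonglongrightarrow> indicator {a<..<b} s"
proof (cases "s \<in> {a<..<b}")
  case True
  have 1: "(\<lambda>n. flat_exp 0 (real n * c)) \<longlonglongrightarrow> 1" if "c > 0" for c
  proof -
    have "(\<lambda>n. exp (- (inverse (real n) * inverse c))) \<longlonglongrightarrow> exp (- (0 * inverse c))"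
      by (intro tendsto_intros lim_inverse_n)
    moreover have "\<forall>\<^sub>F n in sequentially.
        exp (- (inverse (real n) * inverse c)) = flat_exp 0 (real n * c)"
      using that by (intro eventually_sequentiallyI[of 1]) (auto simp: flat_exp_def field_simps)
    ultimately show ?thesis
      by (simp add: Lim_transform_eventually)
  qed
  have "(\<lambda>n. bump a b n s) \<longlonglongrightarrow> 1 * 1"
    unfolding bump_def using True by (intro tendsto_mult 1) auto
  then show ?thesis using True by simp
qed (simp add: bump_outside)

lemma iter_deriv_lincomb:
  assumes "\<And>vs x. iter_deriv vs f differentiable (at x)" "\<And>vs x. iter_deriv vs g differentiable (at x)"
  shows "iter_deriv vs (\<lambda>x. a * f x + b * g x) = (\<lambda>x. a * iter_deriv vs f x + b * iter_deriv vs g x)"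
proof (induction vs)
  case (Cons v vs)
  have "((\<lambda>x. a * iter_deriv vs f x + b * iter_deriv vs g x) has_derivative
     (\<lambda>v. a * frechet_derivative (iter_deriv vs f) (at x) v + b * frechet_derivative (iter_deriv vs g) (at x) v))
      (at x)" for x
    using assms by (intro has_derivative_add has_derivative_mult_right)
      (auto simp: frechet_derivative_works[symmetric])
  note * = frechet_derivative_at[OF this, symmetric]
  show ?case
    unfolding iter_deriv.simps Cons * ..
qed simp

lemma Cc_infinity_lincomb:
  assumes "f \<in> Cc_infinity" "g \<in> Cc_infinity"
  shows "(\<lambda>x. a * f x + b * g x) \<in> Cc_infinity"
proof -
  have f: "iter_deriv vs f differentiable (at x)" "iter_deriv vs g differentiable (at x)" for vs x
    using assms by (auto simp: Cc_infinity_def)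
  have "bounded ({x. f x \<noteq> 0} \<union> {x. g x \<noteq> 0})"
    using assms by (auto simp: Cc_infinity_def compact_closure)
  then have "bounded {x. a * f x + b * g x \<noteq> 0}"
    by (rule bounded_subset) auto
  then have "compact (closure {x. a * f x + b * g x \<noteq> 0})"
    by (simp only: compact_closure)
  moreover have "iter_deriv vs (\<lambda>x. a * f x + b * g x) differentiable (at x)" for vs x
    unfolding iter_deriv_lincomb[OF f]
    by (intro differentiable_add differentiable_mult differentiable_const f)
  ultimately show ?thesis
    unfolding Cc_infinity_def by blast
qed

section \<open>Weak gradients\<close>

definition locally_integrable :: "('a::euclidean_space \<Rightarrow> 'b::euclidean_space) \<Rightarrow> bool" where
  "locally_integrable u \<longleftrightarrow> (\<forall>S. compact S \<longrightarrow> set_integrable lebesgue S u)"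

lemma locally_integrable_subset:
  assumes "locally_integrable u" "A \<subseteq> S" "compact S" "A \<in> sets lebesgue"
  shows "set_integrable lebesgue A u"
  using assms set_integrable_subset unfolding locally_integrable_def by blast

lemma locally_integrable_measurable:
  assumes "locally_integrable u" shows "u \<in> borel_measurable lebesgue"
proof (rule borel_measurable_LIMSEQ_metric)
  show "(\<lambda>x. indicat_real (cball 0 (real n)) x *\<^sub>R u x) \<in> borel_measurable lebesgue" for n
    using assms unfolding locally_integrable_def set_integrable_def
    by (intro borel_measurable_integrable) simp
  show "(\<lambda>n. indicat_real (cball 0 (real n)) x *\<^sub>R u x) \<longlonglongrightarrow> u x" for x
  proof (rule tendsto_eventually)
    obtain m where "norm x \<le> real m" using real_arch_simple by blast
    then show "\<forall>\<^sub>F n in sequentially. indicat_real (cball 0 (real n)) x *\<^sub>R u x = u x"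
      by (intro eventually_sequentiallyI[of m]) auto
  qed
qed

lemma integrable_mult_compact_support:
  fixes u :: "'a::euclidean_space \<Rightarrow> 'b::euclidean_space" and F :: "'a \<Rightarrow> real"
  assumes "locally_integrable u" "F \<in> borel_measurable lebesgue" "compact S"
    and "\<And>x. x \<in> S \<Longrightarrow> \<bar>F x\<bar> \<le> B" and supp: "\<And>x. x \<notin> S \<Longrightarrow> F x = 0"
  shows "integrable lebesgue (\<lambda>x. F x *\<^sub>R u x)"
proof -
  let ?v = "\<lambda>x. indicator S x *\<^sub>R u x"
  have v: "integrable lebesgue ?v"
    using assms unfolding locally_integrable_def set_integrable_def by blast
  have eq: "(\<lambda>x. F x *\<^sub>R u x) = (\<lambda>x. F x *\<^sub>R ?v x)"
    using supp by (auto simp: fun_eq_iff indicator_def)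
  have "integrable lebesgue (\<lambda>x. F x *\<^sub>R ?v x)"
  proof (rule Bochner_Integration.integrable_bound)
    show "integrable lebesgue (\<lambda>x. B *\<^sub>R ?v x)"
      using v by (rule integrable_scaleR_right)
    show "(\<lambda>x. F x *\<^sub>R ?v x) \<in> borel_measurable lebesgue"
      using assms(2) borel_measurable_integrable[OF v] by (rule borel_measurable_scaleR)
    show "AE x in lebesgue. norm (F x *\<^sub>R ?v x) \<le> norm (B *\<^sub>R ?v x)"
      using assms(4) by (intro AE_I2) (auto simp: indicator_def intro!: mult_right_mono order_trans[OF _ abs_ge_self])
  qed
  then show ?thesis unfolding eq .
qed

lemma continuous_measurable_lebesgue:
  fixes f :: "'a::euclidean_space \<Rightarrow> 'b::euclidean_space"
  shows "continuous_on UNIV f \<Longrightarrow> f \<in> borel_measurable lebesgue"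
  by (intro measurable_completion) (simp add: borel_measurable_continuous_onI)

lemma integrable_continuous_compact_support:
  fixes F :: "'a::euclidean_space \<Rightarrow> real"
  assumes "continuous_on UNIV F" "compact S" "\<And>x. x \<notin> S \<Longrightarrow> F x = 0"
  shows "integrable lebesgue F"
proof -
  have "bounded (F ` S)"
    using compact_continuous_image[OF continuous_on_subset[OF assms(1)] assms(2)]
    by (simp add: compact_imp_bounded)
  then obtain B where B: "\<forall>x\<in>S. \<bar>F x\<bar> \<le> B"
    unfolding bounded_iff by auto
  have one: "locally_integrable (\<lambda>x::'a. 1::real)"
    unfolding locally_integrable_def set_integrable_def
    using fmeasurableD fmeasurableD2[OF lmeasurable_compact] lmeasurable_compact
    by (auto simp: less_top intro!: integrable_real_indicator)
  have "integrable lebesgue (\<lambda>x. F x *\<^sub>R (1::real))"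
    using B assms(3) by (intro integrable_mult_compact_support[OF one
          continuous_measurable_lebesgue[OF assms(1)] assms(2), where B = B]) auto
  then show ?thesis by simp
qed

lemma test_function_properties:
  fixes \<psi> :: "'a::euclidean_space \<Rightarrow> real"
  assumes "\<psi> \<in> Cc_infinity"
  obtains S B where "compact S" "\<And>x. \<psi> differentiable (at x)"
    "continuous_on UNIV \<psi>" "continuous_on UNIV (\<lambda>x. frechet_derivative \<psi> (at x) i)"
    "\<And>x. x \<notin> S \<Longrightarrow> \<psi> x = 0" "\<And>x. x \<notin> S \<Longrightarrow> frechet_derivative \<psi> (at x) i = 0"
    "\<And>x. \<bar>\<psi> x\<bar> \<le> B" "\<And>x. \<bar>frechet_derivative \<psi> (at x) i\<bar> \<le> B"
proof -
  define S where "S = closure {x. \<psi> x \<noteq> 0}"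
  let ?d = "\<lambda>x. frechet_derivative \<psi> (at x) i"
  have S: "compact S" and D: "\<And>vs x. iter_deriv vs \<psi> differentiable (at x)"
    using assms by (auto simp: Cc_infinity_def S_def)
  have diff: "\<psi> differentiable (at x)" for x
    using D[of "[]"] by simp
  have c: "continuous_on UNIV \<psi>" "continuous_on UNIV ?d"
    using D[of "[]"] D[of "[i]"]
    by (auto simp: continuous_on_eq_continuous_within intro!: differentiable_imp_continuous_within)
  have z: "\<psi> x = 0" if "x \<notin> S" for x
    using that closure_subset[of "{x. \<psi> x \<noteq> 0}"] by (auto simp: S_def)
  have dz: "?d x = 0" if "x \<notin> S" for x
  proof -
    have "((\<lambda>x. 0) has_derivative (\<lambda>v. 0)) (at x)" by simp
    then have "(\<psi> has_derivative (\<lambda>v. 0)) (at x)"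
      by (rule has_derivative_transform_within_open[of _ _ _ UNIV "- S"])
        (use that z S compact_imp_closed in auto)
    from frechet_derivative_at[OF this, symmetric] show ?thesis by simp
  qed
  have "\<exists>B. \<forall>x. \<bar>f x\<bar> \<le> B" if "continuous_on UNIV f" "\<And>x. x \<notin> S \<Longrightarrow> f x = 0" for f :: "'a \<Rightarrow> real"
  proof -
    have "bounded (f ` S)"
      using compact_continuous_image[OF continuous_on_subset[OF that(1)] S] compact_imp_bounded by blast
    then obtain B where "\<forall>x\<in>S. \<bar>f x\<bar> \<le> B"
      unfolding bounded_iff by auto
    then have "\<bar>f x\<bar> \<le> max B 0" for x
      using that(2)[of x] by (cases "x \<in> S") (auto simp: le_max_iff_disj)
    then show ?thesis by blast
  qed
  from this[OF c(1) z] this[OF c(2) dz]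
  obtain B1 B2 where "\<forall>x. \<bar>\<psi> x\<bar> \<le> B1" "\<forall>x. \<bar>?d x\<bar> \<le> B2"
    by blast
  then have "\<And>x. \<bar>\<psi> x\<bar> \<le> max B1 B2" "\<And>x. \<bar>?d x\<bar> \<le> max B1 B2"
    by (auto simp: le_max_iff_disj)
  from that[OF S diff c z dz this] show thesis .
qed

lemma AE_lebesgue_nonzero: "AE x in lebesgue. x \<noteq> (0::'a::euclidean_space)"
  by (intro AE_I'[of "{0}"]) (auto simp: negligible_iff_null_sets[symmetric])

text \<open>By the Lebesgue differentiation theorem for cubes, almost every value of \<open>f\<close> is a limit of averages
over small cubes, and near a point of the open set \<open>S\<close> these cubes lie in \<open>S\<close>.\<close>

lemma AE_zero_if_box_integrals_zero:
  fixes f :: "'a::euclidean_space \<Rightarrow> real"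
  assumes f: "locally_integrable f" and "open S"
    and zero: "\<And>a b. cbox a b \<subseteq> S \<Longrightarrow> (LINT x:box a b|lebesgue. f x) = 0"
  shows "AE x in lebesgue. x \<in> S \<longrightarrow> f x = 0"
proof -
  have int: "set_integrable lebesgue (cbox a b) f" "set_integrable lebesgue (box a b) f" for a b
    using f by (auto intro: locally_integrable_subset[OF f box_subset_cbox compact_cbox]
        simp: locally_integrable_def)
  have "f integrable_on cbox a b" for a b
    using set_lebesgue_integral_eq_integral(1)[OF int(1)] .
  from integrable_ccontinuous_explicit[OF this]
  obtain N where N: "negligible N" and *: "\<And>x e. \<lbrakk>x \<notin> N; 0 < e\<rbrakk> \<Longrightarrow> \<exists>d>0. \<forall>h. 0 < h \<and> h < d \<longrightarrow>
        norm (integral (cbox x (x + h *\<^sub>R One)) f /\<^sub>R h ^ DIM('a) - f x) < e"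
    by blast
  have "f x = 0" if x: "x \<in> S" "x \<notin> N" for x
  proof (rule ccontr)
    assume "f x \<noteq> 0"
    with *[OF x(2), of "norm (f x)"] obtain d where d: "d > 0" "\<And>h. 0 < h \<Longrightarrow> h < d \<Longrightarrow>
        norm (integral (cbox x (x + h *\<^sub>R One)) f /\<^sub>R h ^ DIM('a) - f x) < norm (f x)"
      by auto
    obtain e where e: "e > 0" "ball x e \<subseteq> S"
      using \<open>open S\<close> x(1) open_contains_ball by blast
    \<comment> \<open>The diameter of the cube of side \<open>h\<close> is \<open>h * norm One\<close>, hence less than \<open>e\<close>.\<close>
    define h where "h = min (d / 2) (e / (2 * (1 + norm (One::'a))))"
    have h: "0 < h" "h < d"
      using d e by (auto simp: h_def add_pos_nonneg)
    have "norm (y - x) \<le> h * norm (One::'a)" if "y \<in> cbox x (x + h *\<^sub>R One)" for y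
    proof -
      have "norm (y - x) \<le> norm (h *\<^sub>R (One::'a))"
      proof (rule norm_le_componentwise)
        fix j :: 'a assume "j \<in> Basis"
        then show "\<bar>(y - x) \<bullet> j\<bar> \<le> \<bar>(h *\<^sub>R One) \<bullet> j\<bar>"
          using that h(1) by (force simp: mem_box inner_simps)
      qed
      then show ?thesis using h by simp
    qed
    moreover have "h * norm (One::'a) < e"
    proof -
      have "h * norm (One::'a) \<le> e / (2 * (1 + norm (One::'a))) * norm (One::'a)"
        by (intro mult_right_mono) (auto simp: h_def)
      also have "\<dots> < e"
        using e by (auto simp: field_simps add_pos_nonneg intro: add_pos_nonneg)
      finally show ?thesis .
    qed
    ultimately have "cbox x (x + h *\<^sub>R One) \<subseteq> S"
      using e(2) by (force simp: dist_norm norm_minus_commute)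
    from zero[OF this] have "integral (cbox x (x + h *\<^sub>R One)) f = 0"
      using set_lebesgue_integral_eq_integral(2)[OF int(2)] by (simp add: integral_open_interval)
    then show False using d(2)[OF h] by simp
  qed
  then have "{x. \<not> (x \<in> S \<longrightarrow> f x = 0)} \<subseteq> N" by auto
  moreover have "N \<in> null_sets lebesgue"
    using N by (simp add: negligible_iff_null_sets)
  ultimately show ?thesis by (intro AE_I') auto
qed

lemma prod_indicator_box:
  fixes a b x :: "'a::euclidean_space"
  shows "(\<Prod>j\<in>Basis. indicator {a \<bullet> j<..<b \<bullet> j} (x \<bullet> j)) = (indicator (box a b) x :: real)"
proof (cases "x \<in> box a b")
  case True
  then show ?thesis by (auto simp: mem_box intro!: prod.neutral)
next
  case False
  then obtain j :: 'a where "j \<in> Basis" "\<not> (a \<bullet> j < x \<bullet> j \<and> x \<bullet> j < b \<bullet> j)"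
    by (auto simp: mem_box)
  with False show ?thesis
    by (auto intro!: prod_zero bexI[of _ j] simp: indicator_def)
qed

definition box_bump :: "'a::euclidean_space \<Rightarrow> 'a \<Rightarrow> nat \<Rightarrow> 'a \<Rightarrow> real" where
  "box_bump a b n x = (\<Prod>j\<in>Basis. bump (a \<bullet> j) (b \<bullet> j) n (x \<bullet> j))"

lemma box_bump_in_Cc_infinity: "box_bump a b n \<in> Cc_infinity"
  unfolding box_bump_def
  by (rule product_test_function[where a = a and b = b]) (auto intro: bump_smooth bump_outside)

lemma box_bump_bounds: "0 \<le> box_bump a b n x" "box_bump a b n x \<le> 1"
  unfolding box_bump_def by (auto intro!: prod_nonneg prod_le_1 bump_nonneg bump_le_1)

lemma box_bump_outside:
  assumes "x \<notin> cbox a b" shows "box_bump a b n x = 0"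
proof -
  obtain j where "j \<in> Basis" "x \<bullet> j \<notin> {a \<bullet> j<..<b \<bullet> j}"
    using assms by (force simp: mem_box)
  then show ?thesis
    unfolding box_bump_def by (auto intro!: prod_zero bexI[of _ j] bump_outside)
qed

lemma box_bump_tendsto: "(\<lambda>n. box_bump a b n x) \<longlonglongrightarrow> indicator (box a b) x"
  unfolding box_bump_def prod_indicator_box[symmetric] by (intro tendsto_prod bump_tendsto)

lemma box_bump_measurable: "box_bump a b n \<in> borel_measurable lebesgue"
proof -
  from test_function_properties[OF box_bump_in_Cc_infinity] show ?thesis
    using continuous_measurable_lebesgue by metis
qed

lemma integrable_mult_box_bump:
  assumes "locally_integrable v"
  shows "integrable lebesgue (\<lambda>x. v x * box_bump a b n x)"
proof -
  have "integrable lebesgue (\<lambda>x. box_bump a b n x *\<^sub>R v x)"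
    by (rule integrable_mult_compact_support[OF assms box_bump_measurable compact_cbox[of a b],
          where B = 1])
      (auto simp: box_bump_bounds box_bump_outside)
  then show ?thesis by (simp add: mult.commute)
qed

lemma integral_box_bump_tendsto:
  fixes v :: "'a::euclidean_space \<Rightarrow> real"
  assumes v: "locally_integrable v"
  shows "(\<lambda>n. LINT x|lebesgue. v x * box_bump a b n x) \<longlonglongrightarrow> (LINT x:box a b|lebesgue. v x)"
  unfolding set_lebesgue_integral_def
proof (rule integral_dominated_convergence)
  have *: "set_integrable lebesgue (box a b) v" "set_integrable lebesgue (cbox a b) v"
    using v by (auto intro: locally_integrable_subset[OF v box_subset_cbox compact_cbox]
        simp: locally_integrable_def)
  note * = *[unfolded set_integrable_def]
  show "(\<lambda>x. indicat_real (box a b) x *\<^sub>R v x) \<in> borel_measurable lebesgue"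
    by (rule borel_measurable_integrable[OF *(1)])
  show "integrable lebesgue (\<lambda>x. norm (indicat_real (cbox a b) x *\<^sub>R v x))"
    by (rule integrable_norm[OF *(2)])
  show "(\<lambda>x. v x * box_bump a b n x) \<in> borel_measurable lebesgue" for n
    by (rule borel_measurable_integrable[OF integrable_mult_box_bump[OF v]])
  show "AE x in lebesgue. (\<lambda>n. v x * box_bump a b n x) \<longlonglongrightarrow> indicat_real (box a b) x *\<^sub>R v x"
    by (auto intro!: AE_I2 tendsto_mult tendsto_const box_bump_tendsto simp: mult.commute[of _ "v _"])
  show "AE x in lebesgue. norm (v x * box_bump a b n x) \<le> norm (indicat_real (cbox a b) x *\<^sub>R v x)" for n
    by (rule AE_I2) (auto simp: indicator_def box_bump_outside abs_mult box_bump_bounds mult_left_le)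
qed

text \<open>The bumps of a box are admissible test functions that converge boundedly to the indicator of the
box, so all box integrals of \<open>f\<close> vanish.\<close>

lemma fundamental_lemma:
  fixes f :: "'a::euclidean_space \<Rightarrow> real"
  assumes f: "locally_integrable f"
    and zero: "\<And>\<psi>. \<psi> \<in> Cc_infinity \<Longrightarrow> (LINT x|lebesgue. f x * \<psi> x) = 0"
  shows "AE x in lebesgue. f x = 0"
proof -
  have "(LINT x:box a b|lebesgue. f x) = 0" for a b
    using integral_box_bump_tendsto[OF f, of a b] unfolding zero[OF box_bump_in_Cc_infinity]
    by (simp add: LIMSEQ_const_iff)
  from AE_zero_if_box_integrals_zero[OF f open_UNIV this] show ?thesis by simp
qed

lemma has_weak_gradient_locally_integrable:
  assumes "has_weak_gradient u g" shows "locally_integrable u" "locally_integrable g"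
  using assms by (auto simp: has_weak_gradient_def locally_integrable_def)

lemma locally_integrable_inner:
  fixes g :: "'a::euclidean_space \<Rightarrow> 'a"
  assumes "locally_integrable g" shows "locally_integrable (\<lambda>x. g x \<bullet> i)"
  unfolding locally_integrable_def set_integrable_def
proof (intro allI impI)
  fix S :: "'a set" assume "compact S"
  then have "integrable lebesgue (\<lambda>x. (indicat_real S x *\<^sub>R g x) \<bullet> i)"
    using assms by (intro integrable_inner_left) (auto simp: locally_integrable_def set_integrable_def)
  then show "integrable lebesgue (\<lambda>x. indicat_real S x *\<^sub>R (g x \<bullet> i))" by simp
qed

lemma locally_integrable_lincomb:
  fixes u v :: "'a::euclidean_space \<Rightarrow> 'b::euclidean_space"
  assumes "locally_integrable u" "locally_integrable v"
  shows "locally_integrable (\<lambda>x. a *\<^sub>R u x + b *\<^sub>R v x)"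
  using assms unfolding locally_integrable_def
  by (auto intro!: set_integral_add set_integrable_scaleR_right)

lemma has_weak_gradient_integrable:
  assumes "has_weak_gradient u g" "\<phi> \<in> Cc_infinity"
  shows "integrable lebesgue (\<lambda>x. u x * frechet_derivative \<phi> (at x) i)"
    "integrable lebesgue (\<lambda>x. (g x \<bullet> j) * \<phi> x)"
proof -
  obtain S B where S: "compact S" 
    "continuous_on UNIV \<phi>" "continuous_on UNIV (\<lambda>x. frechet_derivative \<phi> (at x) i)"
    "\<And>x. x \<notin> S \<Longrightarrow> \<phi> x = 0" "\<And>x. x \<notin> S \<Longrightarrow> frechet_derivative \<phi> (at x) i = 0"
    "\<And>x. \<bar>\<phi> x\<bar> \<le> B" "\<And>x. \<bar>frechet_derivative \<phi> (at x) i\<bar> \<le> B"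
    using test_function_properties[OF assms(2)] by metis
  note l = has_weak_gradient_locally_integrable[OF assms(1)]
  show "integrable lebesgue (\<lambda>x. u x * frechet_derivative \<phi> (at x) i)"
    using integrable_mult_compact_support[OF l(1) continuous_measurable_lebesgue[OF S(3)] S(1) S(7) S(5)]
    by (simp add: mult.commute)
  show "integrable lebesgue (\<lambda>x. (g x \<bullet> j) * \<phi> x)"
    using integrable_mult_compact_support[OF locally_integrable_inner[OF l(2), of j]
        continuous_measurable_lebesgue[OF S(2)] S(1) S(6) S(4)]
    by (simp add: mult.commute)
qed

lemma has_weak_gradient_lincomb:
  assumes u: "has_weak_gradient u g" and v: "has_weak_gradient v h"
  shows "has_weak_gradient (\<lambda>x. a * u x + b * v x) (\<lambda>x. a *\<^sub>R g x + b *\<^sub>R h x)"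
  unfolding has_weak_gradient_def
proof (intro conjI ballI)
  note lu = has_weak_gradient_locally_integrable[OF u]
    and lv = has_weak_gradient_locally_integrable[OF v]
  show "\<forall>S. compact S \<longrightarrow> set_integrable lebesgue S (\<lambda>x. a * u x + b * v x) \<and>
      set_integrable lebesgue S (\<lambda>x. a *\<^sub>R g x + b *\<^sub>R h x)"
    using locally_integrable_lincomb[OF lu(1) lv(1), of a b]
      locally_integrable_lincomb[OF lu(2) lv(2), of a b]
    by (simp add: locally_integrable_def)
next
  fix \<phi> :: "'a \<Rightarrow> real" and i :: 'a
  assume \<phi>: "\<phi> \<in> Cc_infinity" and i: "i \<in> Basis"
  let ?d = "\<lambda>x. frechet_derivative \<phi> (at x) i"
  note iu = has_weak_gradient_integrable[OF u \<phi>] and iv = has_weak_gradient_integrable[OF v \<phi>]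
  have "(LINT x|lebesgue. (a * u x + b * v x) * ?d x)
      = (LINT x|lebesgue. a * (u x * ?d x) + b * (v x * ?d x))"
    by (simp add: algebra_simps)
  also have "\<dots> = a * (LINT x|lebesgue. u x * ?d x) + b * (LINT x|lebesgue. v x * ?d x)"
    using iu iv by (subst Bochner_Integration.integral_add) auto
  also have "\<dots> = - (a * (LINT x|lebesgue. (g x \<bullet> i) * \<phi> x) + b * (LINT x|lebesgue. (h x \<bullet> i) * \<phi> x))"
    using u v \<phi> i by (simp add: has_weak_gradient_def)
  also have "a * (LINT x|lebesgue. (g x \<bullet> i) * \<phi> x) + b * (LINT x|lebesgue. (h x \<bullet> i) * \<phi> x)
      = (LINT x|lebesgue. a * ((g x \<bullet> i) * \<phi> x) + b * ((h x \<bullet> i) * \<phi> x))"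
    using iu iv by (subst Bochner_Integration.integral_add) auto
  also have "\<dots> = (LINT x|lebesgue. ((a *\<^sub>R g x + b *\<^sub>R h x) \<bullet> i) * \<phi> x)"
    by (simp add: algebra_simps)
  finally show "(LINT x|lebesgue. (a * u x + b * v x) * ?d x)
      = - (LINT x|lebesgue. ((a *\<^sub>R g x + b *\<^sub>R h x) \<bullet> i) * \<phi> x)" .
qed

lemma has_weak_gradient_unique:
  fixes u :: "'a::euclidean_space \<Rightarrow> real"
  assumes "has_weak_gradient u g" "has_weak_gradient u h"
  shows "AE x in lebesgue. g x = h x"
proof -
  let ?k = "\<lambda>x. 1 *\<^sub>R g x + (- 1) *\<^sub>R h x"
  have k: "has_weak_gradient (\<lambda>x. 1 * u x + (- 1) * u x) ?k"
    using assms by (rule has_weak_gradient_lincomb)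
  have "AE x in lebesgue. ?k x \<bullet> i = 0" if i: "i \<in> Basis" for i
  proof (rule fundamental_lemma)
    show "locally_integrable (\<lambda>x. ?k x \<bullet> i)"
      by (intro locally_integrable_inner has_weak_gradient_locally_integrable(2)[OF k])
    show "(LINT x|lebesgue. (?k x \<bullet> i) * \<psi> x) = 0" if "\<psi> \<in> Cc_infinity" for \<psi>
      using k that i unfolding has_weak_gradient_def by simp
  qed
  then have "AE x in lebesgue. \<forall>i\<in>Basis. ?k x \<bullet> i = 0"
    by (intro AE_finite_allI) auto
  then show ?thesis
    by eventually_elim (rule euclidean_eqI, simp add: inner_diff_left)
qed

text \<open>Frees \<open>D12_norm\<close> from the choice in \<open>weak_gradient\<close>: any weak gradient computes it.\<close>

lemma D12_norm_eq:
  assumes "has_weak_gradient u g"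
  shows "D12_norm u = sqrt (LINT x|lebesgue. (norm (g x))\<^sup>2)"
proof -
  have "has_weak_gradient u (weak_gradient u)"
    unfolding weak_gradient_def by (rule someI[of "has_weak_gradient u", OF assms])
  from has_weak_gradient_unique[OF this assms] have "AE x in lebesgue. weak_gradient u x = g x" .
  moreover have "weak_gradient u \<in> borel_measurable lebesgue" "g \<in> borel_measurable lebesgue"
    using \<open>has_weak_gradient u (weak_gradient u)\<close> assms
    by (auto intro!: locally_integrable_measurable has_weak_gradient_locally_integrable)
  ultimately show ?thesis
    unfolding D12_norm_def
    by (intro arg_cong[where f = sqrt] integral_cong_AE) auto
qed

section \<open>Translating boxes, and gradients of smooth functions\<close>

lemma bump_isCont: "isCont (bump a b n) s"
  unfolding bump_def
  by (intro isCont_mult isCont_o2[OF _ DERIV_isCont[OF flat_exp_has_derivative]]) auto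

lemma bump_primitive:
  obtains P where "\<And>s. (P has_real_derivative bump a b n s) (at s)"
  using einterval_antiderivative[of "-\<infinity>" \<infinity> "bump a b n"] bump_isCont
  by (auto simp: has_real_derivative_iff_has_vector_derivative)

text \<open>If \<open>\<theta>\<close> is the increment \<open>P s - P (s - t)\<close> of a primitive of a bump, then the product of \<open>\<theta>\<close> in the
direction \<open>i\<close> with bumps in the other directions is a test function. Its derivative in direction \<open>i\<close>
is the bump of the box minus the bump of the translated box, and the function itself is bounded by \<open>t\<close>
and supported in the swept-out region. Testing the weak gradient against it gives the estimate, which
says that a function with small gradient has almost translation-invariant box integrals.\<close>

lemma weak_gradient_translation:
  fixes v :: "'a::euclidean_space \<Rightarrow> real"
  assumes wg: "has_weak_gradient v g" and i: "i \<in> Basis" and t: "t \<ge> 0"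
  shows "\<bar>(LINT x:box a b|lebesgue. v x) - (LINT x:box (a + t *\<^sub>R i) (b + t *\<^sub>R i)|lebesgue. v x)\<bar>
    \<le> t * (LINT x:cbox a (b + t *\<^sub>R i)|lebesgue. norm (g x))"
proof -
  let ?a = "a + t *\<^sub>R i" and ?b = "b + t *\<^sub>R i"
  let ?I = "\<lambda>n. (LINT x|lebesgue. v x * box_bump a b n x) - (LINT x|lebesgue. v x * box_bump ?a ?b n x)"
  let ?C = "t * (LINT x:cbox a ?b|lebesgue. norm (g x))"
  note lv = has_weak_gradient_locally_integrable(1)[OF wg]
    and lg = has_weak_gradient_locally_integrable(2)[OF wg]
  have "\<bar>?I n\<bar> \<le> ?C" for n
  proof -
    obtain P where P: "\<And>s. (P has_real_derivative bump (a \<bullet> i) (b \<bullet> i) n s) (at s)"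
      using bump_primitive[of "a \<bullet> i" "b \<bullet> i" n] by metis
    define \<theta> where "\<theta> s = P s - P (s - t)" for s
    have shift: "bump (a \<bullet> i) (b \<bullet> i) n (s - t) = bump (a \<bullet> i + t) (b \<bullet> i + t) n s" for s
      by (simp add: bump_def algebra_simps)
    have \<theta>': "(\<theta> has_real_derivative
        bump (a \<bullet> i) (b \<bullet> i) n s - bump (a \<bullet> i + t) (b \<bullet> i + t) n s) (at s)" for s
    proof -
      have "((\<lambda>s. P (s - t)) has_real_derivative bump (a \<bullet> i) (b \<bullet> i) n (s - t) * 1) (at s)"
        by (rule DERIV_chain2[OF P]) (auto intro!: derivative_eq_intros)
      then show ?thesis
        unfolding \<theta>_def shift[symmetric] by (intro DERIV_diff P) simp
    qed
    \<comment> \<open>The closed interval for \<open>z\<close> covers the case \<open>t = 0\<close>.\<close>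
    have mvt: "\<exists>z. s - t \<le> z \<and> z \<le> s \<and> \<theta> s = t * bump (a \<bullet> i) (b \<bullet> i) n z" for s
    proof (cases "t = 0")
      case False
      then have "s - t < s" using t by simp
      from MVT2[OF this P] obtain z where "s - t < z" "z < s"
        "P s - P (s - t) = (s - (s - t)) * bump (a \<bullet> i) (b \<bullet> i) n z" by blast
      then show ?thesis by (intro exI[of _ z]) (simp add: \<theta>_def)
    qed (auto simp: \<theta>_def)
    have \<theta>_le: "\<bar>\<theta> s\<bar> \<le> t" for s
    proof -
      obtain z where "\<theta> s = t * bump (a \<bullet> i) (b \<bullet> i) n z" using mvt by blast
      then show ?thesis
        using t by (simp add: abs_mult bump_nonneg bump_le_1 mult_left_le)
    qed
    have \<theta>_out: "\<theta> s = 0" if "s \<notin> {a \<bullet> i..b \<bullet> i + t}" for s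
    proof -
      obtain z where z: "s - t \<le> z" "z \<le> s" "\<theta> s = t * bump (a \<bullet> i) (b \<bullet> i) n z"
        using mvt by blast
      have "z \<notin> {a \<bullet> i<..<b \<bullet> i}" using z(1,2) that by auto
      then show ?thesis using z(3) by (simp add: bump_outside)
    qed
    define h where "h j = (if j = i then \<theta> else bump (a \<bullet> j) (b \<bullet> j) n)" for j
    let ?H = "\<lambda>x. \<Prod>j\<in>Basis. h j (x \<bullet> j)"
    have H: "?H \<in> Cc_infinity"
    proof (rule product_test_function[where a = a and b = ?b])
      fix j :: 'a assume j: "j \<in> Basis"
      show "(\<lambda>x. h j (x \<bullet> j)) \<in> smooth_family"
      proof (cases "j = i")
        case True
        have "(\<lambda>x. bump (a \<bullet> i) (b \<bullet> i) n (x \<bullet> i) + (- 1) * bump (a \<bullet> i + t) (b \<bullet> i + t) n (x \<bullet> i))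
            \<in> smooth_family"
          by (intro smooth_family.add smooth_family.mult smooth_family.const bump_smooth)
        then have "(\<lambda>x. \<theta> (x \<bullet> i)) \<in> smooth_family"
          by (intro smooth_family.primitive[OF \<theta>']) simp
        then show ?thesis using True by (simp add: h_def)
      qed (simp add: h_def bump_smooth)
      fix s assume "s \<notin> {a \<bullet> j..?b \<bullet> j}"
      then show "h j s = 0"
        using i j by (auto simp: h_def inner_simps inner_Basis \<theta>_out bump_outside)
    qed
    have dH: "frechet_derivative ?H (at x) i = box_bump a b n x - box_bump ?a ?b n x" for x
    proof -
      have *: "(\<Prod>j\<in>Basis - {i}. h j (x \<bullet> j)) = (\<Prod>j\<in>Basis - {i}. bump (a \<bullet> j) (b \<bullet> j) n (x \<bullet> j))"
        "(\<Prod>j\<in>Basis - {i}. h j (x \<bullet> j)) = (\<Prod>j\<in>Basis - {i}. bump (?a \<bullet> j) (?b \<bullet> j) n (x \<bullet> j))"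
        using i by (auto intro!: prod.cong simp: h_def inner_simps inner_Basis split: if_splits)
      have "?H differentiable (at x)" using H by (metis test_function_properties)
      moreover have "(h i has_real_derivative
        bump (a \<bullet> i) (b \<bullet> i) n (x \<bullet> i) - bump (a \<bullet> i + t) (b \<bullet> i + t) n (x \<bullet> i)) (at (x \<bullet> i))"
        using \<theta>' by (simp add: h_def)
      ultimately have "frechet_derivative ?H (at x) i =
        (bump (a \<bullet> i) (b \<bullet> i) n (x \<bullet> i) - bump (a \<bullet> i + t) (b \<bullet> i + t) n (x \<bullet> i)) *
          (\<Prod>j\<in>Basis - {i}. h j (x \<bullet> j))"
        using i by (intro frechet_derivative_product)
      also have "\<dots> = box_bump a b n x - box_bump ?a ?b n x"
      proof -
        have "box_bump c d n x = bump (c \<bullet> i) (d \<bullet> i) n (x \<bullet> i)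
            * (\<Prod>j\<in>Basis - {i}. bump (c \<bullet> j) (d \<bullet> j) n (x \<bullet> j))" for c d
          unfolding box_bump_def by (rule prod.remove[OF finite_Basis i])
        from this[of a b] this[of ?a ?b] show ?thesis
          unfolding *[symmetric] left_diff_distrib using i by (simp add: inner_simps)
      qed
      finally show ?thesis .
    qed
    have H_le: "\<bar>?H x\<bar> \<le> t" for x
    proof -
      have "\<bar>?H x\<bar> = \<bar>\<theta> (x \<bullet> i)\<bar> * (\<Prod>j\<in>Basis - {i}. \<bar>h j (x \<bullet> j)\<bar>)"
        using prod.remove[OF finite_Basis i, of "\<lambda>j. \<bar>h j (x \<bullet> j)\<bar>"] by (simp add: abs_prod h_def)
      also have "\<dots> \<le> t * 1"
        by (intro mult_mono \<theta>_le prod_le_1) (auto simp: h_def bump_nonneg bump_le_1 t prod_nonneg)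
      finally show ?thesis by simp
    qed
    have H_out: "?H x = 0" if x: "x \<notin> cbox a ?b" for x
    proof -
      from x obtain j where j: "j \<in> Basis" "x \<bullet> j \<notin> {a \<bullet> j..?b \<bullet> j}"
        by (force simp: mem_box)
      then have "h j (x \<bullet> j) = 0"
        using i by (auto simp: h_def inner_simps inner_Basis \<theta>_out bump_outside)
      then show ?thesis using j by (auto intro!: prod_zero)
    qed
    have "?I n = (LINT x|lebesgue. v x * frechet_derivative ?H (at x) i)"
      unfolding dH right_diff_distrib
      by (rule Bochner_Integration.integral_diff[symmetric]) (intro integrable_mult_box_bump lv)+
    also have "\<dots> = - (LINT x|lebesgue. (g x \<bullet> i) * ?H x)"
      using wg H i unfolding has_weak_gradient_def by blast
    finally have "\<bar>?I n\<bar> = norm (LINT x|lebesgue. (g x \<bullet> i) * ?H x)" by simp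
    also have "\<dots> \<le> (LINT x|lebesgue. t * (indicator (cbox a ?b) x *\<^sub>R norm (g x)))"
    proof (rule Bochner_Integration.integral_norm_bound_integral)
      show "integrable lebesgue (\<lambda>x. (g x \<bullet> i) * ?H x)"
        by (rule has_weak_gradient_integrable(2)[OF wg H])
      have "set_integrable lebesgue (cbox a ?b) g"
        using lg by (simp add: locally_integrable_def)
      then show "integrable lebesgue (\<lambda>x. t * (indicator (cbox a ?b) x *\<^sub>R norm (g x)))"
        using set_integrable_norm unfolding set_integrable_def by (intro integrable_mult_right) blast
      show "norm ((g x \<bullet> i) * ?H x) \<le> t * (indicator (cbox a ?b) x *\<^sub>R norm (g x))" for x
      proof (cases "x \<in> cbox a ?b")
        case True
        have "\<bar>g x \<bullet> i\<bar> * \<bar>?H x\<bar> \<le> norm (g x) * t"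
          using Basis_le_norm[OF i] H_le by (intro mult_mono) auto
        then show ?thesis using True by (simp add: abs_mult mult.commute)
      qed (simp add: H_out)
    qed
    also have "\<dots> = ?C"
      unfolding set_lebesgue_integral_def by (rule integral_mult_right_zero)
    finally show ?thesis .
  qed
  moreover have "(\<lambda>n. \<bar>?I n\<bar>) \<longlonglongrightarrow>
      \<bar>(LINT x:box a b|lebesgue. v x) - (LINT x:box ?a ?b|lebesgue. v x)\<bar>"
    by (intro tendsto_intros integral_box_bump_tendsto lv)
  ultimately show ?thesis
    by (intro LIMSEQ_le_const2) auto
qed

lemma integral_translation:
  fixes F :: "'a::euclidean_space \<Rightarrow> real"
  assumes "continuous_on UNIV F"
  shows "(LINT x|lebesgue. F (c + x)) = (LINT x|lebesgue. F x)"
proof -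
  have F: "F \<in> borel_measurable borel"
    using assms by (rule borel_measurable_continuous_onI)
  have "(LINT x|lebesgue. F (c + x)) = (LINT x|lborel. F (c + x))"
    using F by (intro integral_completion) simp
  also have "\<dots> = (LINT x|distr lborel borel ((+) c). F x)"
    using F by (subst integral_distr) auto
  also have "\<dots> = (LINT x|lebesgue. F x)"
    using F by (simp add: lborel_distr_plus integral_completion)
  finally show ?thesis .
qed

text \<open>The integral of \<open>F\<close> is invariant under translations, so the difference quotients integrate to zero;
they converge to \<open>F'\<close> and are dominated by a multiple of the indicator of a ball. This gives
integration by parts without iterated integrals.\<close>

lemma integral_directional_derivative:
  fixes F F' :: "'a::euclidean_space \<Rightarrow> real"
  assumes F: "continuous_on UNIV F" and F': "continuous_on UNIV F'" and S: "compact S"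
    and "\<And>x. x \<notin> S \<Longrightarrow> F x = 0" "\<And>x. x \<notin> S \<Longrightarrow> F' x = 0" and bound: "\<And>x. \<bar>F' x\<bar> \<le> B"
    and deriv: "\<And>x s. ((\<lambda>s. F (x + s *\<^sub>R i)) has_real_derivative F' (x + s *\<^sub>R i)) (at s)"
  shows "(LINT x|lebesgue. F' x) = 0"
proof -
  define t where "t n = inverse (real (Suc n))" for n
  have t: "0 < t n" "t n \<le> 1" for n
    by (auto simp: t_def divide_simps)
  define D where "D n x = (F (t n *\<^sub>R i + x) - F x) / t n" for n x
  have int: "integrable lebesgue F"
    using integrable_continuous_compact_support assms by blast
  have int_t: "integrable lebesgue (\<lambda>x. F (t n *\<^sub>R i + x))" for n
  proof (rule integrable_continuous_compact_support)
    show "continuous_on UNIV (\<lambda>x. F (t n *\<^sub>R i + x))"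
      by (rule continuous_on_compose2[OF F]) (auto intro!: continuous_intros)
    show "compact ((\<lambda>x. - (t n *\<^sub>R i) + x) ` S)"
      using S by (rule compact_translation)
    show "F (t n *\<^sub>R i + x) = 0" if "x \<notin> (\<lambda>x. - (t n *\<^sub>R i) + x) ` S" for x
      using that assms(4) by (force simp: image_iff)
  qed
  obtain R where R: "\<forall>x\<in>S. norm x \<le> R"
    using compact_imp_bounded[OF S] by (auto simp: bounded_iff)
  have "(\<lambda>n. LINT x|lebesgue. D n x) \<longlonglongrightarrow> (LINT x|lebesgue. F' x)"
  proof (rule integral_dominated_convergence)
    let ?w = "\<lambda>x::'a. B * indicat_real (cball 0 (R + norm i)) x"
    show "F' \<in> borel_measurable lebesgue" using F' by (rule continuous_measurable_lebesgue)
    show "D n \<in> borel_measurable lebesgue" for n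
      unfolding D_def using int int_t by (intro borel_measurable_integrable) auto
    show "integrable lebesgue ?w"
      using fmeasurableD2[OF lmeasurable_cball] by (auto simp: less_top intro!: integrable_real_indicator)
    show "AE x in lebesgue. (\<lambda>n. D n x) \<longlonglongrightarrow> F' x"
    proof (rule AE_I2)
      fix x
      have "t \<longlonglongrightarrow> 0" unfolding t_def by (rule LIMSEQ_inverse_real_of_nat)
      then have "filterlim t (at 0) sequentially"
        using t(1) by (auto simp: filterlim_at less_imp_neq[symmetric])
      moreover have "((\<lambda>h. (F (x + (0 + h) *\<^sub>R i) - F (x + 0 *\<^sub>R i)) / h) \<longlongrightarrow> F' (x + 0 *\<^sub>R i)) (at 0)"
        using deriv[of x 0] by (simp only: DERIV_def)
      ultimately show "(\<lambda>n. D n x) \<longlonglongrightarrow> F' x"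
        unfolding D_def by (auto dest: filterlim_compose simp: add.commute)
    qed
    show "AE x in lebesgue. norm (D n x) \<le> ?w x" for n
    proof (rule AE_I2)
      fix x
      obtain z where z: "0 < z" "z < t n"
        "F (x + t n *\<^sub>R i) - F (x + 0 *\<^sub>R i) = (t n - 0) * F' (x + z *\<^sub>R i)"
        using MVT2[OF t(1), of n "\<lambda>s. F (x + s *\<^sub>R i)" "\<lambda>s. F' (x + s *\<^sub>R i)"] deriv by blast
      then have D: "D n x = F' (x + z *\<^sub>R i)"
        using t(1)[of n] by (simp add: D_def add.commute field_simps)
      show "norm (D n x) \<le> ?w x"
      proof (cases "x \<in> cball 0 (R + norm i)")
        case False
        have "norm x \<le> norm (x + z *\<^sub>R i) + norm (z *\<^sub>R i)"
          by (metis add_diff_cancel_right' norm_triangle_ineq4)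
        also have "norm (z *\<^sub>R i) \<le> 1 * norm i"
          using z t(2)[of n] unfolding norm_scaleR by (intro mult_right_mono) auto
        finally have "R < norm (x + z *\<^sub>R i)" using False by simp
        then have "x + z *\<^sub>R i \<notin> S" using R by force
        then show ?thesis using False by (simp add: D assms(5))
      qed (simp add: D bound)
    qed
  qed
  moreover have "(LINT x|lebesgue. D n x) = 0" for n
    unfolding D_def using int int_t integral_translation[OF F] by simp
  ultimately show ?thesis
    by (simp add: LIMSEQ_const_iff)
qed

lemma directional_derivative:
  fixes f :: "'a::euclidean_space \<Rightarrow> real"
  assumes "f differentiable (at (x + s *\<^sub>R v))"
  shows "((\<lambda>s. f (x + s *\<^sub>R v)) has_real_derivative frechet_derivative f (at (x + s *\<^sub>R v)) v) (at s)"
proof -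
  have 1: "(f has_derivative frechet_derivative f (at (x + s *\<^sub>R v))) (at (x + s *\<^sub>R v))"
    using assms by (simp add: frechet_derivative_works)
  have 2: "((\<lambda>s. x + s *\<^sub>R v) has_derivative (\<lambda>t. t *\<^sub>R v)) (at s)"
    by (auto intro!: derivative_eq_intros)
  have "frechet_derivative f (at (x + s *\<^sub>R v)) (t *\<^sub>R v) = frechet_derivative f (at (x + s *\<^sub>R v)) v * t" for t
    using linear_scale[OF linear_frechet_derivative[OF assms]] by simp
  with has_derivative_compose[OF 2 1] show ?thesis
    by (simp add: has_field_derivative_def)
qed

definition classical_gradient :: "('a::euclidean_space \<Rightarrow> real) \<Rightarrow> 'a \<Rightarrow> 'a" where
  "classical_gradient \<phi> x = (\<Sum>i\<in>Basis. frechet_derivative \<phi> (at x) i *\<^sub>R i)"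

lemma classical_gradient_inner_Basis:
  "i \<in> Basis \<Longrightarrow> classical_gradient \<phi> x \<bullet> i = frechet_derivative \<phi> (at x) i"
  by (simp add: classical_gradient_def)

lemma classical_gradient_inner:
  assumes "\<phi> differentiable (at x)"
  shows "classical_gradient \<phi> x \<bullet> v = frechet_derivative \<phi> (at x) v"
proof -
  have l: "linear (frechet_derivative \<phi> (at x))" using assms by (rule linear_frechet_derivative)
  have "frechet_derivative \<phi> (at x) v = frechet_derivative \<phi> (at x) (\<Sum>i\<in>Basis. (v \<bullet> i) *\<^sub>R i)"
    by (simp add: euclidean_representation)
  also have "\<dots> = (\<Sum>i\<in>Basis. (v \<bullet> i) * frechet_derivative \<phi> (at x) i)"
    using l by (simp add: linear_sum linear_scale)
  also have "\<dots> = classical_gradient \<phi> x \<bullet> v"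
    unfolding classical_gradient_def inner_sum_left inner_scaleR_left
    by (simp add: mult.commute inner_commute)
  finally show ?thesis by simp
qed

text \<open>Integration by parts: the derivative of the product of two test functions has integral zero.\<close>

lemma test_function_has_weak_gradient:
  fixes \<phi> :: "'a::euclidean_space \<Rightarrow> real"
  assumes \<phi>: "\<phi> \<in> Cc_infinity"
  shows "has_weak_gradient \<phi> (classical_gradient \<phi>)"
  unfolding has_weak_gradient_def
proof (intro conjI allI impI ballI)
  fix S :: "'a set" assume "compact S"
  then have S: "S \<in> sets lebesgue" by (intro fmeasurableD lmeasurable_compact)
  have "integrable lebesgue \<phi>"
    using test_function_properties[OF \<phi>] integrable_continuous_compact_support by metis
  then show "set_integrable lebesgue S \<phi>"
    unfolding set_integrable_def using S by (rule integrable_mult_indicator[rotated])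
  have "integrable lebesgue (\<lambda>x. frechet_derivative \<phi> (at x) i)" for i
    using test_function_properties[OF \<phi>] integrable_continuous_compact_support
    by (metis (no_types, lifting))
  then have "integrable lebesgue (classical_gradient \<phi>)"
    unfolding classical_gradient_def by (intro Bochner_Integration.integrable_sum integrable_scaleR_left) auto
  then show "set_integrable lebesgue S (classical_gradient \<phi>)"
    unfolding set_integrable_def using S by (rule integrable_mult_indicator[rotated])
next
  fix \<psi> :: "'a \<Rightarrow> real" and i :: 'a
  assume \<psi>: "\<psi> \<in> Cc_infinity" and i: "i \<in> Basis"
  let ?p = "\<lambda>x. frechet_derivative \<phi> (at x) i" and ?q = "\<lambda>x. frechet_derivative \<psi> (at x) i"
  obtain S B where S: "compact S" and dp: "\<And>x. \<phi> differentiable (at x)"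
    and p: "continuous_on UNIV \<phi>" "continuous_on UNIV ?p"
    "\<And>x. x \<notin> S \<Longrightarrow> \<phi> x = 0" "\<And>x. x \<notin> S \<Longrightarrow> ?p x = 0" "\<And>x. \<bar>\<phi> x\<bar> \<le> B" "\<And>x. \<bar>?p x\<bar> \<le> B"
    by (rule test_function_properties[OF \<phi>, of i]) blast
  obtain T C where T: "compact T" and dq: "\<And>x. \<psi> differentiable (at x)"
    and q: "continuous_on UNIV \<psi>" "continuous_on UNIV ?q"
    "\<And>x. x \<notin> T \<Longrightarrow> \<psi> x = 0" "\<And>x. x \<notin> T \<Longrightarrow> ?q x = 0" "\<And>x. \<bar>\<psi> x\<bar> \<le> C" "\<And>x. \<bar>?q x\<bar> \<le> C"
    by (rule test_function_properties[OF \<psi>, of i]) blast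
  have B: "B \<ge> 0" using p(5)[of 0] by linarith
  have "(LINT x|lebesgue. \<phi> x * ?q x + ?p x * \<psi> x) = 0"
  proof (rule integral_directional_derivative[OF _ _ S, where F = "\<lambda>x. \<phi> x * \<psi> x" and i = i])
    show "\<bar>\<phi> x * ?q x + ?p x * \<psi> x\<bar> \<le> B * C + B * C" for x
    proof -
      have "\<bar>\<phi> x * ?q x\<bar> \<le> B * C" "\<bar>?p x * \<psi> x\<bar> \<le> B * C"
        unfolding abs_mult using p q B by (auto intro!: mult_mono)
      then show ?thesis by linarith
    qed
    show "((\<lambda>s. \<phi> (x + s *\<^sub>R i) * \<psi> (x + s *\<^sub>R i)) has_real_derivative
      \<phi> (x + s *\<^sub>R i) * ?q (x + s *\<^sub>R i) + ?p (x + s *\<^sub>R i) * \<psi> (x + s *\<^sub>R i)) (at s)" for x s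
      using DERIV_mult[OF directional_derivative[OF dp[of "x + s *\<^sub>R i"]]
          directional_derivative[OF dq[of "x + s *\<^sub>R i"]]]
      by (simp add: algebra_simps)
  qed (use p q in \<open>auto intro!: continuous_intros\<close>)
  moreover have "integrable lebesgue (\<lambda>x. \<phi> x * ?q x)" "integrable lebesgue (\<lambda>x. ?p x * \<psi> x)"
    using p q S by (auto intro!: integrable_continuous_compact_support[of _ S] continuous_intros)
  ultimately show "(LINT x|lebesgue. \<phi> x * ?q x) = - (LINT x|lebesgue. (classical_gradient \<phi> x \<bullet> i) * \<psi> x)"
    by (simp add: classical_gradient_inner_Basis[OF i])
qed

lemma test_function_gradient_square_integrable:
  fixes \<phi> :: "'a::euclidean_space \<Rightarrow> real"
  assumes "\<phi> \<in> Cc_infinity"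
  shows "integrable lebesgue (\<lambda>x. (norm (classical_gradient \<phi> x))\<^sup>2)"
proof -
  have "integrable lebesgue (\<lambda>x. (frechet_derivative \<phi> (at x) i)\<^sup>2)" for i
  proof -
    obtain S B where "compact S" "continuous_on UNIV (\<lambda>x. frechet_derivative \<phi> (at x) i)"
      "\<And>x. x \<notin> S \<Longrightarrow> frechet_derivative \<phi> (at x) i = 0"
      using test_function_properties[OF assms, of i] by metis
    then show ?thesis
      by (intro integrable_continuous_compact_support[of _ S]) (auto intro!: continuous_intros)
  qed
  then have "integrable lebesgue (\<lambda>x. \<Sum>i\<in>Basis. (frechet_derivative \<phi> (at x) i)\<^sup>2)"
    by (intro Bochner_Integration.integrable_sum)
  moreover have "(\<Sum>i\<in>Basis. (frechet_derivative \<phi> (at x) i)\<^sup>2) = (norm (classical_gradient \<phi> x))\<^sup>2" for x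
    unfolding power2_norm_eq_inner
    by (subst euclidean_inner, intro sum.cong)
      (simp_all add: classical_gradient_inner_Basis power2_eq_square)
  ultimately show ?thesis by simp
qed

section \<open>The radial estimate for smooth functions\<close>

definition sphere_area :: "'a::euclidean_space itself \<Rightarrow> real" where
  "sphere_area _ = real DIM('a) * unit_ball_vol (real DIM('a))"

lemma sphere_area_pos: "sphere_area TYPE('a::euclidean_space) > 0"
  by (simp add: sphere_area_def)

text \<open>Polar coordinates for radial integrands only: the image of Lebesgue measure under the norm is
determined by the volumes of balls, so the density follows by differentiating them.\<close>

lemma distr_norm_lborel:
  "distr lborel borel (norm :: 'a::euclidean_space \<Rightarrow> real)
    = density lborel (\<lambda>r. ennreal (sphere_area TYPE('a) * r ^ (DIM('a) - 1)) * indicator {0..} r)"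
    (is "?M = ?N")
proof (rule measure_eqI_generator_eq[where E = "range (\<lambda>a. {..a})" and \<Omega> = UNIV
      and A = "\<lambda>n. {..real n}"])
  show "Int_stable (range (\<lambda>a::real. {..a}))"
    by (auto simp: Int_stable_def)
  show "sets ?M = sigma_sets UNIV (range (\<lambda>a::real. {..a}))"
    "sets ?N = sigma_sets UNIV (range (\<lambda>a::real. {..a}))"
    by (simp_all add: borel_eq_atMost)
  have l: "emeasure ?M {..b} = emeasure lborel (cball (0::'a) b)" for b
    by (subst emeasure_distr) (auto intro!: arg_cong2[where f = emeasure])
  have "emeasure ?M {..b} = emeasure ?N {..b}" for b
  proof (cases "b \<ge> 0")
    case True
    let ?F = "\<lambda>r. unit_ball_vol (real DIM('a)) * r ^ DIM('a)"
    have "emeasure ?N {..b} = (\<integral>\<^sup>+r. ennreal (sphere_area TYPE('a) * r ^ (DIM('a) - 1)) * indicator {0..b} r \<partial>lborel)"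
      by (subst emeasure_density) (auto intro!: nn_integral_cong simp: indicator_def)
    also have "\<dots> = ennreal (?F b - ?F 0)"
    proof (rule nn_integral_FTC_Icc)
      show "(?F has_real_derivative sphere_area TYPE('a) * r ^ (DIM('a) - 1)) (at r)" for r
        by (auto intro!: derivative_eq_intros simp: sphere_area_def)
    qed (use True in \<open>auto simp: sphere_area_def\<close>)
    also have "\<dots> = emeasure lborel (cball (0::'a) b)"
      using True by (simp add: emeasure_cball)
    finally show ?thesis by (simp add: l)
  next
    case False
    then have "emeasure ?N {..b} = 0"
      by (subst emeasure_density) (auto simp: nn_integral_0_iff_AE indicator_def)
    with False show ?thesis by (simp add: l)
  qed
  then show "\<And>X. X \<in> range (\<lambda>a. {..a}) \<Longrightarrow> emeasure ?M X = emeasure ?N X" by auto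
  show "(\<Union>n. {..real n}) = (UNIV :: real set)"
    using real_arch_simple by auto
  show "emeasure ?M {..real n} \<noteq> \<infinity>" for n
    by (simp add: l emeasure_cball)
qed auto

lemma nn_integral_radial:
  fixes h :: "real \<Rightarrow> ennreal"
  assumes "h \<in> borel_measurable borel"
  shows "(\<integral>\<^sup>+x. h (norm (x::'a::euclidean_space)) \<partial>lebesgue)
    = (\<integral>\<^sup>+r. ennreal (sphere_area TYPE('a) * r ^ (DIM('a) - 1)) * indicator {0..} r * h r \<partial>lborel)"
proof -
  have "(\<integral>\<^sup>+x. h (norm (x::'a)) \<partial>lebesgue) = (\<integral>\<^sup>+r. h r \<partial>distr lborel borel (norm :: 'a \<Rightarrow> real))"
    using assms by (simp add: nn_integral_completion nn_integral_distr)
  then show ?thesis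
    unfolding distr_norm_lborel using assms by (simp add: nn_integral_density)
qed

text \<open>Recovers the product form of the Cauchy--Schwarz inequality from its additive form with a free
parameter, which needs only the monotonicity of integrals.\<close>

lemma square_le_mult_if_AM_GM:
  fixes d P Q :: real
  assumes "P \<ge> 0" "Q \<ge> 0" and le: "\<And>l. l > 0 \<Longrightarrow> 2 * \<bar>d\<bar> \<le> l * P + Q / l"
  shows "d\<^sup>2 \<le> P * Q"
proof (cases "d = 0")
  case False
  have "P \<noteq> 0"
  proof
    assume "P = 0"
    with le[of "(Q + 1) / \<bar>d\<bar>"] False \<open>Q \<ge> 0\<close> have "2 * \<bar>d\<bar> \<le> Q / (Q + 1) * \<bar>d\<bar>" by simp
    also have "\<dots> \<le> 1 * \<bar>d\<bar>" using \<open>Q \<ge> 0\<close> by (intro mult_right_mono) auto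
    finally show False using False by simp
  qed
  with assms have P: "P > 0" by simp
  have "2 * \<bar>d\<bar> \<le> \<bar>d\<bar> / P * P + Q / (\<bar>d\<bar> / P)"
    using False P by (intro le) simp
  then have "\<bar>d\<bar> \<le> P * Q / \<bar>d\<bar>" using P by (simp add: mult.commute)
  then have "\<bar>d\<bar> * \<bar>d\<bar> \<le> P * Q" using False by (simp add: field_simps)
  then show ?thesis by (simp add: power2_eq_square)
qed (use assms in simp)

text \<open>Both \<open>Q - p\<close> and \<open>Q + p\<close> have nonnegative derivatives.\<close>

lemma increment_le_increment_of_primitive:
  fixes p p' w Q :: "real \<Rightarrow> real"
  assumes "r \<le> s" and p: "\<And>x. x \<in> {r..s} \<Longrightarrow> (p has_real_derivative p' x) (at x)"
    and q: "\<And>x. x \<in> {r..s} \<Longrightarrow> (Q has_real_derivative w x) (at x)"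
    and le: "\<And>x. x \<in> {r..s} \<Longrightarrow> \<bar>p' x\<bar> \<le> w x"
  shows "\<bar>p s - p r\<bar> \<le> Q s - Q r"
proof -
  have *: "\<exists>z. r \<le> z \<and> z \<le> s \<and> f s - f r = (s - r) * f' z"
    if "\<And>x. x \<in> {r..s} \<Longrightarrow> (f has_real_derivative f' x) (at x)" for f f' :: "real \<Rightarrow> real"
  proof (cases "r = s")
    case False
    with \<open>r \<le> s\<close> have "r < s" by simp
    from MVT2[OF this, of f f'] that show ?thesis by (meson atLeastAtMost_iff less_imp_le)
  qed (use \<open>r \<le> s\<close> in auto)
  have "\<exists>z. r \<le> z \<and> z \<le> s \<and> (Q s - p s) - (Q r - p r) = (s - r) * (w z - p' z)"
    by (rule *) (intro DERIV_diff p q)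
  moreover have "\<exists>z. r \<le> z \<and> z \<le> s \<and> (Q s + p s) - (Q r + p r) = (s - r) * (w z + p' z)"
    by (rule *) (intro DERIV_add p q)
  ultimately obtain y z where y: "y \<in> {r..s}" "(Q s - p s) - (Q r - p r) = (s - r) * (w y - p' y)"
    and z: "z \<in> {r..s}" "(Q s + p s) - (Q r + p r) = (s - r) * (w z + p' z)"
    by auto
  have "(s - r) * (w y - p' y) \<ge> 0" "(s - r) * (w z + p' z) \<ge> 0"
    using le[OF y(1)] le[OF z(1)] \<open>r \<le> s\<close> by auto
  with y z show ?thesis by linarith
qed

lemma radial_eq:
  assumes "radial \<phi>" "norm e = 1" "norm e' = 1" shows "\<phi> (s *\<^sub>R e) = \<phi> (s *\<^sub>R e')"
  using assms by (auto simp: radial_def)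

text \<open>Along a ray, \<open>\<phi>\<close> is a function \<open>p\<close> with \<open>\<bar>p' (norm x)\<bar>\<close> at most the norm of the gradient at every
nonzero \<open>x\<close>. Cauchy--Schwarz with the weights \<open>\<rho> ^ (N - 1)\<close> and \<open>\<rho> ^ (1 - N)\<close> bounds the increment of \<open>p\<close>; the
first weight produces the Dirichlet integral by integration in polar coordinates, and the integral of
the second is estimated through \<open>\<rho> ^ (1 - N) \<le> r ^ (3 - N) * \<rho> ^ (- 2)\<close>, which is where dimension at
least 3 enters. The factor \<open>1 / r - 1 / s\<close> yields equicontinuity and, for large \<open>s\<close>, decay.\<close>

lemma radial_increment_bound:
  fixes \<phi> :: "'a::euclidean_space \<Rightarrow> real"
  assumes dim: "DIM('a) \<ge> 3" and \<phi>: "\<phi> \<in> Cc_infinity" and rad: "radial \<phi>"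
    and e: "norm e = 1" and rs: "0 < r" "r \<le> s"
  shows "sphere_area TYPE('a) * (\<phi> (s *\<^sub>R e) - \<phi> (r *\<^sub>R e))\<^sup>2
    \<le> (LINT x|lebesgue. (norm (classical_gradient \<phi> x))\<^sup>2) * ((1 / r) ^ (DIM('a) - 3) * (1 / r - 1 / s))"
proof -
  let ?N = "DIM('a)" and ?A = "sphere_area TYPE('a)"
  let ?E = "LINT x|lebesgue. (norm (classical_gradient \<phi> x))\<^sup>2"
  have diff: "\<And>x. \<phi> differentiable (at x)"
    and cont: "continuous_on UNIV (\<lambda>x. frechet_derivative \<phi> (at x) e)"
    using test_function_properties[OF \<phi>, of e] by metis+
  define p where "p s = \<phi> (s *\<^sub>R e)" for s
  define p' where "p' s = frechet_derivative \<phi> (at (s *\<^sub>R e)) e" for s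
  have p': "(p has_real_derivative p' s) (at s)" for s
    using directional_derivative[of \<phi> 0 s e] diff by (simp add: p_def[abs_def] p'_def)
  have cont_p': "continuous_on UNIV p'"
    unfolding p'_def by (rule continuous_on_compose2[OF cont]) (auto intro!: continuous_intros)
  have grad: "\<bar>p' (norm x)\<bar> \<le> norm (classical_gradient \<phi> x)" if "x \<noteq> 0" for x
  proof -
    define v where "v = x /\<^sub>R norm x"
    have v: "norm v = 1" "x = norm x *\<^sub>R v" using that by (simp_all add: v_def)
    have "((\<lambda>s. \<phi> (s *\<^sub>R v)) has_real_derivative frechet_derivative \<phi> (at x) v) (at (norm x))"
      using directional_derivative[of \<phi> 0 "norm x" v] diff v(2) by simp
    moreover have "(\<lambda>s. \<phi> (s *\<^sub>R v)) = p"
      unfolding p_def using radial_eq[OF rad v(1) e] by simp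
    ultimately have "p' (norm x) = frechet_derivative \<phi> (at x) v"
      using p' DERIV_unique by metis
    also have "\<dots> = classical_gradient \<phi> x \<bullet> v"
      using classical_gradient_inner[OF diff] by simp
    finally show ?thesis
      using Cauchy_Schwarz_ineq2[of "classical_gradient \<phi> x" v] v(1) by simp
  qed
  define f where "f \<rho> = ?A * \<rho> ^ (?N - 1) * (p' \<rho>)\<^sup>2" for \<rho>
  have cont_f: "continuous_on UNIV f"
    unfolding f_def by (intro continuous_intros cont_p')
  obtain G where G: "\<And>x. (G has_real_derivative f x) (at x)"
    using einterval_antiderivative[of "-\<infinity>" \<infinity> f] cont_f
    by (auto simp: has_real_derivative_iff_has_vector_derivative continuous_on_eq_continuous_at)
  have f_nonneg: "f \<rho> \<ge> 0" if "\<rho> \<ge> 0" for \<rho>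
    using that sphere_area_pos[where 'a = 'a] by (simp add: f_def)
  have m: "p' \<in> borel_measurable borel"
    using cont_p' by (rule borel_measurable_continuous_onI)
  have "ennreal (G s - G r) = (\<integral>\<^sup>+\<rho>. ennreal (f \<rho>) * indicator {r..s} \<rho> \<partial>lborel)"
    using rs f_nonneg cont_f
    by (intro nn_integral_FTC_Icc[symmetric]) (auto intro!: borel_measurable_continuous_onI DERIV_subset[OF G])
  also have "\<dots> \<le> (\<integral>\<^sup>+\<rho>. ennreal (?A * \<rho> ^ (?N - 1)) * indicator {0..} \<rho> * (ennreal ((p' \<rho>)\<^sup>2)) \<partial>lborel)"
    using rs sphere_area_pos[where 'a = 'a]
    by (intro nn_integral_mono) (auto simp: f_def indicator_def ennreal_mult')
  also have "\<dots> = (\<integral>\<^sup>+x. ennreal ((p' (norm (x::'a)))\<^sup>2) \<partial>lebesgue)"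
    by (rule nn_integral_radial[symmetric]) (use m in measurable)
  also have "\<dots> \<le> (\<integral>\<^sup>+x. ennreal ((norm (classical_gradient \<phi> x))\<^sup>2) \<partial>lebesgue)"
  proof (rule nn_integral_mono_AE)
    have "AE x in lebesgue. x \<noteq> (0::'a)"
      by (rule AE_lebesgue_nonzero)
    then show "AE x in lebesgue. ennreal ((p' (norm x))\<^sup>2) \<le> ennreal ((norm (classical_gradient \<phi> x))\<^sup>2)"
      by eventually_elim (use grad in \<open>force intro!: ennreal_leI abs_le_square_iff[THEN iffD1]\<close>)
  qed
  also have "\<dots> = ennreal ?E"
    by (rule nn_integral_eq_integral[OF test_function_gradient_square_integrable[OF \<phi>]]) simp
  finally have GE: "G s - G r \<le> ?E"
    by (simp add: ennreal_le_iff)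
  let ?c = "(1 / r) ^ (?N - 3)"
  have "(p s - p r)\<^sup>2 \<le> (?E / ?A) * (?c * (1 / r - 1 / s))"
  proof (rule square_le_mult_if_AM_GM)
    show "0 \<le> ?E / ?A" using sphere_area_pos[where 'a = 'a] by simp
    show "0 \<le> ?c * (1 / r - 1 / s)" using rs by (simp add: field_simps)
    fix l :: real assume l: "l > 0"
    \<comment> \<open>A primitive of the arithmetic mean that dominates \<open>\<bar>p' \<rho>\<bar>\<close>: \<open>l\<close> weighs the energy density against \<open>\<rho> ^ (- 2)\<close>.\<close>
    let ?Q = "\<lambda>\<rho>. (l / ?A * G \<rho> - ?c / l / \<rho>) / 2"
    have "\<bar>p s - p r\<bar> \<le> ?Q s - ?Q r"
    proof (rule increment_le_increment_of_primitive[OF rs(2) p'])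
      fix \<rho> assume \<rho>: "\<rho> \<in> {r..s}"
      then have \<rho>0: "\<rho> > 0" using rs by simp
      show "(?Q has_real_derivative (l / ?A * f \<rho> + ?c / l / \<rho>\<^sup>2) / 2) (at \<rho>)"
        using \<rho>0 l rs sphere_area_pos[where 'a = 'a]
        by (auto intro!: derivative_eq_intros G simp: field_simps power2_eq_square)
      have "1 \<le> (\<rho> / r) ^ (?N - 3)"
        using \<rho> rs by (intro one_le_power) simp
      then have "(p' \<rho>)\<^sup>2 * 1 \<le> (p' \<rho>)\<^sup>2 * (\<rho> / r) ^ (?N - 3)"
        by (intro mult_left_mono) auto
      also have "\<dots> = (l * (\<rho> ^ (?N - 1) * (p' \<rho>)\<^sup>2)) * (?c / l / \<rho>\<^sup>2)"
      proof -
        have "\<rho> ^ (?N - 1) = \<rho> ^ (?N - 3) * \<rho>\<^sup>2"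
        proof -
          have "?N - 1 = (?N - 3) + 2" using dim by simp
          then show ?thesis by (simp only: power_add)
        qed
        then show ?thesis using \<rho>0 l rs by (simp add: field_simps)
      qed
      finally have "(p' \<rho>)\<^sup>2 \<le> (l * (\<rho> ^ (?N - 1) * (p' \<rho>)\<^sup>2)) * (?c / l / \<rho>\<^sup>2)" by simp
      then have "\<bar>p' \<rho>\<bar> \<le> sqrt ((l * (\<rho> ^ (?N - 1) * (p' \<rho>)\<^sup>2)) * (?c / l / \<rho>\<^sup>2))"
        by (intro real_le_rsqrt) simp
      also have "\<dots> \<le> (l * (\<rho> ^ (?N - 1) * (p' \<rho>)\<^sup>2) + ?c / l / \<rho>\<^sup>2) / 2"
        using \<rho>0 l rs by (intro arith_geo_mean_sqrt) auto
      also have "l * (\<rho> ^ (?N - 1) * (p' \<rho>)\<^sup>2) = l / ?A * f \<rho>"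
        using sphere_area_pos[where 'a = 'a] by (simp add: f_def)
      finally show "\<bar>p' \<rho>\<bar> \<le> (l / ?A * f \<rho> + ?c / l / \<rho>\<^sup>2) / 2" .
    qed
    moreover have "x \<le> P / 2 - R / 2 \<Longrightarrow> 2 * x \<le> P - R" for x P R :: real by simp
    ultimately have "2 * \<bar>p s - p r\<bar> \<le> (l / ?A * G s - ?c / l / s) - (l / ?A * G r - ?c / l / r)"
      by blast
    also have "\<dots> = l / ?A * (G s - G r) + ?c / l * (1 / r - 1 / s)"
      by (simp add: algebra_simps diff_divide_distrib)
    finally have "2 * \<bar>p s - p r\<bar> \<le> l / ?A * (G s - G r) + ?c / l * (1 / r - 1 / s)" .
    also have "l / ?A * (G s - G r) \<le> l / ?A * ?E"
      using l sphere_area_pos[where 'a = 'a] by (intro mult_left_mono GE) auto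
    finally show "2 * \<bar>p s - p r\<bar> \<le> l * (?E / ?A) + ?c * (1 / r - 1 / s) / l"
      by simp
  qed
  then have "?A * (p s - p r)\<^sup>2 \<le> ?A * ((?E / ?A) * (?c * (1 / r - 1 / s)))"
    using sphere_area_pos[where 'a = 'a] by (intro mult_left_mono) auto
  then show ?thesis
    using sphere_area_pos[where 'a = 'a] by (simp add: p_def)
qed

text \<open>The increment bound with the outer point \<open>s\<close> beyond the support.\<close>

lemma radial_pointwise_bound:
  fixes \<phi> :: "'a::euclidean_space \<Rightarrow> real"
  assumes dim: "DIM('a) \<ge> 3" and \<phi>: "\<phi> \<in> Cc_infinity" and rad: "radial \<phi>"
    and e: "norm e = 1" and r: "0 < r"
  shows "sphere_area TYPE('a) * (\<phi> (r *\<^sub>R e))\<^sup>2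
    \<le> (LINT x|lebesgue. (norm (classical_gradient \<phi> x))\<^sup>2) * (1 / r) ^ (DIM('a) - 2)"
proof -
  let ?E = "LINT x|lebesgue. (norm (classical_gradient \<phi> x))\<^sup>2" and ?c = "(1 / r) ^ (DIM('a) - 3)"
  obtain S where S: "compact S" "\<And>x. x \<notin> S \<Longrightarrow> \<phi> x = 0"
    using test_function_properties[OF \<phi>] by metis
  obtain R where R: "\<forall>x\<in>S. norm x \<le> R"
    using compact_imp_bounded[OF S(1)] by (auto simp: bounded_iff)
  define s where "s = max r (\<bar>R\<bar> + 1)"
  have s: "r \<le> s" "0 < s" "R < s" using r by (auto simp: s_def)
  have "s *\<^sub>R e \<notin> S" using R s e by force
  then have "sphere_area TYPE('a) * (\<phi> (r *\<^sub>R e))\<^sup>2 \<le> ?E * (?c * (1 / r - 1 / s))"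
    using radial_increment_bound[OF dim \<phi> rad e r s(1)] S(2) by simp
  also have "\<dots> \<le> ?E * (?c * (1 / r))"
    using r s by (intro mult_left_mono) auto
  also have "?c * (1 / r) = (1 / r) ^ Suc (DIM('a) - 3)" by simp
  also have "Suc (DIM('a) - 3) = DIM('a) - 2" using dim by simp
  finally show ?thesis .
qed

section \<open>Radial profiles\<close>

lemma square_integrable_diff:
  fixes g h :: "'a::euclidean_space \<Rightarrow> 'b::euclidean_space"
  assumes "g \<in> borel_measurable lebesgue" "h \<in> borel_measurable lebesgue"
    and g: "integrable lebesgue (\<lambda>x. (norm (g x))\<^sup>2)" and h: "integrable lebesgue (\<lambda>x. (norm (h x))\<^sup>2)"
  shows "integrable lebesgue (\<lambda>x. (norm (g x - h x))\<^sup>2)"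
    and "(LINT x|lebesgue. (norm (g x - h x))\<^sup>2)
      \<le> 2 * (LINT x|lebesgue. (norm (g x))\<^sup>2) + 2 * (LINT x|lebesgue. (norm (h x))\<^sup>2)"
proof -
  have le: "(norm (a - b))\<^sup>2 \<le> 2 * (norm a)\<^sup>2 + 2 * (norm b)\<^sup>2" for a b :: 'b
  proof -
    have "(norm (a - b))\<^sup>2 \<le> (norm a + norm b)\<^sup>2"
      by (intro power_mono norm_triangle_ineq4) simp
    also have "\<dots> \<le> 2 * (norm a)\<^sup>2 + 2 * (norm b)\<^sup>2"
      using sum_squares_bound[of "norm a" "norm b"] by (simp add: power2_sum)
    finally show ?thesis .
  qed
  have i: "integrable lebesgue (\<lambda>x. 2 * (norm (g x))\<^sup>2 + 2 * (norm (h x))\<^sup>2)"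
    using g h by simp
  then show 1: "integrable lebesgue (\<lambda>x. (norm (g x - h x))\<^sup>2)"
    by (rule Bochner_Integration.integrable_bound) (use assms(1,2) le in \<open>auto intro!: AE_I2\<close>)
  have "(LINT x|lebesgue. (norm (g x - h x))\<^sup>2) \<le> (LINT x|lebesgue. 2 * (norm (g x))\<^sup>2 + 2 * (norm (h x))\<^sup>2)"
    by (intro integral_mono 1 i le)
  then show "(LINT x|lebesgue. (norm (g x - h x))\<^sup>2)
      \<le> 2 * (LINT x|lebesgue. (norm (g x))\<^sup>2) + 2 * (LINT x|lebesgue. (norm (h x))\<^sup>2)"
    using g h by simp
qed

text \<open>A parametrised form of the Cauchy--Schwarz inequality, from \<open>a \<le> d + a\<^sup>2 / d\<close>. Choosing \<open>d\<close> of the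
size of the \<open>L\<^sup>2\<close> norm makes the right-hand side small with that norm.\<close>

lemma set_integral_norm_le_square:
  fixes g :: "'a::euclidean_space \<Rightarrow> 'b::euclidean_space"
  assumes "locally_integrable g" and g: "integrable lebesgue (\<lambda>x. (norm (g x))\<^sup>2)"
    and Q: "compact Q" and d: "d > 0"
  shows "(LINT x:Q|lebesgue. norm (g x))
    \<le> d * measure lebesgue Q + (LINT x|lebesgue. (norm (g x))\<^sup>2) / d"
proof -
  have iQ: "integrable lebesgue (indicat_real Q)"
    using lmeasurable_compact[OF Q] by (simp add: lmeasurable_iff_integrable)
  have "(LINT x:Q|lebesgue. norm (g x)) \<le> (LINT x|lebesgue. d * indicat_real Q x + (norm (g x))\<^sup>2 / d)"
    unfolding set_lebesgue_integral_def
  proof (rule integral_mono)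
    have "set_integrable lebesgue Q g" using assms(1) Q by (simp add: locally_integrable_def)
    then show "integrable lebesgue (\<lambda>x. indicat_real Q x *\<^sub>R norm (g x))"
      using set_integrable_norm unfolding set_integrable_def by blast
    show "integrable lebesgue (\<lambda>x. d * indicat_real Q x + (norm (g x))\<^sup>2 / d)"
      using iQ g by simp
    show "indicat_real Q x *\<^sub>R norm (g x) \<le> d * indicat_real Q x + (norm (g x))\<^sup>2 / d" for x
    proof -
      have "d * norm (g x) \<le> d * d + (norm (g x))\<^sup>2"
      proof (cases "norm (g x) \<le> d")
        case True
        then have "d * norm (g x) \<le> d * d" using d by simp
        then show ?thesis by (smt (verit) zero_le_power2)
      next
        case False
        then have "d * norm (g x) \<le> norm (g x) * norm (g x)" using d by (intro mult_right_mono) auto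
        moreover have "d * d \<ge> 0" by simp
        ultimately show ?thesis unfolding power2_eq_square by linarith
      qed
      then have "norm (g x) \<le> d + (norm (g x))\<^sup>2 / d"
        using d by (simp add: field_simps power2_eq_square)
      then show ?thesis using d by (simp add: indicator_def)
    qed
  qed
  also have "\<dots> = d * measure lebesgue Q + (LINT x|lebesgue. (norm (g x))\<^sup>2) / d"
    using iQ g by simp
  finally show ?thesis .
qed

lemma locally_integrable_bounded:
  fixes h :: "'a::euclidean_space \<Rightarrow> real"
  assumes "h \<in> borel_measurable lebesgue" "\<And>x. \<bar>h x\<bar> \<le> c"
  shows "locally_integrable h"
  unfolding locally_integrable_def set_integrable_def
proof (intro allI impI)
  fix S :: "'a set" assume S: "compact S"
  then have S': "S \<in> sets lebesgue" "emeasure lebesgue S < \<infinity>"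
    using lmeasurable_compact by (auto simp: fmeasurable_def)
  then have "integrable lebesgue (\<lambda>x. c * indicat_real S x)" by simp
  then show "integrable lebesgue (\<lambda>x. indicat_real S x *\<^sub>R h x)"
    by (rule Bochner_Integration.integrable_bound)
      (use assms S' in \<open>auto simp: indicator_def intro!: AE_I2 borel_measurable_times order_trans[OF _ abs_ge_self]\<close>)
qed

lemma set_integral_box_bound:
  fixes f :: "'a::euclidean_space \<Rightarrow> real"
  assumes f: "locally_integrable f" and le: "\<And>x. x \<in> box a b \<Longrightarrow> \<bar>f x\<bar> \<le> c"
  shows "\<bar>LINT x:box a b|lebesgue. f x\<bar> \<le> c * measure lebesgue (box a b)"
proof -
  have "set_integrable lebesgue (box a b) f"
    using f by (rule locally_integrable_subset[OF _ box_subset_cbox compact_cbox]) simp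
  moreover have "integrable lebesgue (\<lambda>x. c * indicat_real (box a b) x)"
    using lmeasurable_box[of a b] by (simp add: lmeasurable_iff_integrable)
  ultimately have "norm (LINT x:box a b|lebesgue. f x) \<le> (LINT x|lebesgue. c * indicat_real (box a b) x)"
    unfolding set_lebesgue_integral_def set_integrable_def
    by (rule Bochner_Integration.integral_norm_bound_integral) (use le in \<open>auto simp: indicator_def\<close>)
  then show ?thesis by simp
qed

lemma measure_translated_box:
  fixes a b c :: "'a::euclidean_space"
  shows "measure lebesgue (box (a + c) (b + c)) = measure lebesgue (box a b)"
proof -
  have "box (a + c) (b + c) = (+) c ` box a b"
  proof safe
    fix x assume "x \<in> box (a + c) (b + c)"
    then have "x - c \<in> box a b" by (auto simp: mem_box inner_simps algebra_simps)
    then show "x \<in> (+) c ` box a b" by (intro image_eqI[of _ _ "x - c"]) auto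
  qed (auto simp: mem_box inner_simps)
  then show ?thesis by (simp add: measure_translation)
qed

text \<open>Since \<open>\<bar>u\<bar> \<le> d + d powr (1 - p) * \<bar>u\<bar> powr p\<close>, the integral over a translate is at most \<open>d\<close> times
the volume of the box plus a multiple of the integral of \<open>\<bar>u\<bar> powr p\<close> over that translate, and the
latter tends to zero by dominated convergence. This is how integrability with the critical exponent
excludes nonzero constants.\<close>

lemma Lp_box_integral_vanishes_at_infinity:
  fixes u :: "'a::euclidean_space \<Rightarrow> real"
  assumes u: "locally_integrable u" and p: "p \<ge> 1"
    and Lp: "integrable lebesgue (\<lambda>x. \<bar>u x\<bar> powr p)" and i: "i \<in> Basis"
  shows "(\<lambda>n. LINT x:box (a + real n *\<^sub>R i) (b + real n *\<^sub>R i)|lebesgue. \<bar>u x\<bar>) \<longlonglongrightarrow> 0"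
proof (rule LIMSEQ_I)
  fix \<epsilon> :: real assume \<epsilon>: "\<epsilon> > 0"
  let ?B = "\<lambda>n. box (a + real n *\<^sub>R i) (b + real n *\<^sub>R i)"
  let ?m = "measure lebesgue (box a b)"
  \<comment> \<open>The summand 1 keeps the denominator positive when the box is empty.\<close>
  define d where "d = \<epsilon> / (2 * (?m + 1))"
  have d: "d > 0" using \<epsilon> by (simp add: d_def add_nonneg_pos)
  have dm: "d * ?m \<le> \<epsilon> / 2"
  proof -
    have "d * ?m \<le> d * (?m + 1)" using d by simp
    also have "\<dots> = \<epsilon> / 2"
    proof -
      have "\<epsilon> / (2 * c) * c = \<epsilon> / 2" if "c > 0" for c using that by simp
      from this[of "?m + 1"] show ?thesis by (simp add: d_def add_nonneg_pos)
    qed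
    finally show ?thesis .
  qed
  have "(\<lambda>n. LINT x|lebesgue. indicat_real (?B n) x * \<bar>u x\<bar> powr p) \<longlonglongrightarrow> (LINT x::'a|lebesgue. 0)"
  proof (rule integral_dominated_convergence[OF _ _ Lp])
    show "AE x in lebesgue. (\<lambda>n. indicat_real (?B n) x * \<bar>u x\<bar> powr p) \<longlonglongrightarrow> 0"
    proof (rule AE_I2, rule tendsto_eventually)
      fix x
      obtain m where m: "x \<bullet> i - a \<bullet> i \<le> real m" using real_arch_simple by blast
      have "x \<notin> ?B n" if "n \<ge> m" for n
      proof
        assume "x \<in> ?B n"
        then have "a \<bullet> i + real n < x \<bullet> i" using i by (auto simp: mem_box inner_simps)
        with m that show False by simp
      qed
      then show "\<forall>\<^sub>F n in sequentially. indicat_real (?B n) x * \<bar>u x\<bar> powr p = 0"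
        by (intro eventually_sequentiallyI[of m]) auto
    qed
    have "(\<lambda>x. \<bar>u x\<bar> powr p) \<in> borel_measurable lebesgue"
      by (rule borel_measurable_integrable[OF Lp])
    then show "(\<lambda>x. indicat_real (?B n) x * \<bar>u x\<bar> powr p) \<in> borel_measurable lebesgue" for n
      by (intro borel_measurable_times borel_measurable_indicator) auto
    show "AE x in lebesgue. norm (indicat_real (?B n) x * \<bar>u x\<bar> powr p) \<le> \<bar>u x\<bar> powr p" for n
      by (rule AE_I2) (simp add: indicator_def)
  qed simp
  then have "(\<lambda>n. LINT x|lebesgue. indicat_real (?B n) x * \<bar>u x\<bar> powr p) \<longlonglongrightarrow> 0" by simp
  moreover have "\<epsilon> / (2 * d powr (1 - p)) > 0" using d \<epsilon> by simp
  ultimately have "\<forall>\<^sub>F n in sequentially.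
      (LINT x|lebesgue. indicat_real (?B n) x * \<bar>u x\<bar> powr p) < \<epsilon> / (2 * d powr (1 - p))"
    by (rule order_tendstoD(2))
  then obtain M where M: "\<And>n. n \<ge> M \<Longrightarrow>
      (LINT x|lebesgue. indicat_real (?B n) x * \<bar>u x\<bar> powr p) < \<epsilon> / (2 * d powr (1 - p))"
    unfolding eventually_sequentially by blast
  have "norm ((LINT x:?B n|lebesgue. \<bar>u x\<bar>) - 0) < \<epsilon>" if n: "n \<ge> M" for n
  proof -
    have iB: "integrable lebesgue (indicat_real (?B n))"
      by (rule lmeasurable_iff_integrable[THEN iffD1, OF lmeasurable_box])
    have iL: "integrable lebesgue (\<lambda>x. indicat_real (?B n) x * \<bar>u x\<bar> powr p)"
      using integrable_mult_indicator[OF _ Lp, of "?B n"] by simp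
    have "(LINT x:?B n|lebesgue. \<bar>u x\<bar>) \<le>
        (LINT x|lebesgue. d * indicat_real (?B n) x + d powr (1 - p) * (indicat_real (?B n) x * \<bar>u x\<bar> powr p))"
      unfolding set_lebesgue_integral_def
    proof (rule integral_mono)
      have "set_integrable lebesgue (?B n) u"
        using u by (rule locally_integrable_subset[OF _ box_subset_cbox compact_cbox]) simp
      from set_integrable_norm[OF this] show "integrable lebesgue (\<lambda>x. indicat_real (?B n) x *\<^sub>R \<bar>u x\<bar>)"
        unfolding set_integrable_def by simp
      show "integrable lebesgue (\<lambda>x. d * indicat_real (?B n) x + d powr (1 - p) * (indicat_real (?B n) x * \<bar>u x\<bar> powr p))"
        using iB iL by simp
      show "indicat_real (?B n) x *\<^sub>R \<bar>u x\<bar> \<le>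
          d * indicat_real (?B n) x + d powr (1 - p) * (indicat_real (?B n) x * \<bar>u x\<bar> powr p)" for x
      proof -
        have "\<bar>u x\<bar> \<le> d + d powr (1 - p) * \<bar>u x\<bar> powr p"
        proof (cases "\<bar>u x\<bar> \<le> d")
          case True
          then show ?thesis by (simp add: add_increasing2)
        next
          case False
          then have "1 \<le> \<bar>u x\<bar> / d" using d by simp
          then have "(\<bar>u x\<bar> / d) powr 1 \<le> (\<bar>u x\<bar> / d) powr p" using p by (intro powr_mono) auto
          then have "\<bar>u x\<bar> \<le> d * ((\<bar>u x\<bar> / d) powr p)" using d by (simp add: field_simps)
          also have "\<dots> = d powr (1 - p) * \<bar>u x\<bar> powr p"
            using d by (simp add: powr_divide powr_diff)
          finally show ?thesis using d by simp
        qed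
        then show ?thesis by (simp add: indicator_def)
      qed
    qed
    also have "\<dots> = d * ?m + d powr (1 - p) * (LINT x|lebesgue. indicat_real (?B n) x * \<bar>u x\<bar> powr p)"
      using iB iL by (simp add: measure_translated_box)
    also have "\<dots> < \<epsilon> / 2 + d powr (1 - p) * (\<epsilon> / (2 * d powr (1 - p)))"
      using M[OF n] d dm by (intro add_le_less_mono mult_strict_left_mono) auto
    also have "\<dots> = \<epsilon>" using d by simp
    finally have "(LINT x:?B n|lebesgue. \<bar>u x\<bar>) < \<epsilon>" .
    moreover have "(LINT x:?B n|lebesgue. \<bar>u x\<bar>) \<ge> 0"
      unfolding set_lebesgue_integral_def by (intro integral_nonneg_AE) auto
    ultimately show ?thesis by simp
  qed
  then show "\<exists>M. \<forall>n\<ge>M. norm ((LINT x:?B n|lebesgue. \<bar>u x\<bar>) - 0) < \<epsilon>" by blast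
qed

text \<open>Identifies the abstract distance of \<open>u\<close> to a test function with the \<open>L\<^sup>2\<close> distance of gradients.\<close>

lemma D12_norm_diff_test_function:
  fixes u :: "'a::euclidean_space \<Rightarrow> real"
  assumes g: "has_weak_gradient u g" "integrable lebesgue (\<lambda>x. (norm (g x))\<^sup>2)" and \<phi>: "\<phi> \<in> Cc_infinity"
  defines "k \<equiv> (\<lambda>x. g x - classical_gradient \<phi> x)"
  shows "has_weak_gradient (\<lambda>x. u x - \<phi> x) k" "integrable lebesgue (\<lambda>x. (norm (k x))\<^sup>2)"
    "(LINT x|lebesgue. (norm (k x))\<^sup>2) = (D12_norm (\<lambda>x. u x - \<phi> x))\<^sup>2"
proof -
  note g\<phi> = test_function_has_weak_gradient[OF \<phi>]
  show w: "has_weak_gradient (\<lambda>x. u x - \<phi> x) k"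
    using has_weak_gradient_lincomb[OF g(1) g\<phi>, of 1 "-1"] by (simp add: k_def)
  show "integrable lebesgue (\<lambda>x. (norm (k x))\<^sup>2)"
    unfolding k_def using g g\<phi> test_function_gradient_square_integrable[OF \<phi>]
    by (intro square_integrable_diff(1))
      (auto intro!: locally_integrable_measurable has_weak_gradient_locally_integrable)
  show "(LINT x|lebesgue. (norm (k x))\<^sup>2) = (D12_norm (\<lambda>x. u x - \<phi> x))\<^sup>2"
    unfolding D12_norm_eq[OF w] by (simp add: integral_nonneg_AE)
qed

lemma test_function_energy_bound:
  fixes u :: "'a::euclidean_space \<Rightarrow> real"
  assumes g: "has_weak_gradient u g" "integrable lebesgue (\<lambda>x. (norm (g x))\<^sup>2)" and \<phi>: "\<phi> \<in> Cc_infinity"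
  shows "(LINT x|lebesgue. (norm (classical_gradient \<phi> x))\<^sup>2)
    \<le> 2 * (D12_norm u)\<^sup>2 + 2 * (D12_norm (\<lambda>x. u x - \<phi> x))\<^sup>2"
proof -
  note k = D12_norm_diff_test_function[OF g \<phi>]
  have "(LINT x|lebesgue. (norm (g x - (g x - classical_gradient \<phi> x)))\<^sup>2) \<le>
    2 * (LINT x|lebesgue. (norm (g x))\<^sup>2) + 2 * (LINT x|lebesgue. (norm (g x - classical_gradient \<phi> x))\<^sup>2)"
    using g k by (intro square_integrable_diff(2))
      (auto intro!: locally_integrable_measurable has_weak_gradient_locally_integrable)
  then show ?thesis
    unfolding k(3) D12_norm_eq[OF g(1)] by (simp add: integral_nonneg_AE)
qed

lemma test_function_energy_diff_bound:
  fixes u :: "'a::euclidean_space \<Rightarrow> real"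
  assumes g: "has_weak_gradient u g" "integrable lebesgue (\<lambda>x. (norm (g x))\<^sup>2)"
    and \<phi>: "\<phi> \<in> Cc_infinity" and \<psi>: "\<psi> \<in> Cc_infinity"
  shows "(LINT x|lebesgue. (norm (classical_gradient (\<lambda>x. \<phi> x - \<psi> x) x))\<^sup>2)
    \<le> 2 * (D12_norm (\<lambda>x. u x - \<phi> x))\<^sup>2 + 2 * (D12_norm (\<lambda>x. u x - \<psi> x))\<^sup>2"
proof -
  let ?d = "\<lambda>x. \<phi> x - \<psi> x"
  note k = D12_norm_diff_test_function[OF g \<phi>] and l = D12_norm_diff_test_function[OF g \<psi>]
  let ?k = "\<lambda>x. g x - classical_gradient \<phi> x" and ?l = "\<lambda>x. g x - classical_gradient \<psi> x"
  have d: "?d \<in> Cc_infinity"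
    using Cc_infinity_lincomb[OF \<phi> \<psi>, of 1 "-1"] by simp
  have "has_weak_gradient ?d (\<lambda>x. ?l x - ?k x)"
    using has_weak_gradient_lincomb[OF l(1) k(1), of 1 "-1"] by simp
  from D12_norm_eq[OF this] D12_norm_eq[OF test_function_has_weak_gradient[OF d]]
  have "(LINT x|lebesgue. (norm (classical_gradient ?d x))\<^sup>2) = (LINT x|lebesgue. (norm (?l x - ?k x))\<^sup>2)"
    by simp
  also have "\<dots> \<le> 2 * (LINT x|lebesgue. (norm (?l x))\<^sup>2) + 2 * (LINT x|lebesgue. (norm (?k x))\<^sup>2)"
    using k l by (intro square_integrable_diff(2))
      (auto intro!: locally_integrable_measurable has_weak_gradient_locally_integrable)
  finally show ?thesis
    unfolding k(3) l(3) by simp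
qed

lemma D12_norm_nonneg: "D12_norm u \<ge> 0"
  unfolding D12_norm_def by (simp add: integral_nonneg_AE)

text \<open>Smooth radial approximants form a Cauchy sequence at every positive radius, uniformly away from the
origin, and the two estimates pass to the limit \<open>W\<close>. That \<open>W\<close> is a profile of \<open>u\<close> itself is the
substantial part: on the complement of a small ball the box integrals of \<open>u - W (norm x)\<close> are
invariant under translation by \<open>weak_gradient_translation\<close>, and they vanish at infinity. The constant 2
comes from bounding the energy of an approximant by twice the sum of two energies.\<close>

theorem radial_profile:
  fixes u :: "'a::euclidean_space \<Rightarrow> real"
  assumes dim: "DIM('a) \<ge> 3" and u: "u \<in> D12_rad"
  obtains W where "W \<in> borel_measurable borel" "AE x in lebesgue. u x = W (norm x)"
    "\<And>r s. 0 < r \<Longrightarrow> r \<le> s \<Longrightarrow> sphere_area TYPE('a) * (W s - W r)\<^sup>2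
        \<le> 2 * (D12_norm u)\<^sup>2 * ((1 / r) ^ (DIM('a) - 3) * (1 / r - 1 / s))"
    "\<And>r. 0 < r \<Longrightarrow> sphere_area TYPE('a) * (W r)\<^sup>2 \<le> 2 * (D12_norm u)\<^sup>2 * (1 / r) ^ (DIM('a) - 2)"
proof -
  let ?N = "DIM('a)" and ?A = "sphere_area TYPE('a)"
  have A: "?A > 0" by (rule sphere_area_pos)
  obtain e :: 'a where e: "e \<in> Basis" "norm e = 1"
    using nonempty_Basis norm_Basis by blast
  from u obtain g where g: "has_weak_gradient u g" "integrable lebesgue (\<lambda>x. (norm (g x))\<^sup>2)"
    and Lp: "integrable lebesgue (\<lambda>x. \<bar>u x\<bar> powr crit_exp TYPE('a))"
    by (auto simp: D12_rad_def D12_def)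
  define \<delta> where "\<delta> n = inverse (real (Suc n))" for n
  have \<delta>: "\<delta> n > 0" "\<delta> \<longlonglongrightarrow> 0" for n
    unfolding \<delta>_def by (simp, rule LIMSEQ_inverse_real_of_nat)
  have "\<exists>\<phi>\<in>Cc_infinity. radial \<phi> \<and> D12_norm (\<lambda>x. u x - \<phi> x) < \<delta> n" for n
    using u \<delta>(1) by (auto simp: D12_rad_def)
  then obtain \<phi> where \<phi>: "\<And>n. \<phi> n \<in> Cc_infinity" "\<And>n. radial (\<phi> n)"
    "\<And>n. D12_norm (\<lambda>x. u x - \<phi> n x) < \<delta> n" by metis
  have D2: "(D12_norm (\<lambda>x. u x - \<phi> n x))\<^sup>2 \<le> (\<delta> n)\<^sup>2" for n
    using \<phi>(3)[of n] D12_norm_nonneg by (intro power_mono) auto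
  have energy: "(LINT x|lebesgue. (norm (classical_gradient (\<phi> n) x))\<^sup>2) \<le> 2 * (D12_norm u)\<^sup>2 + 2 * (\<delta> n)\<^sup>2" for n
    using test_function_energy_bound[OF g \<phi>(1)[of n]] D2[of n] by linarith
  have cauchy_bound: "?A * (\<phi> m (r *\<^sub>R e) - \<phi> n (r *\<^sub>R e))\<^sup>2 \<le> (2 * (\<delta> m)\<^sup>2 + 2 * (\<delta> n)\<^sup>2) * (1 / r) ^ (?N - 2)"
    if "r > 0" for m n r
  proof -
    have C: "(\<lambda>x. \<phi> m x - \<phi> n x) \<in> Cc_infinity"
      using Cc_infinity_lincomb[OF \<phi>(1)[of m] \<phi>(1)[of n], of 1 "-1"] by simp
    have "radial (\<lambda>x. \<phi> m x - \<phi> n x)"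
      using \<phi>(2)[of m] \<phi>(2)[of n] unfolding radial_def by metis
    from radial_pointwise_bound[OF dim C this e(2) that]
    have "?A * (\<phi> m (r *\<^sub>R e) - \<phi> n (r *\<^sub>R e))\<^sup>2
        \<le> (LINT x|lebesgue. (norm (classical_gradient (\<lambda>x. \<phi> m x - \<phi> n x) x))\<^sup>2) * (1 / r) ^ (?N - 2)" .
    also have "\<dots> \<le> (2 * (\<delta> m)\<^sup>2 + 2 * (\<delta> n)\<^sup>2) * (1 / r) ^ (?N - 2)"
      using test_function_energy_diff_bound[OF g \<phi>(1)[of m] \<phi>(1)[of n]] D2[of m] D2[of n] that
      by (intro mult_right_mono) auto
    finally show ?thesis .
  qed
  define W where "W r = lim (\<lambda>n. \<phi> n (r *\<^sub>R e))" for r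
  have lim: "(\<lambda>n. \<phi> n (r *\<^sub>R e)) \<longlonglongrightarrow> W r" if r: "r > 0" for r
  proof -
    have "Cauchy (\<lambda>n. \<phi> n (r *\<^sub>R e))"
    proof (rule CauchyI)
      fix \<epsilon> :: real assume \<epsilon>: "\<epsilon> > 0"
      have "(\<lambda>n. 4 * (\<delta> n)\<^sup>2 * (1 / r) ^ (?N - 2)) \<longlonglongrightarrow> 4 * 0\<^sup>2 * (1 / r) ^ (?N - 2)"
        by (intro tendsto_intros \<delta>(2))
      then have "\<forall>\<^sub>F n in sequentially. 4 * (\<delta> n)\<^sup>2 * (1 / r) ^ (?N - 2) < ?A * \<epsilon>\<^sup>2"
        using A \<epsilon> by (intro order_tendstoD(2)) auto
      then obtain M where M: "4 * (\<delta> M)\<^sup>2 * (1 / r) ^ (?N - 2) < ?A * \<epsilon>\<^sup>2"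
        by (auto simp: eventually_sequentially)
      have mono: "(\<delta> n)\<^sup>2 \<le> (\<delta> M)\<^sup>2" if "n \<ge> M" for n
        using that by (intro power_mono) (auto simp: \<delta>_def intro!: le_imp_inverse_le)
      have "norm (\<phi> m (r *\<^sub>R e) - \<phi> n (r *\<^sub>R e)) < \<epsilon>" if "m \<ge> M" "n \<ge> M" for m n
      proof -
        have "?A * (\<phi> m (r *\<^sub>R e) - \<phi> n (r *\<^sub>R e))\<^sup>2 \<le> (2 * (\<delta> m)\<^sup>2 + 2 * (\<delta> n)\<^sup>2) * (1 / r) ^ (?N - 2)"
          by (rule cauchy_bound[OF r])
        also have "\<dots> \<le> 4 * (\<delta> M)\<^sup>2 * (1 / r) ^ (?N - 2)"
          using mono[OF that(1)] mono[OF that(2)] r by (intro mult_right_mono) auto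
        also have "\<dots> < ?A * \<epsilon>\<^sup>2" by (rule M)
        finally have "\<bar>\<phi> m (r *\<^sub>R e) - \<phi> n (r *\<^sub>R e)\<bar>\<^sup>2 < \<epsilon>\<^sup>2" using A by simp
        then have "\<bar>\<phi> m (r *\<^sub>R e) - \<phi> n (r *\<^sub>R e)\<bar> < \<epsilon>"
          using \<epsilon> by (rule power_less_imp_less_base[OF _ less_imp_le])
        then show ?thesis by simp
      qed
      then show "\<exists>M. \<forall>m\<ge>M. \<forall>n\<ge>M. norm (\<phi> m (r *\<^sub>R e) - \<phi> n (r *\<^sub>R e)) < \<epsilon>" by blast
    qed
    then show ?thesis
      unfolding W_def by (simp only: Cauchy_convergent_iff convergent_LIMSEQ_iff)
  qed
  have approx: "?A * (\<phi> m (r *\<^sub>R e) - W r)\<^sup>2 \<le> 2 * (\<delta> m)\<^sup>2 * (1 / r) ^ (?N - 2)" if r: "r > 0" for m r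
  proof (rule LIMSEQ_le)
    show "(\<lambda>n. ?A * (\<phi> m (r *\<^sub>R e) - \<phi> n (r *\<^sub>R e))\<^sup>2) \<longlonglongrightarrow> ?A * (\<phi> m (r *\<^sub>R e) - W r)\<^sup>2"
      by (intro tendsto_intros lim r)
    have "(\<lambda>n. (2 * (\<delta> m)\<^sup>2 + 2 * (\<delta> n)\<^sup>2) * (1 / r) ^ (?N - 2)) \<longlonglongrightarrow>
        (2 * (\<delta> m)\<^sup>2 + 2 * 0\<^sup>2) * (1 / r) ^ (?N - 2)"
      by (intro tendsto_intros \<delta>(2))
    then show "(\<lambda>n. (2 * (\<delta> m)\<^sup>2 + 2 * (\<delta> n)\<^sup>2) * (1 / r) ^ (?N - 2)) \<longlonglongrightarrow> 2 * (\<delta> m)\<^sup>2 * (1 / r) ^ (?N - 2)"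
      by simp
  qed (use cauchy_bound[OF r] in blast)
  have lim_energy: "(\<lambda>n. (2 * (D12_norm u)\<^sup>2 + 2 * (\<delta> n)\<^sup>2) * c) \<longlonglongrightarrow> 2 * (D12_norm u)\<^sup>2 * c" for c
  proof -
    have "(\<lambda>n. (2 * (D12_norm u)\<^sup>2 + 2 * (\<delta> n)\<^sup>2) * c) \<longlonglongrightarrow> (2 * (D12_norm u)\<^sup>2 + 2 * 0\<^sup>2) * c"
      by (intro tendsto_intros \<delta>(2))
    then show ?thesis by simp
  qed
  have W_increment: "?A * (W s - W r)\<^sup>2 \<le> 2 * (D12_norm u)\<^sup>2 * ((1 / r) ^ (?N - 3) * (1 / r - 1 / s))"
    if rs: "0 < r" "r \<le> s" for r s
  proof (rule LIMSEQ_le[OF _ lim_energy])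
    show "(\<lambda>n. ?A * (\<phi> n (s *\<^sub>R e) - \<phi> n (r *\<^sub>R e))\<^sup>2) \<longlonglongrightarrow> ?A * (W s - W r)\<^sup>2"
      using rs by (intro tendsto_intros lim) auto
    have "?A * (\<phi> n (s *\<^sub>R e) - \<phi> n (r *\<^sub>R e))\<^sup>2 \<le>
        (2 * (D12_norm u)\<^sup>2 + 2 * (\<delta> n)\<^sup>2) * ((1 / r) ^ (?N - 3) * (1 / r - 1 / s))" for n
      by (rule order_trans[OF radial_increment_bound[OF dim \<phi>(1) \<phi>(2) e(2) rs]
          mult_right_mono[OF energy]]) (use rs in \<open>simp add: frac_le\<close>)
    then show "\<exists>M. \<forall>n\<ge>M. ?A * (\<phi> n (s *\<^sub>R e) - \<phi> n (r *\<^sub>R e))\<^sup>2 \<le>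
        (2 * (D12_norm u)\<^sup>2 + 2 * (\<delta> n)\<^sup>2) * ((1 / r) ^ (?N - 3) * (1 / r - 1 / s))" by blast
  qed
  have W_bound: "?A * (W r)\<^sup>2 \<le> 2 * (D12_norm u)\<^sup>2 * (1 / r) ^ (?N - 2)" if r: "0 < r" for r
  proof (rule LIMSEQ_le[OF _ lim_energy])
    show "(\<lambda>n. ?A * (\<phi> n (r *\<^sub>R e))\<^sup>2) \<longlonglongrightarrow> ?A * (W r)\<^sup>2"
      using r by (intro tendsto_intros lim) auto
    have "?A * (\<phi> n (r *\<^sub>R e))\<^sup>2 \<le> (2 * (D12_norm u)\<^sup>2 + 2 * (\<delta> n)\<^sup>2) * (1 / r) ^ (?N - 2)" for n
      by (rule order_trans[OF radial_pointwise_bound[OF dim \<phi>(1) \<phi>(2) e(2) r]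
          mult_right_mono[OF energy]]) (use r in simp)
    then show "\<exists>M. \<forall>n\<ge>M. ?A * (\<phi> n (r *\<^sub>R e))\<^sup>2 \<le>
        (2 * (D12_norm u)\<^sup>2 + 2 * (\<delta> n)\<^sup>2) * (1 / r) ^ (?N - 2)" by blast
  qed
  have W_meas: "W \<in> borel_measurable borel"
  proof -
    have "continuous_on UNIV (\<phi> n)" for n
      using test_function_properties[OF \<phi>(1)] by metis
    then have "continuous_on UNIV (\<lambda>r. \<phi> n (r *\<^sub>R e))" for n
      by (rule continuous_on_compose2) (auto intro!: continuous_intros)
    then have "(\<lambda>r. \<phi> n (r *\<^sub>R e)) \<in> borel_measurable borel" for n
      by (rule borel_measurable_continuous_onI)
    then show ?thesis
      unfolding W_def by (rule borel_measurable_lim_metric)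
  qed
  have "AE x in lebesgue. norm x > 1 / real (Suc m) \<longrightarrow> u x = W (norm x)" for m
  proof -
    define S where "S = - cball (0::'a) (1 / real (Suc m))"
    have S: "open S" "\<And>x. x \<in> S \<longleftrightarrow> norm x > 1 / real (Suc m)"
      by (auto simp: S_def)
    have S_pos: "norm x > 0" if "x \<in> S" for x
      using that unfolding S(2) by (rule order.strict_trans[rotated]) simp
    have inv_le: "(1 / norm x) ^ (?N - 2) \<le> real (Suc m) ^ (?N - 2)" if "x \<in> S" for x
      using that S_pos[OF that] unfolding S(2) by (intro power_mono) (auto simp: field_simps)
    \<comment> \<open>Cutting off near the origin makes \<open>w\<close> bounded, hence locally integrable.\<close>
    define w where "w x = indicat_real S x * W (norm x)" for x
    define c where "c = sqrt (2 * real (Suc m) ^ (?N - 2) / ?A)"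
    have c_bound: "\<bar>d\<bar> \<le> c * q" if "?A * d\<^sup>2 \<le> 2 * q\<^sup>2 * (1 / norm x) ^ (?N - 2)" "q \<ge> 0" "x \<in> S" for d q x
    proof -
      have "?A * d\<^sup>2 \<le> 2 * q\<^sup>2 * real (Suc m) ^ (?N - 2)"
        using that(1) mult_left_mono[OF inv_le[OF that(3)], of "2 * q\<^sup>2"] by simp
      also have "\<dots> = ?A * (c\<^sup>2 * q\<^sup>2)" using A by (simp add: c_def)
      finally have "\<bar>d\<bar>\<^sup>2 \<le> (c * q)\<^sup>2" using A by (simp add: power_mult_distrib)
      moreover have "c * q \<ge> 0" using that(2) A by (simp add: c_def)
      ultimately show ?thesis by (rule power2_le_imp_le)
    qed
    have w_meas: "w \<in> borel_measurable lebesgue"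
    proof (rule measurable_completion)
      show "w \<in> borel_measurable lborel"
        unfolding w_def using W_meas S(1) by (intro borel_measurable_times borel_measurable_indicator)
          (auto intro!: measurable_compose[OF borel_measurable_norm])
    qed
    have w_le: "\<bar>w x\<bar> \<le> c * D12_norm u" for x
    proof (cases "x \<in> S")
      case True
      show ?thesis
        using c_bound[OF W_bound[OF S_pos[OF True]] D12_norm_nonneg True] True by (simp add: w_def)
    qed (use A in \<open>simp add: w_def c_def D12_norm_nonneg\<close>)
    have approx_w: "\<bar>\<phi> n x - w x\<bar> \<le> c * \<delta> n" if "x \<in> S" for n x
    proof -
      have "\<phi> n x = \<phi> n (norm x *\<^sub>R e)"
        using \<phi>(2)[of n, unfolded radial_def, rule_format, of x "norm x *\<^sub>R e"] e(2) by simp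
      then have "?A * (\<phi> n x - w x)\<^sup>2 \<le> 2 * (\<delta> n)\<^sup>2 * (1 / norm x) ^ (?N - 2)"
        using approx[OF S_pos[OF that]] that by (simp add: w_def)
      then show ?thesis using \<delta>(1)[of n] that by (intro c_bound) auto
    qed
    define f where "f x = u x - w x" for x
    note lu = has_weak_gradient_locally_integrable(1)[OF g(1)]
    have lw: "locally_integrable w"
      using w_meas w_le by (rule locally_integrable_bounded)
    have lf: "locally_integrable f"
      using locally_integrable_lincomb[OF lu lw, of 1 "-1"] by (simp add: f_def[abs_def])
    \<comment> \<open>Only the two boxes have to avoid the origin; the region swept out between them may contain it.\<close>
    have shift: "(LINT x:box a b|lebesgue. f x) = (LINT x:box (a + t *\<^sub>R e) (b + t *\<^sub>R e)|lebesgue. f x)"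
      if t: "t \<ge> 0" and sub: "box a b \<subseteq> S" "box (a + t *\<^sub>R e) (b + t *\<^sub>R e) \<subseteq> S" for a b t
    proof -
      let ?B = "box a b" and ?B' = "box (a + t *\<^sub>R e) (b + t *\<^sub>R e)" and ?Q = "cbox a (b + t *\<^sub>R e)"
      let ?m = "measure lebesgue ?B" and ?M = "measure lebesgue ?Q"
      have "\<bar>(LINT x:?B|lebesgue. f x) - (LINT x:?B'|lebesgue. f x)\<bar>
          \<le> t * (\<delta> n * ?M + \<delta> n) + 2 * (c * \<delta> n * ?m)" for n
      proof -
        let ?y = "\<lambda>x. u x - \<phi> n x" and ?k = "\<lambda>x. g x - classical_gradient (\<phi> n) x"
        note k = D12_norm_diff_test_function[OF g \<phi>(1)[of n]]
        note ly = has_weak_gradient_locally_integrable[OF k(1)]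
        have "(LINT x:?Q|lebesgue. norm (?k x)) \<le> \<delta> n * ?M + (D12_norm ?y)\<^sup>2 / \<delta> n"
          using set_integral_norm_le_square[OF ly(2) k(2) compact_cbox \<delta>(1)] unfolding k(3) .
        also have "(D12_norm ?y)\<^sup>2 / \<delta> n \<le> (\<delta> n)\<^sup>2 / \<delta> n"
          using D2 \<delta>(1)[of n] by (intro divide_right_mono) auto
        also have "(\<delta> n)\<^sup>2 / \<delta> n = \<delta> n" by (simp add: power2_eq_square)
        finally have "t * (LINT x:?Q|lebesgue. norm (?k x)) \<le> t * (\<delta> n * ?M + \<delta> n)"
          using t by (intro mult_left_mono) auto
        with weak_gradient_translation[OF k(1) e(1) t, of a b]
        have 1: "\<bar>(LINT x:?B|lebesgue. ?y x) - (LINT x:?B'|lebesgue. ?y x)\<bar> \<le> t * (\<delta> n * ?M + \<delta> n)"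
          by linarith
        have 2: "\<bar>(LINT x:box a' b'|lebesgue. f x) - (LINT x:box a' b'|lebesgue. ?y x)\<bar>
            \<le> c * \<delta> n * measure lebesgue (box a' b')" if "box a' b' \<subseteq> S" for a' b'
        proof -
          have "set_integrable lebesgue (box a' b') f" "set_integrable lebesgue (box a' b') ?y"
            using lf ly(1) by (auto intro: locally_integrable_subset[OF _ box_subset_cbox compact_cbox])
          then have "(LINT x:box a' b'|lebesgue. f x) - (LINT x:box a' b'|lebesgue. ?y x)
              = (LINT x:box a' b'|lebesgue. f x - ?y x)"
            by (simp add: set_integral_diff)
          moreover have "locally_integrable (\<lambda>x. f x - ?y x)"
            using locally_integrable_lincomb[OF lf ly(1), of 1 "-1"] 
            by (simp only: scaleR_one scaleR_minus1_left diff_conv_add_uminus)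
          then have "\<bar>LINT x:box a' b'|lebesgue. f x - ?y x\<bar> \<le> c * \<delta> n * measure lebesgue (box a' b')"
          proof (rule set_integral_box_bound)
            fix x assume "x \<in> box a' b'"
            with that have "x \<in> S" by blast
            then show "\<bar>f x - ?y x\<bar> \<le> c * \<delta> n" using approx_w[of x n] by (simp add: f_def)
          qed
          ultimately show ?thesis by (simp only:)
        qed
        show ?thesis
          using 1 2[OF sub(1)] 2[OF sub(2)] unfolding measure_translated_box by linarith
      qed
      moreover have "(\<lambda>n. t * (\<delta> n * ?M + \<delta> n) + 2 * (c * \<delta> n * ?m))
          \<longlonglongrightarrow> t * (0 * ?M + 0) + 2 * (c * 0 * ?m)"
        by (intro tendsto_intros \<delta>(2))
      ultimately have "\<bar>(LINT x:?B|lebesgue. f x) - (LINT x:?B'|lebesgue. f x)\<bar> \<le> t * (0 * ?M + 0) + 2 * (c * 0 * ?m)"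
        by (intro LIMSEQ_le_const) auto
      then show ?thesis by simp
    qed
    have "(LINT x:box a b|lebesgue. f x) = 0" if "cbox a b \<subseteq> S" for a b
    proof -
      let ?B = "\<lambda>n. box (a + real n *\<^sub>R e) (b + real n *\<^sub>R e)"
      let ?m = "measure lebesgue (box a b)"
      have sub0: "box a b \<subseteq> S" using that box_subset_cbox by blast
      have far: "norm x > a \<bullet> e + real n" if "x \<in> ?B n" for x n
      proof -
        have "a \<bullet> e + real n < x \<bullet> e" using that e by (auto simp: mem_box inner_simps dot_square_norm)
        then show ?thesis using Basis_le_norm[OF e(1), of x] by linarith
      qed
      \<comment> \<open>From the index \<open>M\<close> on, the translated boxes lie outside the ball of radius 2.\<close>
      obtain M where M: "2 - a \<bullet> e \<le> real M" using real_arch_simple by blast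
      have large: "norm x > 2 + real (n - M)" if "x \<in> ?B n" "n \<ge> M" for x n
        using far[OF that(1)] M that(2) by (simp add: of_nat_diff)
      have sub: "?B n \<subseteq> S" if "n \<ge> M" for n
      proof
        fix x assume "x \<in> ?B n"
        from large[OF this that] have "norm x > 1" by linarith
        moreover have "1 / real (Suc m) \<le> 1" by simp
        ultimately show "x \<in> S" unfolding S(2) by linarith
      qed
      let ?c = "sqrt (2 * (D12_norm u)\<^sup>2 / ?A)"
      have bound: "\<bar>LINT x:box a b|lebesgue. f x\<bar> \<le>
          (LINT x:?B n|lebesgue. \<bar>u x\<bar>) + ?c * sqrt (1 / (2 + real (n - M))) * ?m" if n: "n \<ge> M" for n
      proof -
        have w_small: "\<bar>w x\<bar> \<le> ?c * sqrt (1 / (2 + real (n - M)))" if "x \<in> ?B n" for x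
        proof -
          have xS: "x \<in> S" using that sub[OF n] by blast
          have l: "norm x > 2 + real (n - M)" using large[OF that n] .
          have "(1 / norm x) ^ (?N - 2) \<le> (1 / norm x) ^ 1"
          proof (rule power_decreasing)
            have "0 < norm x" using l by linarith
            from divide_le_eq_1_pos[OF this, of 1] show "1 / norm x \<le> 1" using l by linarith
          qed (use dim in auto)
          also have "\<dots> \<le> 1 / (2 + real (n - M))"
            using l by (simp add: frac_le)
          finally have *: "(1 / norm x) ^ (?N - 2) \<le> 1 / (2 + real (n - M))" .
          have "?A * (w x)\<^sup>2 \<le> 2 * (D12_norm u)\<^sup>2 * (1 / norm x) ^ (?N - 2)"
            using W_bound[OF S_pos[OF xS]] xS by (simp add: w_def)
          also have "\<dots> \<le> 2 * (D12_norm u)\<^sup>2 * (1 / (2 + real (n - M)))"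
            by (intro mult_left_mono *) simp
          finally have "?A * (w x)\<^sup>2 \<le> 2 * (D12_norm u)\<^sup>2 * (1 / (2 + real (n - M)))" .
          then have "(w x)\<^sup>2 \<le> 2 * (D12_norm u)\<^sup>2 * (1 / (2 + real (n - M))) / ?A"
            by (simp only: pos_le_divide_eq[OF A] mult.commute[of "(w x)\<^sup>2"])
          then have "(w x)\<^sup>2 \<le> 2 * (D12_norm u)\<^sup>2 / ?A * (1 / (2 + real (n - M)))"
            by (simp add: mult.commute)
          then show ?thesis
            unfolding real_sqrt_mult[symmetric] by (intro real_le_rsqrt) simp
        qed
        have iu: "set_integrable lebesgue (?B n) u" and iw: "set_integrable lebesgue (?B n) w"
          using lu lw by (auto intro: locally_integrable_subset[OF _ box_subset_cbox compact_cbox])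
        have "(LINT x:box a b|lebesgue. f x) = (LINT x:?B n|lebesgue. f x)"
          using shift[OF _ sub0 sub[OF n]] by simp
        also have "\<dots> = (LINT x:?B n|lebesgue. u x) - (LINT x:?B n|lebesgue. w x)"
          unfolding f_def using iu iw by (simp add: set_integral_diff)
        also have "\<bar>\<dots>\<bar> \<le> \<bar>LINT x:?B n|lebesgue. u x\<bar> + \<bar>LINT x:?B n|lebesgue. w x\<bar>" by (rule abs_triangle_ineq4)
        also have "\<bar>LINT x:?B n|lebesgue. u x\<bar> \<le> (LINT x:?B n|lebesgue. \<bar>u x\<bar>)"
          using set_integral_norm_bound[OF iu] by simp
        also have "\<bar>LINT x:?B n|lebesgue. w x\<bar> \<le> ?c * sqrt (1 / (2 + real (n - M))) * ?m"
          using set_integral_box_bound[OF lw, of "a + real n *\<^sub>R e" "b + real n *\<^sub>R e", OF w_small]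
          unfolding measure_translated_box .
        finally show ?thesis by simp
      qed
      have p: "crit_exp TYPE('a) \<ge> 1"
        using dim by (simp add: crit_exp_def field_simps)
      have "(\<lambda>n. (LINT x:?B (n + M)|lebesgue. \<bar>u x\<bar>) + ?c * sqrt (1 / (2 + real (n + M - M))) * ?m)
          \<longlonglongrightarrow> 0 + ?c * sqrt 0 * ?m"
      proof (intro tendsto_intros)
        show "(\<lambda>n. LINT x:?B (n + M)|lebesgue. \<bar>u x\<bar>) \<longlonglongrightarrow> 0"
          using Lp_box_integral_vanishes_at_infinity[OF lu p Lp e(1)] by (rule LIMSEQ_ignore_initial_segment)
        have "(\<lambda>n. inverse (real (Suc (Suc n)))) \<longlonglongrightarrow> 0"
          using LIMSEQ_inverse_real_of_nat by (rule LIMSEQ_Suc)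
        then show "(\<lambda>n. 1 / (2 + real (n + M - M))) \<longlonglongrightarrow> 0"
          by (simp add: inverse_eq_divide add.commute)
      qed
      moreover have "\<bar>LINT x:box a b|lebesgue. f x\<bar> \<le>
          (LINT x:?B (n + M)|lebesgue. \<bar>u x\<bar>) + ?c * sqrt (1 / (2 + real (n + M - M))) * ?m" for n
        by (rule bound) simp
      ultimately have "\<bar>LINT x:box a b|lebesgue. f x\<bar> \<le> 0 + ?c * sqrt 0 * ?m"
        by (intro LIMSEQ_le_const) auto
      then show ?thesis by simp
    qed
    with lf S(1) have "AE x in lebesgue. x \<in> S \<longrightarrow> f x = 0"
      by (rule AE_zero_if_box_integrals_zero)
    then show ?thesis
      by eventually_elim (auto simp: f_def w_def S(2))
  qed
  then have "AE x in lebesgue. \<forall>m. norm x > 1 / real (Suc m) \<longrightarrow> u x = W (norm x)"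
    unfolding AE_all_countable by blast
  moreover have "AE x in lebesgue. x \<noteq> (0::'a)"
    by (rule AE_lebesgue_nonzero)
  ultimately have "AE x in lebesgue. u x = W (norm x)"
  proof eventually_elim
    case (elim x)
    then obtain m where "inverse (real (Suc m)) < norm x"
      using reals_Archimedean[of "norm x"] by auto
    with elim show ?case by (auto simp: inverse_eq_divide)
  qed
  from that[OF W_meas this W_increment W_bound] show thesis .
qed

section \<open>Homogeneity of the norm and integrals over annuli\<close>

lemma fsol_deriv: "(fsol has_real_derivative 1 / sqrt (1 + 2 * (fsol t)\<^sup>2)) (at t)"
  and fsol_0: "fsol 0 = 0"
  using solves_cauchy_fsol by (auto simp: solves_cauchy_def)

text \<open>The reflected function solves the same Cauchy problem.\<close>

lemma fsol_odd: "fsol (- t) = - fsol t"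
proof -
  have "((\<lambda>t. - fsol (- t)) has_real_derivative 1 / sqrt (1 + 2 * (- fsol (- t))\<^sup>2)) (at t)" for t
    by (rule DERIV_cong[OF DERIV_minus[OF DERIV_chain2[OF fsol_deriv]]])
      (auto intro!: derivative_eq_intros)
  then have "solves_cauchy (\<lambda>t. - fsol (- t))"
    by (simp add: solves_cauchy_def fsol_0)
  then have "(\<lambda>t. - fsol (- t)) = fsol"
    using ex1_solves_cauchy solves_cauchy_fsol by blast
  then show ?thesis by (metis minus_minus)
qed

lemma fsol_mono: "s \<le> t \<Longrightarrow> fsol s \<le> fsol t"
  by (rule DERIV_nonneg_imp_nondecreasing) (auto intro!: exI fsol_deriv)

text \<open>Concavity of \<open>fsol\<close> on the nonnegative half-line: its derivative decreases as \<open>fsol\<close> grows.\<close>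

lemma fsol_scale_le:
  assumes "c \<ge> 1" "t \<ge> 0" shows "fsol (c * t) \<le> c * fsol t"
proof -
  let ?h = "\<lambda>s. c * fsol s - fsol (c * s)"
  have "?h 0 \<le> ?h t"
  proof (rule DERIV_nonneg_imp_nondecreasing[OF assms(2)])
    fix s assume s: "0 \<le> s" "s \<le> t"
    have "(?h has_real_derivative c * (1 / sqrt (1 + 2 * (fsol s)\<^sup>2)) - 1 / sqrt (1 + 2 * (fsol (c * s))\<^sup>2) * c) (at s)"
      by (intro DERIV_diff DERIV_cmult fsol_deriv DERIV_chain2[OF fsol_deriv])
        (auto intro!: derivative_eq_intros)
    moreover have "0 \<le> c * (1 / sqrt (1 + 2 * (fsol s)\<^sup>2)) - 1 / sqrt (1 + 2 * (fsol (c * s))\<^sup>2) * c"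
    proof -
      have "0 \<le> fsol s" using fsol_mono[OF s(1)] by (simp add: fsol_0)
      moreover have "1 * s \<le> c * s" using assms(1) s(1) by (rule mult_right_mono)
      then have "fsol s \<le> fsol (c * s)" by (simp add: fsol_mono)
      ultimately have "(fsol s)\<^sup>2 \<le> (fsol (c * s))\<^sup>2" by (intro power_mono)
      then have "1 / sqrt (1 + 2 * (fsol (c * s))\<^sup>2) \<le> 1 / sqrt (1 + 2 * (fsol s)\<^sup>2)"
        by (intro divide_left_mono) (auto intro!: mult_pos_pos add_pos_nonneg)
      from mult_left_mono[OF this, of c] assms(1) show ?thesis by (simp add: mult.commute)
    qed
    ultimately show "\<exists>y. (?h has_real_derivative y) (at s) \<and> 0 \<le> y" by blast
  qed
  then show ?thesis by (simp add: fsol_0)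
qed

lemma fsol_scale_square_le:
  assumes "c > 0" shows "(fsol (c * t))\<^sup>2 \<le> (max 1 c)\<^sup>2 * (fsol t)\<^sup>2"
proof -
  have nonneg: "(fsol (c * t))\<^sup>2 \<le> (max 1 c)\<^sup>2 * (fsol t)\<^sup>2" if t: "t \<ge> 0" for t
  proof -
    have "c * t \<le> max 1 c * t" using t by (intro mult_right_mono) auto
    then have "fsol (c * t) \<le> max 1 c * fsol t"
      using fsol_mono fsol_scale_le[of "max 1 c" t] t by fastforce
    moreover have "0 \<le> fsol (c * t)"
      using fsol_mono[of 0 "c * t"] assms t by (simp add: fsol_0)
    ultimately have "(fsol (c * t))\<^sup>2 \<le> (max 1 c * fsol t)\<^sup>2" by (intro power_mono)
    then show ?thesis by (simp add: power_mult_distrib)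
  qed
  show ?thesis
    using nonneg[of t] nonneg[of "- t"] by (cases "t \<ge> 0") (auto simp: fsol_odd)
qed

lemma radial_weight_measurable:
  fixes K :: "real \<Rightarrow> real"
  assumes "continuous_on {0<..} K"
  shows "(\<lambda>x::'a::euclidean_space. K (norm x)) \<in> borel_measurable lebesgue"
proof (rule measurable_completion)
  have "(\<lambda>r. if r \<in> {0<..} then K r else K 0) \<in> borel_measurable borel"
    using assms by (intro borel_measurable_continuous_on_if) auto
  then have "(\<lambda>x::'a. if norm x \<in> {0<..} then K (norm x) else K 0) \<in> borel_measurable borel"
    by (rule measurable_compose[rotated]) auto
  also have "(\<lambda>x::'a. if norm x \<in> {0<..} then K (norm x) else K 0) = (\<lambda>x. K (norm x))"
    by auto
  finally show "(\<lambda>x::'a. K (norm x)) \<in> borel_measurable lborel" by simp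
qed

text \<open>The space \<open>E_space V\<close> is defined by an integral condition that is not homogeneous; concavity of
\<open>fsol\<close> still makes it stable under dilation, so that elements can be normalised.\<close>

lemma V_integral_scale_finite:
  fixes u :: "'a::euclidean_space \<Rightarrow> real"
  assumes V: "continuous_on {0<..} V" and u: "u \<in> borel_measurable lebesgue"
    and fin: "V_integral V u < \<infinity>" and c: "c > 0"
  shows "V_integral V (\<lambda>x. c * u x) < \<infinity>"
proof -
  have "continuous_on UNIV fsol"
    using fsol_deriv DERIV_isCont by (blast intro: continuous_at_imp_continuous_on)
  then have f: "fsol \<in> borel_measurable borel" by (rule borel_measurable_continuous_onI)
  have "(\<lambda>x. fsol (u x)) \<in> borel_measurable lebesgue"
    using u f by (rule measurable_compose)
  then have m: "(\<lambda>x. ennreal (V (norm x) * (fsol (u x))\<^sup>2)) \<in> borel_measurable lebesgue"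
    using radial_weight_measurable[OF V] by measurable
  have "V_integral V (\<lambda>x. c * u x)
      \<le> (\<integral>\<^sup>+x. ennreal ((max 1 c)\<^sup>2) * ennreal (V (norm x) * (fsol (u x))\<^sup>2) \<partial>lebesgue)"
    unfolding V_integral_def
  proof (rule nn_integral_mono)
    fix x :: 'a
    show "ennreal (V (norm x) * (fsol (c * u x))\<^sup>2)
        \<le> ennreal ((max 1 c)\<^sup>2) * ennreal (V (norm x) * (fsol (u x))\<^sup>2)"
    proof (cases "V (norm x) \<ge> 0")
      case True
      have "V (norm x) * (fsol (c * u x))\<^sup>2 \<le> V (norm x) * ((max 1 c)\<^sup>2 * (fsol (u x))\<^sup>2)"
        using True by (intro mult_left_mono fsol_scale_square_le c)
      also have "\<dots> = (max 1 c)\<^sup>2 * (V (norm x) * (fsol (u x))\<^sup>2)" by (rule mult.left_commute)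
      finally show ?thesis
        using True by (subst ennreal_mult[symmetric]) (auto intro!: ennreal_leI)
    next
      case False
      then have "V (norm x) * (fsol (c * u x))\<^sup>2 \<le> 0" by (simp add: mult_nonpos_nonneg)
      then show ?thesis by (simp add: ennreal_neg)
    qed
  qed
  also have "\<dots> = ennreal ((max 1 c)\<^sup>2) * V_integral V u"
    unfolding V_integral_def by (rule nn_integral_cmult[OF m])
  also have "\<dots> < \<infinity>" using fin by (simp add: ennreal_mult_less_top)
  finally show ?thesis .
qed

lemma has_weak_gradient_scale:
  "has_weak_gradient u g \<Longrightarrow> has_weak_gradient (\<lambda>x. c * u x) (\<lambda>x. c *\<^sub>R g x)"
  using has_weak_gradient_lincomb[of u g u g c 0] by simp

lemma D12_norm_scale:
  fixes u :: "'a::euclidean_space \<Rightarrow> real"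
  assumes "has_weak_gradient u g" "c > 0" shows "D12_norm (\<lambda>x. c * u x) = c * D12_norm u"
  unfolding D12_norm_eq[OF assms(1)] D12_norm_eq[OF has_weak_gradient_scale[OF assms(1), of c]]
  using assms(2) by (simp add: power_mult_distrib real_sqrt_mult)

lemma D12_rad_scale:
  fixes u :: "'a::euclidean_space \<Rightarrow> real"
  assumes u: "u \<in> D12_rad" and c: "c > 0" shows "(\<lambda>x. c * u x) \<in> D12_rad"
proof -
  from u obtain g where m: "u \<in> borel_measurable lebesgue"
    and Lp: "integrable lebesgue (\<lambda>x. \<bar>u x\<bar> powr crit_exp TYPE('a))"
    and g: "has_weak_gradient u g" "integrable lebesgue (\<lambda>x. (norm (g x))\<^sup>2)"
    by (auto simp: D12_rad_def D12_def)
  have "(\<lambda>x. c * u x) \<in> D12"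
    unfolding D12_def
  proof (intro CollectI conjI exI)
    show "(\<lambda>x. c * u x) \<in> borel_measurable lebesgue" using m by simp
    show "integrable lebesgue (\<lambda>x. \<bar>c * u x\<bar> powr crit_exp TYPE('a))"
      using Lp c by (simp add: abs_mult powr_mult)
    show "has_weak_gradient (\<lambda>x. c * u x) (\<lambda>x. c *\<^sub>R g x)" by (rule has_weak_gradient_scale[OF g(1)])
    show "integrable lebesgue (\<lambda>x. (norm (c *\<^sub>R g x))\<^sup>2)" using g(2) by (simp add: power_mult_distrib)
  qed
  moreover have "\<exists>\<psi>\<in>Cc_infinity. radial \<psi> \<and> D12_norm (\<lambda>x. c * u x - \<psi> x) < \<epsilon>" if "\<epsilon> > 0" for \<epsilon>
  proof -
    have "\<epsilon> / c > 0" using that c by simp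
    with u obtain \<phi> where \<phi>: "\<phi> \<in> Cc_infinity" "radial \<phi>" "D12_norm (\<lambda>x. u x - \<phi> x) < \<epsilon> / c"
      unfolding D12_rad_def by blast
    have "(\<lambda>x. c * \<phi> x) \<in> Cc_infinity"
      using Cc_infinity_lincomb[OF \<phi>(1) \<phi>(1), of c 0] by simp
    moreover have "radial (\<lambda>x. c * \<phi> x)"
      using \<phi>(2) unfolding radial_def by metis
    moreover have "D12_norm (\<lambda>x. c * u x - c * \<phi> x) < \<epsilon>"
      using D12_norm_scale[OF D12_norm_diff_test_function(1)[OF g \<phi>(1)] c] \<phi>(3) c
      by (simp add: right_diff_distrib field_simps)
    ultimately show ?thesis by blast
  qed
  ultimately show ?thesis unfolding D12_rad_def by blast
qed

text \<open>The substitution of \<open>k * c\<close> for \<open>k\<close> in the infimum gives one inequality for every \<open>c\<close>; applied to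
\<open>1 / c\<close> it gives the other one.\<close>

lemma o_norm_scale:
  assumes c: "c > 0" shows "o_norm V (\<lambda>x. c * u x) = c * o_norm V u"
proof -
  \<comment> \<open>The infimum before it is converted to a real number, since scaling is exact in \<open>ennreal\<close>.\<close>
  define G where "G u = (INF k\<in>{0<..}. ennreal (1 / k) * (1 + V_integral V (\<lambda>x. k * u x)))"
    for u :: "'a \<Rightarrow> real"
  have ge: "ennreal c * G u \<le> G (\<lambda>x. c * u x)" if c: "c > 0" for c u
    unfolding G_def[of "\<lambda>x. c * u x"]
  proof (rule INF_greatest)
    fix k :: real assume k: "k \<in> {0<..}"
    have "ennreal c * G u \<le> ennreal c * (ennreal (1 / (k * c)) * (1 + V_integral V (\<lambda>x. k * c * u x)))"
      unfolding G_def using k c by (intro mult_left_mono INF_lower) auto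
    also have "\<dots> = ennreal (c * (1 / (k * c))) * (1 + V_integral V (\<lambda>x. k * (c * u x)))"
      using k c by (subst ennreal_mult) (auto simp: mult.assoc)
    also have "c * (1 / (k * c)) = 1 / k" using c by simp
    finally show "ennreal c * G u \<le> ennreal (1 / k) * (1 + V_integral V (\<lambda>x. k * (c * u x)))" .
  qed
  have "G (\<lambda>x. c * u x) = ennreal c * G u"
  proof (rule antisym[OF _ ge[OF c]])
    have "ennreal (1 / c) * G (\<lambda>x. c * u x) \<le> G u"
      using ge[of "1 / c" "\<lambda>x. c * u x"] c by simp
    then have "ennreal c * (ennreal (1 / c) * G (\<lambda>x. c * u x)) \<le> ennreal c * G u"
      by (rule mult_left_mono) simp
    moreover have "ennreal c * ennreal (1 / c) = 1"
      using c by (subst ennreal_mult[symmetric]) auto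
    ultimately show "G (\<lambda>x. c * u x) \<le> ennreal c * G u" by (simp add: mult.assoc[symmetric])
  qed
  then show ?thesis
    using c unfolding o_norm_def G_def by (simp add: enn2real_mult)
qed

lemma D12_rad_has_weak_gradient: "u \<in> D12_rad \<Longrightarrow> \<exists>g. has_weak_gradient u g"
  by (auto simp: D12_rad_def D12_def)

lemma E_norm_scale:
  assumes "u \<in> D12_rad" "c > 0" shows "E_norm V (\<lambda>x. c * u x) = c * E_norm V u"
  using D12_rad_has_weak_gradient[OF assms(1)] D12_norm_scale o_norm_scale assms(2)
  by (metis E_norm_def distrib_left)

lemma E_space_scale:
  assumes "continuous_on {0<..} V" "u \<in> E_space V" "c > 0"
  shows "(\<lambda>x. c * u x) \<in> E_space V"
proof -
  have "u \<in> borel_measurable lebesgue" using assms(2) by (auto simp: E_space_def D12_rad_def D12_def)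
  then show ?thesis
    using assms D12_rad_scale V_integral_scale_finite unfolding E_space_def by blast
qed

lemma D12_norm_le_E_norm: "D12_norm u \<le> E_norm V u"
  and E_norm_nonneg: "E_norm V u \<ge> 0"
  unfolding E_norm_def using D12_norm_nonneg[of u] by (auto simp: o_norm_def)

definition weighted_power_integral ::
    "(real \<Rightarrow> real) \<Rightarrow> real \<Rightarrow> 'a::euclidean_space set \<Rightarrow> ('a \<Rightarrow> real) \<Rightarrow> ennreal" where
  "weighted_power_integral K q A u = (\<integral>\<^sup>+x\<in>A. ennreal (K (norm x) * \<bar>u x\<bar> powr q) \<partial>lebesgue)"

lemma weighted_power_measurable:
  assumes "continuous_on {0<..} K" "u \<in> borel_measurable lebesgue"
  shows "(\<lambda>x. ennreal (K (norm x) * \<bar>u x\<bar> powr q)) \<in> borel_measurable lebesgue"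
  using radial_weight_measurable[OF assms(1)] assms(2) by measurable

lemma weighted_power_integral_scale:
  fixes u :: "'a::euclidean_space \<Rightarrow> real"
  assumes "continuous_on {0<..} K" "u \<in> borel_measurable lebesgue" "A \<in> sets lebesgue" "c > 0"
  shows "weighted_power_integral K q A (\<lambda>x. c * u x) = ennreal (c powr q) * weighted_power_integral K q A u"
proof -
  have m: "(\<lambda>x. ennreal (K (norm x) * \<bar>u x\<bar> powr q) * indicator A x) \<in> borel_measurable lebesgue"
    using weighted_power_measurable[OF assms(1,2)] assms(3) by measurable
  have "ennreal (K (norm x) * \<bar>c * u x\<bar> powr q) * indicator A x
      = ennreal (c powr q) * (ennreal (K (norm x) * \<bar>u x\<bar> powr q) * indicator A x)" for x
  proof -
    have "K (norm x) * \<bar>c * u x\<bar> powr q = c powr q * (K (norm x) * \<bar>u x\<bar> powr q)"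
      using assms(4) by (simp add: abs_mult powr_mult)
    then show ?thesis by (simp only: ennreal_mult' powr_ge_zero mult.assoc)
  qed
  then show ?thesis
    unfolding weighted_power_integral_def using m by (simp add: nn_integral_cmult)
qed

lemma E_space_measurable: "u \<in> E_space V \<Longrightarrow> u \<in> borel_measurable lebesgue"
  by (auto simp: E_space_def D12_rad_def D12_def)

text \<open>Elements of positive norm are normalised. An element of norm zero has a profile bounded by a multiple
of \<open>D12_norm u = 0\<close>, so both sides are zero.\<close>

lemma weighted_power_integral_le_SUP:
  fixes u :: "'a::euclidean_space \<Rightarrow> real"
  assumes dim: "DIM('a) \<ge> 3" and V: "continuous_on {0<..} V" and K: "continuous_on {0<..} K"
    and u: "u \<in> E_space V" and A: "A \<in> sets lebesgue"
  shows "weighted_power_integral K q A u \<le> ennreal (E_norm V u powr q) *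
    (SUP v\<in>{v \<in> E_space V. E_norm V v = 1}. weighted_power_integral K q A v)"
    (is "_ \<le> _ * ?S")
proof (cases "E_norm V u = 0")
  case True
  have uD: "u \<in> D12_rad" using u by (simp add: E_space_def)
  have "D12_norm u = 0"
    using True D12_norm_le_E_norm[of u V] D12_norm_nonneg[of u] by simp
  moreover obtain W where W: "AE x in lebesgue. u x = W (norm x)"
    "\<And>r. 0 < r \<Longrightarrow> sphere_area TYPE('a) * (W r)\<^sup>2 \<le> 2 * (D12_norm u)\<^sup>2 * (1 / r) ^ (DIM('a) - 2)"
    using radial_profile[OF dim uD] by metis
  ultimately have W0: "W r = 0" if "r > 0" for r
    using W(2)[OF that] sphere_area_pos[where 'a = 'a] by (simp add: mult_le_0_iff)
  have "AE x in lebesgue. x \<noteq> (0::'a)"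
    by (rule AE_lebesgue_nonzero)
  with W(1) have "AE x in lebesgue. ennreal (K (norm x) * \<bar>u x\<bar> powr q) * indicator A x = 0"
    by eventually_elim (simp add: W0)
  then have "weighted_power_integral K q A u = (\<integral>\<^sup>+(x::'a). 0 \<partial>lebesgue)"
    unfolding weighted_power_integral_def by (rule nn_integral_cong_AE)
  then show ?thesis by simp
next
  case False
  then have t: "E_norm V u > 0" using E_norm_nonneg[of V u] by simp
  let ?t = "E_norm V u"
  let ?v = "\<lambda>x. 1 / ?t * u x"
  have "?v \<in> E_space V" using t by (intro E_space_scale[OF V u]) simp
  moreover have "E_norm V ?v = 1"
    using E_norm_scale[of u "1 / ?t" V] t u by (simp add: E_space_def)
  ultimately have "weighted_power_integral K q A ?v \<le> ?S" by (intro SUP_upper) simp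
  moreover have "weighted_power_integral K q A u = weighted_power_integral K q A (\<lambda>x. ?t * ?v x)"
    using t by simp
  moreover have "\<dots> = ennreal (?t powr q) * weighted_power_integral K q A ?v"
    using E_space_measurable[OF u] t by (intro weighted_power_integral_scale[OF K _ A]) auto
  ultimately show ?thesis by (simp only: mult_left_mono zero_le)
qed

lemma annulus_pointwise_bound:
  assumes dim: "DIM('a::euclidean_space) \<ge> 3" and a: "a > 0"
  obtains c where "c \<ge> 0" "\<And>u::'a \<Rightarrow> real. u \<in> D12_rad \<Longrightarrow>
    AE x in lebesgue. a \<le> norm x \<longrightarrow> \<bar>u x\<bar> \<le> c * D12_norm u"
proof -
  let ?A = "sphere_area TYPE('a)" and ?N = "DIM('a)"
  have A: "?A > 0" by (rule sphere_area_pos)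
  define c where "c = sqrt (2 / ?A * (1 / a) ^ (?N - 2))"
  show thesis
  proof (rule that[of c])
    show "c \<ge> 0" using A a by (simp add: c_def)
    fix u :: "'a \<Rightarrow> real" assume "u \<in> D12_rad"
    then obtain W where W: "AE x in lebesgue. u x = W (norm x)"
      "\<And>r. 0 < r \<Longrightarrow> ?A * (W r)\<^sup>2 \<le> 2 * (D12_norm u)\<^sup>2 * (1 / r) ^ (?N - 2)"
      using radial_profile[OF dim] by metis
    have "\<bar>W r\<bar> \<le> c * D12_norm u" if "a \<le> r" for r
    proof -
      have "?A * (W r)\<^sup>2 \<le> 2 * (D12_norm u)\<^sup>2 * (1 / r) ^ (?N - 2)"
        using W(2) a that by simp
      also have "\<dots> \<le> 2 * (D12_norm u)\<^sup>2 * (1 / a) ^ (?N - 2)"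
        using a that by (intro mult_left_mono power_mono divide_left_mono) auto
      also have "\<dots> = ?A * (2 / ?A * (1 / a) ^ (?N - 2) * (D12_norm u)\<^sup>2)"
        using A by simp
      finally have "(W r)\<^sup>2 \<le> 2 / ?A * (1 / a) ^ (?N - 2) * (D12_norm u)\<^sup>2"
        by (simp only: mult_le_cancel_left_pos[OF A])
      moreover have "c\<^sup>2 = 2 / ?A * (1 / a) ^ (?N - 2)"
        unfolding c_def using A a by (intro real_sqrt_pow2) simp
      ultimately have "\<bar>W r\<bar>\<^sup>2 \<le> (c * D12_norm u)\<^sup>2"
        by (simp only: power2_abs power_mult_distrib)
      moreover have "0 \<le> c * D12_norm u"
        using A a D12_norm_nonneg[of u] by (simp add: c_def)
      ultimately show ?thesis by (rule power2_le_imp_le)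
    qed
    then show "AE x in lebesgue. a \<le> norm x \<longrightarrow> \<bar>u x\<bar> \<le> c * D12_norm u"
      using W(1) by (auto elim!: eventually_mono)
  qed
qed

lemma weighted_power_integral_Un:
  assumes K: "continuous_on {0<..} K" and u: "u \<in> borel_measurable lebesgue"
    and "A \<subseteq> S \<union> T" "S \<in> sets lebesgue" "T \<in> sets lebesgue"
  shows "weighted_power_integral K q A u \<le> weighted_power_integral K q S u + weighted_power_integral K q T u"
proof -
  let ?h = "\<lambda>x. ennreal (K (norm x) * \<bar>u x\<bar> powr q)"
  have "weighted_power_integral K q A u \<le> (\<integral>\<^sup>+x. ?h x * indicator S x + ?h x * indicator T x \<partial>lebesgue)"
    unfolding weighted_power_integral_def
    using assms(3) by (intro nn_integral_mono) (auto simp: indicator_def)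
  also have "\<dots> = weighted_power_integral K q S u + weighted_power_integral K q T u"
    unfolding weighted_power_integral_def using weighted_power_measurable[OF K u] assms(4,5)
    by (intro nn_integral_add) (auto intro!: borel_measurable_times_ennreal)
  finally show ?thesis .
qed

lemma abs_diff_powr_le:
  fixes a b q :: real
  assumes "q > 0" shows "\<bar>a - b\<bar> powr q \<le> 2 powr q * (\<bar>a\<bar> powr q + \<bar>b\<bar> powr q)"
proof -
  have "\<bar>a - b\<bar> powr q \<le> (2 * max \<bar>a\<bar> \<bar>b\<bar>) powr q"
    using assms by (intro powr_mono2) auto
  also have "\<dots> = 2 powr q * max \<bar>a\<bar> \<bar>b\<bar> powr q" by (simp add: powr_mult)
  also have "max \<bar>a\<bar> \<bar>b\<bar> powr q \<le> \<bar>a\<bar> powr q + \<bar>b\<bar> powr q"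
    by (simp add: max_def)
  finally show ?thesis by simp
qed

lemma weighted_power_integral_diff:
  assumes K: "continuous_on {0<..} K" and q: "q > 0"
    and u: "u \<in> borel_measurable lebesgue" and v: "v \<in> borel_measurable lebesgue" and A: "A \<in> sets lebesgue"
  shows "weighted_power_integral K q A (\<lambda>x. u x - v x)
    \<le> ennreal (2 powr q) * (weighted_power_integral K q A u + weighted_power_integral K q A v)"
proof -
  let ?h = "\<lambda>w x. ennreal (K (norm x) * \<bar>w x\<bar> powr q) * indicator A x"
  have m: "?h u \<in> borel_measurable lebesgue" "?h v \<in> borel_measurable lebesgue"
    using weighted_power_measurable[OF K] u v A by (auto intro!: borel_measurable_times_ennreal)
  have "?h (\<lambda>x. u x - v x) x \<le> ennreal (2 powr q) * (?h u x + ?h v x)" for x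
  proof (cases "K (norm x) \<ge> 0")
    case True
    have "K (norm x) * \<bar>u x - v x\<bar> powr q \<le> K (norm x) * (2 powr q * (\<bar>u x\<bar> powr q + \<bar>v x\<bar> powr q))"
      by (intro mult_left_mono abs_diff_powr_le q True)
    also have "\<dots> = 2 powr q * (K (norm x) * \<bar>u x\<bar> powr q + K (norm x) * \<bar>v x\<bar> powr q)"
      by (simp add: algebra_simps)
    finally have "ennreal (K (norm x) * \<bar>u x - v x\<bar> powr q) \<le>
        ennreal (2 powr q) * (ennreal (K (norm x) * \<bar>u x\<bar> powr q) + ennreal (K (norm x) * \<bar>v x\<bar> powr q))"
      using True by (simp add: ennreal_plus[symmetric] ennreal_mult'[symmetric] ennreal_leI del: ennreal_plus)
    then show ?thesis by (simp add: indicator_def)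
  next
    case False
    then have "K (norm x) * \<bar>u x - v x\<bar> powr q \<le> 0" by (simp add: mult_nonpos_nonneg)
    then show ?thesis by (simp add: ennreal_neg)
  qed
  then have "weighted_power_integral K q A (\<lambda>x. u x - v x)
      \<le> (\<integral>\<^sup>+x. ennreal (2 powr q) * (?h u x + ?h v x) \<partial>lebesgue)"
    unfolding weighted_power_integral_def by (rule nn_integral_mono)
  also have "\<dots> = ennreal (2 powr q) * (weighted_power_integral K q A u + weighted_power_integral K q A v)"
    unfolding weighted_power_integral_def using m by (simp add: nn_integral_cmult nn_integral_add)
  finally show ?thesis .
qed

lemma Lp_space_weighted_restrict:
  fixes u :: "'a::euclidean_space \<Rightarrow> real"
  assumes K: "continuous_on {0<..} K" and q: "q > 0"
    and u: "u \<in> borel_measurable lebesgue" and A: "A \<in> sets lebesgue"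
    and fin: "weighted_power_integral K q A u < \<infinity>"
  shows "(\<lambda>x. indicator A x * u x) \<in> Lp_space (weighted_measure K) q"
    "Lp_norm (weighted_measure K) q (\<lambda>x. indicator A x * u x)
      = enn2real (weighted_power_integral K q A u) powr (1 / q)"
proof -
  let ?M = "weighted_measure K :: 'a measure" and ?v = "\<lambda>x. indicator A x * u x"
  let ?h = "\<lambda>x. \<bar>?v x\<bar> powr q"
  have v: "?v \<in> borel_measurable lebesgue" using u A by simp
  have h: "?h \<in> borel_measurable lebesgue" using v by measurable
  have hM: "?h \<in> borel_measurable ?M" using h by (simp add: weighted_measure_def)
  have "(\<integral>\<^sup>+x. ennreal (?h x) \<partial>?M) = (\<integral>\<^sup>+x. ennreal (K (norm x)) * ennreal (?h x) \<partial>lebesgue)"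
    unfolding weighted_measure_def
    using measurable_compose[OF radial_weight_measurable[OF K] measurable_ennreal] h
    by (intro nn_integral_density) auto
  also have "\<dots> = weighted_power_integral K q A u"
    unfolding weighted_power_integral_def
    by (intro nn_integral_cong) (auto simp: indicator_def ennreal_mult'')
  finally have eq: "(\<integral>\<^sup>+x. ennreal (?h x) \<partial>?M) = weighted_power_integral K q A u" .
  have i: "integrable ?M ?h"
    by (rule integrableI_nonneg[OF hM]) (use eq fin in auto)
  show "?v \<in> Lp_space ?M q"
    using i v by (simp add: Lp_space_def weighted_measure_def)
  show "Lp_norm ?M q ?v = enn2real (weighted_power_integral K q A u) powr (1 / q)"
    unfolding Lp_norm_def eq[symmetric] by (subst integral_eq_nn_integral[OF hM]) auto
qed

section \<open>The embeddings\<close>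

text \<open>Cutting \<open>u\<close> at the boundary of \<open>A\<close> is the only decomposition used to estimate the sum norm.\<close>

lemma sum_space_split:
  fixes u :: "'a::euclidean_space \<Rightarrow> real"
  assumes K: "continuous_on {0<..} K" and q: "q1 > 0" "q2 > 0"
    and u: "u \<in> borel_measurable lebesgue" and A: "A \<in> sets lebesgue"
    and fin: "weighted_power_integral K q1 A u < \<infinity>" "weighted_power_integral K q2 (- A) u < \<infinity>"
  shows "u \<in> sum_space (weighted_measure K) q1 q2"
    "sum_norm (weighted_measure K) q1 q2 u \<le>
      max (enn2real (weighted_power_integral K q1 A u) powr (1 / q1))
          (enn2real (weighted_power_integral K q2 (- A) u) powr (1 / q2))"
proof -
  let ?M = "weighted_measure K :: 'a measure"
  let ?u1 = "\<lambda>x. indicator A x * u x" and ?u2 = "\<lambda>x. indicator (- A) x * u x"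
  have A': "- A \<in> sets lebesgue" using sets.compl_sets[OF A] by (simp add: Compl_eq_Diff_UNIV)
  note 1 = Lp_space_weighted_restrict[OF K q(1) u A fin(1)]
    and 2 = Lp_space_weighted_restrict[OF K q(2) u A' fin(2)]
  have eq: "u = (\<lambda>x. ?u1 x + ?u2 x)" by (auto simp: indicator_def)
  then show "u \<in> sum_space ?M q1 q2"
    unfolding sum_space_def using 1(1) 2(1) by (intro CollectI exI[of _ ?u1] exI[of _ ?u2] conjI)
  have "sum_norm ?M q1 q2 u \<le> max (Lp_norm ?M q1 ?u1) (Lp_norm ?M q2 ?u2)"
    unfolding sum_norm_def
  proof (rule cInf_lower)
    show "max (Lp_norm ?M q1 ?u1) (Lp_norm ?M q2 ?u2) \<in> {max (Lp_norm ?M q1 u1) (Lp_norm ?M q2 u2) |u1 u2.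
      u1 \<in> Lp_space ?M q1 \<and> u2 \<in> Lp_space ?M q2 \<and> u = (\<lambda>x. u1 x + u2 x)}"
      using 1(1) 2(1) eq by (intro CollectI exI[of _ ?u1] exI[of _ ?u2] conjI refl)
    show "bdd_below {max (Lp_norm ?M q1 u1) (Lp_norm ?M q2 u2) |u1 u2.
      u1 \<in> Lp_space ?M q1 \<and> u2 \<in> Lp_space ?M q2 \<and> u = (\<lambda>x. u1 x + u2 x)}"
      by (rule bdd_belowI[of _ 0]) (auto simp: Lp_norm_def le_max_iff_disj)
  qed
  then show "sum_norm ?M q1 q2 u \<le>
      max (enn2real (weighted_power_integral K q1 A u) powr (1 / q1))
          (enn2real (weighted_power_integral K q2 (- A) u) powr (1 / q2))"
    unfolding 1(2) 2(2) .
qed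

lemma sum_norm_nonneg: 
  assumes "u \<in> sum_space M q1 q2" shows "sum_norm M q1 q2 u \<ge> 0"
  unfolding sum_norm_def
proof (rule cInf_greatest)
  show "{max (Lp_norm M q1 u1) (Lp_norm M q2 u2) |u1 u2.
      u1 \<in> Lp_space M q1 \<and> u2 \<in> Lp_space M q2 \<and> u = (\<lambda>x. u1 x + u2 x)} \<noteq> {}"
    using assms by (auto simp: sum_space_def)
qed (auto simp: Lp_norm_def le_max_iff_disj)

lemma weight_bounded_on_annulus:
  fixes K :: "real \<Rightarrow> real"
  assumes K: "continuous_on {0<..} K" and a: "a > 0"
  obtains c where "c \<ge> 0" "\<And>r. a \<le> r \<Longrightarrow> r \<le> b \<Longrightarrow> K r \<le> c"
proof -
  have "compact (K ` {a..b})"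
    using a by (intro compact_continuous_image continuous_on_subset[OF K]) auto
  then obtain c where "\<forall>y\<in>K ` {a..b}. norm y \<le> c"
    using compact_imp_bounded bounded_iff by blast
  then have "K r \<le> max 0 c" if "a \<le> r" "r \<le> b" for r
    using that by (force simp: le_max_iff_disj)
  then show thesis using that[of "max 0 c"] by simp
qed

lemma annulus_integral_bound:
  assumes dim: "DIM('a::euclidean_space) \<ge> 3" and K: "continuous_on {0<..} K"
    and a: "a > 0" and q: "q > 0"
  obtains C where "C \<ge> 0" "\<And>u::'a \<Rightarrow> real. u \<in> E_space V \<Longrightarrow>
    weighted_power_integral K q (cball 0 b - ball 0 a) u \<le> ennreal (C * E_norm V u powr q)"
proof -
  obtain c where c: "c \<ge> 0" "\<And>u::'a \<Rightarrow> real. u \<in> D12_rad \<Longrightarrow>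
    AE x in lebesgue. a \<le> norm x \<longrightarrow> \<bar>u x\<bar> \<le> c * D12_norm u"
    using annulus_pointwise_bound[OF dim a] by blast
  obtain k where k: "k \<ge> 0" "\<And>r. a \<le> r \<Longrightarrow> r \<le> b \<Longrightarrow> K r \<le> k"
    using weight_bounded_on_annulus[OF K a] by metis
  let ?Y = "cball (0::'a) b - ball 0 a"
  define C where "C = k * c powr q * measure lebesgue ?Y"
  have Y: "?Y \<in> lmeasurable" by (intro fmeasurable_Diff) auto
  show thesis
  proof (rule that[of C])
    show "C \<ge> 0" using c k by (simp add: C_def)
    fix u :: "'a \<Rightarrow> real" assume u: "u \<in> E_space V"
    have "weighted_power_integral K q ?Y u \<le>
        (\<integral>\<^sup>+x. ennreal (k * (c * E_norm V u) powr q) * indicator ?Y x \<partial>lebesgue)"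
      unfolding weighted_power_integral_def
    proof (rule nn_integral_mono_AE)
      have "AE x in lebesgue. a \<le> norm x \<longrightarrow> \<bar>u x\<bar> \<le> c * D12_norm u"
        using u by (intro c(2)) (simp add: E_space_def)
      then show "AE x in lebesgue. ennreal (K (norm x) * \<bar>u x\<bar> powr q) * indicator ?Y x
          \<le> ennreal (k * (c * E_norm V u) powr q) * indicator ?Y x"
      proof eventually_elim
        case (elim x)
        show ?case
        proof (cases "x \<in> ?Y")
          case True
          have "\<bar>u x\<bar> \<le> c * D12_norm u" using elim True by auto
          also have "\<dots> \<le> c * E_norm V u" by (intro mult_left_mono D12_norm_le_E_norm c(1))
          finally have "\<bar>u x\<bar> powr q \<le> (c * E_norm V u) powr q" using q by (intro powr_mono2) auto
          then have "K (norm x) * \<bar>u x\<bar> powr q \<le> k * (c * E_norm V u) powr q"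
            using k True by (intro mult_mono) auto
          then show ?thesis by (simp add: mult_right_mono ennreal_leI)
        qed simp
      qed
    qed
    also have "\<dots> = ennreal (k * (c * E_norm V u) powr q) * emeasure lebesgue ?Y"
      using Y by (intro nn_integral_cmult_indicator) auto
    also have "\<dots> = ennreal (k * (c * E_norm V u) powr q * measure lebesgue ?Y)"
      using Y k by (simp add: emeasure_eq_measure2 ennreal_mult')
    also have "k * (c * E_norm V u) powr q * measure lebesgue ?Y = C * E_norm V u powr q"
      using c(1) E_norm_nonneg[of V u] by (simp add: C_def powr_mult)
    finally show "weighted_power_integral K q ?Y u \<le> ennreal (C * E_norm V u powr q)" .
  qed
qed

lemma S_zero_eq: "S_zero TYPE('a::euclidean_space) V K q R
    = (SUP v\<in>{v \<in> E_space V. E_norm V v = 1}. weighted_power_integral K q (ball (0::'a) R) v)"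
  and S_infty_eq: "S_infty TYPE('a::euclidean_space) V K q R
    = (SUP v\<in>{v \<in> E_space V. E_norm V v = 1}. weighted_power_integral K q (- ball (0::'a) R) v)"
  by (simp_all add: S_zero_def S_infty_def weighted_power_integral_def)

lemma weighted_power_integral_le_S_zero:
  fixes u :: "'a::euclidean_space \<Rightarrow> real"
  assumes "DIM('a) \<ge> 3" "continuous_on {0<..} V" "continuous_on {0<..} K" "u \<in> E_space V"
  shows "weighted_power_integral K q (ball 0 R) u \<le> ennreal (E_norm V u powr q) * S_zero TYPE('a) V K q R"
  unfolding S_zero_eq using assms by (intro weighted_power_integral_le_SUP) auto

lemma weighted_power_integral_le_S_infty:
  fixes u :: "'a::euclidean_space \<Rightarrow> real"
  assumes "DIM('a) \<ge> 3" "continuous_on {0<..} V" "continuous_on {0<..} K" "u \<in> E_space V"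
  shows "weighted_power_integral K q (- ball 0 R) u \<le> ennreal (E_norm V u powr q) * S_infty TYPE('a) V K q R"
  unfolding S_infty_eq using assms by (intro weighted_power_integral_le_SUP) auto

text \<open>The part of \<open>u\<close> in the ball of radius \<open>R2\<close> lies in the ball of radius \<open>R1\<close> and the annulus between
the two radii, which is a null set unless \<open>R1 < R2\<close>; each piece is at most a constant times
\<open>E_norm V u powr q1\<close>.\<close>

lemma continuous_embedding:
  fixes V K :: "real \<Rightarrow> real"
  assumes dim: "DIM('a::euclidean_space) \<ge> 3"
    and V: "continuous_on {0<..} V" and K: "continuous_on {0<..} K" and q: "q1 > 0" "q2 > 0"
    and R: "R1 > 0" "R2 > 0"
    and S: "S_zero TYPE('a) V K q1 R1 < \<infinity>" "S_infty TYPE('a) V K q2 R2 < \<infinity>"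
  shows "continuously_embedded (E_space V :: ('a \<Rightarrow> real) set) (E_norm V)
    (sum_space (weighted_measure K) q1 q2) (sum_norm (weighted_measure K) q1 q2)"
proof -
  obtain C where C: "C \<ge> 0" "\<And>u::'a \<Rightarrow> real. u \<in> E_space V \<Longrightarrow>
    weighted_power_integral K q1 (cball 0 R2 - ball 0 R1) u \<le> ennreal (C * E_norm V u powr q1)"
    using annulus_integral_bound[OF dim K R(1) q(1)] by metis
  obtain s1 where s1: "S_zero TYPE('a) V K q1 R1 = ennreal s1" "s1 \<ge> 0"
    using S(1) by (cases "S_zero TYPE('a) V K q1 R1") auto
  obtain s2 where s2: "S_infty TYPE('a) V K q2 R2 = ennreal s2" "s2 \<ge> 0"
    using S(2) by (cases "S_infty TYPE('a) V K q2 R2") auto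
  let ?B = "ball (0::'a) R2" and ?M = "weighted_measure K :: 'a measure"
  let ?c1 = "(s1 + C) powr (1 / q1)" and ?c2 = "s2 powr (1 / q2)"
  have main: "u \<in> sum_space ?M q1 q2 \<and> sum_norm ?M q1 q2 u \<le> max ?c1 ?c2 * E_norm V u"
    if u: "u \<in> E_space V" for u :: "'a \<Rightarrow> real"
  proof -
    let ?t = "E_norm V u"
    have t: "?t \<ge> 0" by (rule E_norm_nonneg)
    note um = E_space_measurable[OF u]
    have "weighted_power_integral K q1 ?B u \<le> weighted_power_integral K q1 (ball 0 R1) u
        + weighted_power_integral K q1 (cball 0 R2 - ball 0 R1) u"
      by (rule weighted_power_integral_Un[OF K um]) auto
    also have "\<dots> \<le> ennreal (?t powr q1) * ennreal s1 + ennreal (C * ?t powr q1)"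
      using weighted_power_integral_le_S_zero[OF dim V K u, of q1 R1] C(2)[OF u]
      unfolding s1(1) by (intro add_mono)
    also have "\<dots> = ennreal ((s1 + C) * ?t powr q1)"
      using s1(2) C(1)
      by (simp add: ennreal_mult[symmetric] ennreal_plus[symmetric] algebra_simps del: ennreal_plus)
    finally have 1: "weighted_power_integral K q1 ?B u \<le> ennreal ((s1 + C) * ?t powr q1)" .
    have "weighted_power_integral K q2 (- ?B) u \<le> ennreal (?t powr q2) * ennreal s2"
      using weighted_power_integral_le_S_infty[OF dim V K u, of q2 R2] unfolding s2(1) .
    also have "\<dots> = ennreal (s2 * ?t powr q2)"
      using s2(2) by (simp add: ennreal_mult[symmetric] mult.commute)
    finally have 2: "weighted_power_integral K q2 (- ?B) u \<le> ennreal (s2 * ?t powr q2)" .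
    have root: "enn2real I powr (1 / q) \<le> s powr (1 / q) * ?t"
      if "I \<le> ennreal (s * ?t powr q)" "s \<ge> 0" "q > 0" for I s q
    proof -
      have "enn2real I \<le> s * ?t powr q" using that by (intro enn2real_leI) auto
      then have "enn2real I powr (1 / q) \<le> (s * ?t powr q) powr (1 / q)"
        using that by (intro powr_mono2) auto
      also have "\<dots> = s powr (1 / q) * ?t"
        using that t by (simp add: powr_mult powr_powr)
      finally show ?thesis .
    qed
    have fin: "weighted_power_integral K q1 ?B u < \<infinity>" "weighted_power_integral K q2 (- ?B) u < \<infinity>"
      using 1 2 by (auto intro: le_less_trans)
    note split = sum_space_split[OF K q um _ fin]
    have "sum_norm ?M q1 q2 u \<le> max (?c1 * ?t) (?c2 * ?t)"
      using split(2) root[OF 1 _ q(1)] root[OF 2 _ q(2)] s1(2) s2(2) C(1) by fastforce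
    also have "\<dots> = max ?c1 ?c2 * ?t"
      using t by (simp add: max_mult_distrib_right)
    finally show ?thesis using split(1) by simp
  qed
  then show ?thesis
    unfolding continuously_embedded_def by blast
qed

text \<open>The Arzela--Ascoli argument for the profiles: a diagonal subsequence converges at all positive
rational radii, and equicontinuity from the increment bound extends this to all positive radii.
Pointwise convergence suffices because dominated convergence is available on annuli.\<close>

lemma bounded_radial_subsequence:
  fixes u :: "nat \<Rightarrow> 'a::euclidean_space \<Rightarrow> real"
  assumes dim: "DIM('a) \<ge> 3" and u: "\<And>n. u n \<in> D12_rad" and B: "\<And>n. D12_norm (u n) \<le> B"
  obtains k v where "strict_mono (k :: nat \<Rightarrow> nat)" "v \<in> borel_measurable lebesgue"
    "AE x in lebesgue. (\<lambda>n. u (k n) x) \<longlonglongrightarrow> v x"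
proof -
  let ?A = "sphere_area TYPE('a)" and ?N = "DIM('a)"
  have A: "?A > 0" by (rule sphere_area_pos)
  have "\<forall>n. \<exists>W. W \<in> borel_measurable borel \<and> (AE x in lebesgue. u n x = W (norm x)) \<and>
    (\<forall>r s. 0 < r \<longrightarrow> r \<le> s \<longrightarrow> ?A * (W s - W r)\<^sup>2
        \<le> 2 * (D12_norm (u n))\<^sup>2 * ((1 / r) ^ (?N - 3) * (1 / r - 1 / s))) \<and>
    (\<forall>r>0. ?A * (W r)\<^sup>2 \<le> 2 * (D12_norm (u n))\<^sup>2 * (1 / r) ^ (?N - 2))"
    by (rule allI, rule radial_profile[OF dim u]) blast
  from choice[OF this] obtain W where W: "\<And>n. W n \<in> borel_measurable borel" "\<And>n. AE x in lebesgue. u n x = W n (norm x)"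
    and incr: "\<And>n r s. 0 < r \<Longrightarrow> r \<le> s \<Longrightarrow> ?A * (W n s - W n r)\<^sup>2
        \<le> 2 * (D12_norm (u n))\<^sup>2 * ((1 / r) ^ (?N - 3) * (1 / r - 1 / s))"
    and bound: "\<And>n r. 0 < r \<Longrightarrow> ?A * (W n r)\<^sup>2 \<le> 2 * (D12_norm (u n))\<^sup>2 * (1 / r) ^ (?N - 2)"
    by blast
  have B2: "2 * (D12_norm (u n))\<^sup>2 \<le> 2 * B\<^sup>2" for n
    using power_mono[OF B[of n] D12_norm_nonneg, of 2] by simp
  \<comment> \<open>Dividing by the decay rate makes the profiles uniformly bounded on all positive radii at once.\<close>
  define F where "F n r = W n r / sqrt ((1 / r) ^ (?N - 2))" for n r
  have F_bound: "norm (F n r) \<le> sqrt (2 * B\<^sup>2 / ?A)" if "r \<in> \<rat> \<inter> {0<..}" for n r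
  proof -
    have r: "r > 0" "(1 / r) ^ (?N - 2) > 0" using that by auto
    have "?A * (W n r)\<^sup>2 \<le> 2 * B\<^sup>2 * (1 / r) ^ (?N - 2)"
      using bound[OF r(1), of n] mult_right_mono[OF B2[of n] less_imp_le[OF r(2)]] by linarith
    then have "?A * (W n r)\<^sup>2 / (1 / r) ^ (?N - 2) \<le> 2 * B\<^sup>2"
      by (simp only: pos_divide_le_eq[OF r(2)])
    moreover have "(F n r)\<^sup>2 = (W n r)\<^sup>2 / (1 / r) ^ (?N - 2)"
      unfolding F_def power_divide using r by simp
    ultimately have "(F n r)\<^sup>2 * ?A \<le> 2 * B\<^sup>2" by (simp add: mult.commute)
    then have "(F n r)\<^sup>2 \<le> 2 * B\<^sup>2 / ?A" by (simp only: pos_le_divide_eq[OF A])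
    then show ?thesis
      using real_sqrt_le_mono by fastforce
  qed
  have "countable (\<rat> \<inter> {0<..} :: real set)"
    by (intro countable_Int1 countable_rat)
  then obtain k where k: "strict_mono (k::nat\<Rightarrow>nat)"
    "\<And>r. r \<in> \<rat> \<inter> {0<..} \<Longrightarrow> \<exists>l. (\<lambda>n. F (k n) r) \<longlonglongrightarrow> l"
    using function_convergent_subsequence[of "\<rat> \<inter> {0<..}" F "sqrt (2 * B\<^sup>2 / ?A)"] F_bound by blast
  have conv_rat: "convergent (\<lambda>n. W (k n) s)" if s: "s \<in> \<rat>" "s > 0" for s
  proof -
    obtain l where "(\<lambda>n. F (k n) s) \<longlonglongrightarrow> l" using k(2)[of s] s by auto
    then have "(\<lambda>n. F (k n) s * sqrt ((1 / s) ^ (?N - 2))) \<longlonglongrightarrow> l * sqrt ((1 / s) ^ (?N - 2))"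
      by (intro tendsto_intros)
    moreover have "F (k n) s * sqrt ((1 / s) ^ (?N - 2)) = W (k n) s" for n
      using s by (simp add: F_def)
    ultimately show ?thesis by (auto simp: convergent_def)
  qed
  have conv: "convergent (\<lambda>n. W (k n) r)" if r: "r > 0" for r
  proof -
    have "Cauchy (\<lambda>n. W (k n) r)"
    proof (rule CauchyI)
      fix \<epsilon> :: real assume \<epsilon>: "\<epsilon> > 0"
      let ?m = "\<lambda>s. 2 * B\<^sup>2 * ((1 / r) ^ (?N - 3) * (1 / r - 1 / s))"
      have "(?m \<longlongrightarrow> 2 * B\<^sup>2 * ((1 / r) ^ (?N - 3) * (1 / r - 1 / r))) (at_right r)"
        using r by (intro tendsto_intros) auto
      then have "\<forall>\<^sub>F s in at_right r. ?m s < ?A * (\<epsilon> / 3)\<^sup>2"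
        using A \<epsilon> by (intro order_tendstoD(2)) auto
      then obtain d where d: "d > r" "\<And>s. r < s \<Longrightarrow> s < d \<Longrightarrow> ?m s < ?A * (\<epsilon> / 3)\<^sup>2"
        unfolding eventually_at_right_field by blast
      obtain s where s: "s \<in> \<rat>" "r < s" "s < d" using Rats_dense_in_real[OF d(1)] by blast
      have close: "\<bar>W n s - W n r\<bar> < \<epsilon> / 3" for n
      proof -
        have "?A * (W n s - W n r)\<^sup>2 \<le> 2 * (D12_norm (u n))\<^sup>2 * ((1 / r) ^ (?N - 3) * (1 / r - 1 / s))"
          using r s by (intro incr) auto
        also have "\<dots> \<le> ?m s"
          using r s by (intro mult_right_mono[OF B2]) (auto simp: frac_le)
        also have "\<dots> < ?A * (\<epsilon> / 3)\<^sup>2" using d(2) s by simp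
        finally have "\<bar>W n s - W n r\<bar>\<^sup>2 < (\<epsilon> / 3)\<^sup>2" using A by simp
        then show ?thesis by (rule power_less_imp_less_base) (use \<epsilon> in simp)
      qed
      have "Cauchy (\<lambda>n. W (k n) s)" using conv_rat[of s] s r by (simp add: Cauchy_convergent_iff)
      then obtain M where M: "\<And>m n. m \<ge> M \<Longrightarrow> n \<ge> M \<Longrightarrow> norm (W (k m) s - W (k n) s) < \<epsilon> / 3"
        using CauchyD[of _ "\<epsilon> / 3"] \<epsilon> by (metis divide_pos_pos zero_less_numeral)
      have "norm (W (k m) r - W (k n) r) < \<epsilon>" if "m \<ge> M" "n \<ge> M" for m n
        using M[OF that] close[of "k m"] close[of "k n"] unfolding real_norm_def by linarith
      then show "\<exists>M. \<forall>m\<ge>M. \<forall>n\<ge>M. norm (W (k m) r - W (k n) r) < \<epsilon>" by blast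
    qed
    then show ?thesis by (rule Cauchy_convergent)
  qed
  define v where "v x = lim (\<lambda>n. W (k n) (norm x))" for x :: 'a
  have "v \<in> borel_measurable lborel"
    unfolding v_def using W(1)
    by (intro borel_measurable_lim_metric measurable_compose[OF borel_measurable_norm]) auto
  then have v: "v \<in> borel_measurable lebesgue" by (rule measurable_completion)
  have "AE x in lebesgue. \<forall>n. u n x = W n (norm x)"
    unfolding AE_all_countable using W(2) by blast
  moreover have "AE x in lebesgue. x \<noteq> (0::'a)"
    by (rule AE_lebesgue_nonzero)
  ultimately have "AE x in lebesgue. (\<lambda>n. u (k n) x) \<longlonglongrightarrow> v x"
  proof eventually_elim
    case (elim x)
    then show ?case
      using conv[of "norm x"] by (simp add: v_def convergent_LIMSEQ_iff)
  qed
  from that[OF k(1) v this] show thesis .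
qed

lemma weighted_power_integral_Fatou:
  assumes K: "continuous_on {0<..} K" and q: "q > 0" and A: "A \<in> sets lebesgue"
    and u: "\<And>n. u n \<in> borel_measurable lebesgue"
    and conv: "AE x in lebesgue. (\<lambda>n. u n x) \<longlonglongrightarrow> v x"
    and le: "\<And>n. weighted_power_integral K q A (u n) \<le> c"
  shows "weighted_power_integral K q A v \<le> c"
proof -
  let ?h = "\<lambda>w x. ennreal (K (norm x) * \<bar>w x\<bar> powr q) * indicator A x"
  have "AE x in lebesgue. ?h v x = liminf (\<lambda>n. ?h (u n) x)"
    using conv
  proof eventually_elim
    case (elim x)
    have "(\<lambda>n. K (norm x) * \<bar>u n x\<bar> powr q) \<longlonglongrightarrow> K (norm x) * \<bar>v x\<bar> powr q"
      using q by (intro tendsto_intros tendsto_powr' elim) auto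
    then have "(\<lambda>n. ?h (u n) x) \<longlonglongrightarrow> ?h v x"
      by (cases "x \<in> A") (auto intro: tendsto_ennrealI)
    then show ?case by (intro lim_imp_Liminf[symmetric]) auto
  qed
  then have "weighted_power_integral K q A v = (\<integral>\<^sup>+x. liminf (\<lambda>n. ?h (u n) x) \<partial>lebesgue)"
    unfolding weighted_power_integral_def by (rule nn_integral_cong_AE)
  also have "\<dots> \<le> liminf (\<lambda>n. \<integral>\<^sup>+x. ?h (u n) x \<partial>lebesgue)"
    using weighted_power_measurable[OF K u] A
    by (intro nn_integral_liminf) (auto intro!: borel_measurable_times_ennreal)
  also have "\<dots> \<le> liminf (\<lambda>n::nat. c)"
    using le unfolding weighted_power_integral_def by (intro Liminf_mono) auto
  also have "\<dots> = c" by (rule Liminf_const) simp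
  finally show ?thesis .
qed

lemma annulus_integral_tendsto_0:
  fixes u :: "nat \<Rightarrow> 'a::euclidean_space \<Rightarrow> real"
  assumes dim: "DIM('a) \<ge> 3" and K: "continuous_on {0<..} K" and q: "q > 0" and a: "a > 0"
    and u: "\<And>n. u n \<in> D12_rad" and B: "\<And>n. D12_norm (u n) \<le> B"
    and v: "v \<in> borel_measurable lebesgue" and conv: "AE x in lebesgue. (\<lambda>n. u n x) \<longlonglongrightarrow> v x"
  shows "(\<lambda>n. weighted_power_integral K q (cball 0 b - ball 0 a) (\<lambda>x. u n x - v x)) \<longlonglongrightarrow> 0"
proof -
  let ?Y = "cball (0::'a) b - ball 0 a"
  have Y: "?Y \<in> lmeasurable" by (intro fmeasurable_Diff) auto
  obtain c where c: "c \<ge> 0" "\<And>u::'a \<Rightarrow> real. u \<in> D12_rad \<Longrightarrow>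
    AE x in lebesgue. a \<le> norm x \<longrightarrow> \<bar>u x\<bar> \<le> c * D12_norm u"
    using annulus_pointwise_bound[OF dim a] by blast
  obtain k where k: "k \<ge> 0" "\<And>r. a \<le> r \<Longrightarrow> r \<le> b \<Longrightarrow> K r \<le> k"
    using weight_bounded_on_annulus[OF K a] by metis
  let ?h = "\<lambda>n x. ennreal (K (norm x) * \<bar>u n x - v x\<bar> powr q) * indicator ?Y x"
  let ?w = "\<lambda>x. ennreal (k * (2 * (c * B)) powr q) * indicator ?Y x"
  have um: "u n \<in> borel_measurable lebesgue" for n using u by (auto simp: D12_rad_def D12_def)
  have "AE x in lebesgue. \<forall>n. a \<le> norm x \<longrightarrow> \<bar>u n x\<bar> \<le> c * D12_norm (u n)"
    unfolding AE_all_countable using c(2) u by blast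
  with conv have dom: "AE x in lebesgue. \<forall>n. ?h n x \<le> ?w x"
  proof eventually_elim
    case (elim x)
    show ?case
    proof
      fix n
      show "?h n x \<le> ?w x"
      proof (cases "x \<in> ?Y")
        case True
        have ub: "\<bar>u n x\<bar> \<le> c * B" for n
          using elim(2) True mult_left_mono[OF B[of n] c(1)] by (force intro: order_trans)
        have "(\<lambda>n. \<bar>u n x\<bar>) \<longlonglongrightarrow> \<bar>v x\<bar>" using elim(1) by (rule tendsto_rabs)
        then have "\<bar>v x\<bar> \<le> c * B" using ub by (intro LIMSEQ_le_const2) auto
        then have "\<bar>u n x - v x\<bar> \<le> 2 * (c * B)" using ub[of n] by linarith
        then have "\<bar>u n x - v x\<bar> powr q \<le> (2 * (c * B)) powr q" using q by (intro powr_mono2) auto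
        then have "K (norm x) * \<bar>u n x - v x\<bar> powr q \<le> k * (2 * (c * B)) powr q"
          using k True by (intro mult_mono) auto
        then show ?thesis by (simp add: mult_right_mono ennreal_leI)
      qed simp
    qed
  qed
  have "(\<lambda>n. \<integral>\<^sup>+x. ?h n x \<partial>lebesgue) \<longlonglongrightarrow> (\<integral>\<^sup>+(x::'a). 0 \<partial>lebesgue)"
  proof (rule nn_integral_dominated_convergence)
    show "?h n \<in> borel_measurable lebesgue" for n
      using weighted_power_measurable[OF K, of "\<lambda>x. u n x - v x"] um v Y
      by (intro borel_measurable_times_ennreal) auto
    show "?w \<in> borel_measurable lebesgue" using Y by (intro borel_measurable_times_ennreal) auto
    show "AE x in lebesgue. ?h n x \<le> ?w x" for n using dom by eventually_elim blast
    have "(\<integral>\<^sup>+x. ?w x \<partial>lebesgue) = ennreal (k * (2 * (c * B)) powr q) * emeasure lebesgue ?Y"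
      using Y by (intro nn_integral_cmult_indicator) auto
    also have "\<dots> < \<infinity>" using Y by (simp add: fmeasurable_def ennreal_mult_less_top)
    finally show "(\<integral>\<^sup>+x. ?w x \<partial>lebesgue) < \<infinity>" .
    show "AE x in lebesgue. (\<lambda>n. ?h n x) \<longlonglongrightarrow> 0"
      using conv
    proof eventually_elim
      case (elim x)
      have "(\<lambda>n. K (norm x) * \<bar>u n x - v x\<bar> powr q) \<longlonglongrightarrow> K (norm x) * \<bar>v x - v x\<bar> powr q"
        using q by (intro tendsto_intros tendsto_powr' elim) auto
      then have "(\<lambda>n. ennreal (K (norm x) * \<bar>u n x - v x\<bar> powr q)) \<longlonglongrightarrow> 0"
        by (auto dest: tendsto_ennrealI)
      then show ?case by (cases "x \<in> ?Y") auto
    qed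
  qed simp
  then show ?thesis unfolding weighted_power_integral_def by simp
qed

text \<open>Here \<open>T\<close> is a neighbourhood of the origin or of infinity, on which the integrals of all \<open>u n\<close> are
small. By Fatou's lemma the integral of the limit is small there as well, and what remains of \<open>Z\<close> is
covered by an annulus.\<close>

lemma integral_tendsto_0_if_small_tails:
  fixes u :: "nat \<Rightarrow> 'a::euclidean_space \<Rightarrow> real"
  assumes dim: "DIM('a) \<ge> 3" and K: "continuous_on {0<..} K" and q: "q > 0"
    and u: "\<And>n. u n \<in> D12_rad" and B: "\<And>n. D12_norm (u n) \<le> B"
    and v: "v \<in> borel_measurable lebesgue" and conv: "AE x in lebesgue. (\<lambda>n. u n x) \<longlonglongrightarrow> v x"
    and tails: "\<And>\<epsilon>. \<epsilon> > 0 \<Longrightarrow> \<exists>T a b. T \<in> sets lebesgue \<and> a > 0 \<and> Z \<subseteq> T \<union> (cball 0 b - ball 0 a) \<and>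
        (\<forall>n. weighted_power_integral K q T (u n) \<le> ennreal \<epsilon>)"
  shows "(\<lambda>n. weighted_power_integral K q Z (\<lambda>x. u n x - v x)) \<longlonglongrightarrow> 0"
proof (rule order_tendstoI)
  fix y :: ennreal assume "0 < y"
  then obtain z where z: "0 < z" "z < y" using dense by blast
  then obtain e where e: "z = ennreal e" "e > 0"
    by (cases z) auto
  \<comment> \<open>The tails of \<open>u n\<close> and of \<open>v\<close> contribute \<open>2 powr q * (\<epsilon> + \<epsilon>) = e / 2\<close>.\<close>
  define \<epsilon> where "\<epsilon> = e / (4 * 2 powr q)"
  have \<epsilon>: "\<epsilon> > 0" using e by (simp add: \<epsilon>_def)
  from tails[OF this] obtain T a b where T: "T \<in> sets lebesgue" "a > 0" "Z \<subseteq> T \<union> (cball 0 b - ball 0 a)"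
    "\<And>n. weighted_power_integral K q T (u n) \<le> ennreal \<epsilon>" by blast
  let ?Y = "cball (0::'a) b - ball 0 a"
  have um: "u n \<in> borel_measurable lebesgue" for n using u by (auto simp: D12_rad_def D12_def)
  have Tv: "weighted_power_integral K q T v \<le> ennreal \<epsilon>"
    by (rule weighted_power_integral_Fatou[OF K q T(1) um conv T(4)])
  have T_diff: "weighted_power_integral K q T (\<lambda>x. u n x - v x) \<le> ennreal (e / 2)" for n
  proof -
    have "weighted_power_integral K q T (\<lambda>x. u n x - v x)
      \<le> ennreal (2 powr q) * (weighted_power_integral K q T (u n) + weighted_power_integral K q T v)"
      by (rule weighted_power_integral_diff[OF K q um v T(1)])
    also have "\<dots> \<le> ennreal (2 powr q) * (ennreal \<epsilon> + ennreal \<epsilon>)"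
      by (intro mult_left_mono add_mono T(4) Tv) simp
    also have "\<dots> = ennreal (2 powr q * (\<epsilon> + \<epsilon>))"
      using \<epsilon> by (simp add: ennreal_mult[symmetric] ennreal_plus[symmetric] del: ennreal_plus)
    also have "2 powr q * (\<epsilon> + \<epsilon>) = e / 2" by (simp add: \<epsilon>_def)
    finally show ?thesis .
  qed
  have "(\<lambda>n. weighted_power_integral K q ?Y (\<lambda>x. u n x - v x)) \<longlonglongrightarrow> 0"
    by (rule annulus_integral_tendsto_0[OF dim K q T(2) u B v conv])
  then have "\<forall>\<^sub>F n in sequentially. weighted_power_integral K q ?Y (\<lambda>x. u n x - v x) < ennreal (e / 2)"
    using e by (intro order_tendstoD(2)) auto
  then show "\<forall>\<^sub>F n in sequentially. weighted_power_integral K q Z (\<lambda>x. u n x - v x) < y"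
  proof eventually_elim
    case (elim n)
    have "weighted_power_integral K q Z (\<lambda>x. u n x - v x) \<le>
        weighted_power_integral K q T (\<lambda>x. u n x - v x) + weighted_power_integral K q ?Y (\<lambda>x. u n x - v x)"
      using T um v by (intro weighted_power_integral_Un[OF K]) auto
    also have "\<dots> \<le> ennreal (e / 2) + ennreal (e / 2)"
      by (intro add_mono T_diff less_imp_le[OF elim])
    also have "\<dots> = z" using e by (simp add: ennreal_plus[symmetric] del: ennreal_plus)
    finally show ?case using z(2) by simp
  qed
qed simp

lemma S_tail_small:
  assumes "(S \<longlongrightarrow> 0) F" "F \<noteq> bot" "\<forall>\<^sub>F R in F. P R" "B \<ge> 0" "\<epsilon> > 0"
  obtains R where "P R" "ennreal B * S R \<le> ennreal \<epsilon>"
proof -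
  have "\<forall>\<^sub>F R in F. S R < ennreal (\<epsilon> / (B + 1))"
    using assms by (intro order_tendstoD(2)) auto
  then have "\<forall>\<^sub>F R in F. P R \<and> S R < ennreal (\<epsilon> / (B + 1))"
    using assms(3) by (rule eventually_conj[rotated])
  then obtain R where R: "P R" "S R < ennreal (\<epsilon> / (B + 1))"
    using assms(2) eventually_happens by blast
  have "ennreal B * S R \<le> ennreal B * ennreal (\<epsilon> / (B + 1))"
    using R by (intro mult_left_mono) auto
  also have "\<dots> = ennreal (B * (\<epsilon> / (B + 1)))"
    using assms by (intro ennreal_mult[symmetric]) auto
  also have "\<dots> \<le> ennreal \<epsilon>"
    using assms by (intro ennreal_leI) (simp add: field_simps)
  finally show thesis using R(1) that by blast
qed

text \<open>The differences \<open>u (k n) - v\<close> are cut at the unit sphere. The limit \<open>v\<close> is in the sum space because it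
differs from a member of the sequence by a function whose integrals are finite on both pieces.\<close>

lemma compact_embedding:
  fixes V K :: "real \<Rightarrow> real"
  assumes dim: "DIM('a::euclidean_space) \<ge> 3"
    and V: "continuous_on {0<..} V" and K: "continuous_on {0<..} K" and q: "q1 > 0" "q2 > 0"
    and S0: "(S_zero TYPE('a) V K q1 \<longlongrightarrow> 0) (at_right 0)"
    and Sinf: "(S_infty TYPE('a) V K q2 \<longlongrightarrow> 0) at_top"
  shows "compactly_embedded (E_space V :: ('a \<Rightarrow> real) set) (E_norm V)
    (sum_space (weighted_measure K) q1 q2) (sum_norm (weighted_measure K) q1 q2)"
  unfolding compactly_embedded_def
proof (intro conjI allI impI)
  let ?M = "weighted_measure K :: 'a measure"
  have pos: "\<forall>\<^sub>F R in at_right (0::real). R > 0"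
    by (rule eventually_at_right_less)
  obtain R1 where R1: "R1 > 0" "ennreal 1 * S_zero TYPE('a) V K q1 R1 \<le> ennreal 1"
    by (rule S_tail_small[OF S0 _ pos, of 1 1]) auto
  obtain R2 where R2: "R2 > 0" "ennreal 1 * S_infty TYPE('a) V K q2 R2 \<le> ennreal 1"
    by (rule S_tail_small[OF Sinf _ eventually_gt_at_top[of 0], of 1 1]) auto
  have "S_zero TYPE('a) V K q1 R1 < \<infinity>" "S_infty TYPE('a) V K q2 R2 < \<infinity>"
    using le_less_trans[OF R1(2)] le_less_trans[OF R2(2)] by simp_all
  then show "continuously_embedded (E_space V :: ('a \<Rightarrow> real) set) (E_norm V)
    (sum_space ?M q1 q2) (sum_norm ?M q1 q2)"
    by (rule continuous_embedding[OF dim V K q R1(1) R2(1)])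
  fix u :: "nat \<Rightarrow> 'a \<Rightarrow> real"
  assume "(\<forall>n. u n \<in> E_space V) \<and> (\<exists>B. \<forall>n. E_norm V (u n) \<le> B)"
  then obtain B where u: "\<And>n. u n \<in> E_space V" and B: "\<And>n. E_norm V (u n) \<le> B" by blast
  have uD: "u n \<in> D12_rad" for n using u by (simp add: E_space_def)
  have BD: "D12_norm (u n) \<le> B" for n using D12_norm_le_E_norm B order_trans by blast
  obtain k v where k: "strict_mono (k :: nat \<Rightarrow> nat)" and v: "v \<in> borel_measurable lebesgue"
    and conv: "AE x in lebesgue. (\<lambda>n. u (k n) x) \<longlonglongrightarrow> v x"
    by (rule bounded_radial_subsequence[OF dim uD BD])
  let ?Z = "ball (0::'a) 1"
  have tail: "ennreal (E_norm V (u n) powr q) * s \<le> ennreal (B powr q) * s" if "q > 0" for n q s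
    using that by (intro mult_right_mono ennreal_leI powr_mono2 E_norm_nonneg B) auto
  have tails1: "\<exists>T a b. T \<in> sets lebesgue \<and> a > 0 \<and> ?Z \<subseteq> T \<union> (cball 0 b - ball 0 a) \<and>
        (\<forall>n. weighted_power_integral K q1 T (u n) \<le> ennreal \<epsilon>)" if \<epsilon>: "\<epsilon> > 0" for \<epsilon>
  proof -
    obtain R where R: "R > 0" "ennreal (B powr q1) * S_zero TYPE('a) V K q1 R \<le> ennreal \<epsilon>"
      by (rule S_tail_small[OF S0 _ pos, of "B powr q1" \<epsilon>]) (use \<epsilon> in auto)
    have "weighted_power_integral K q1 (ball 0 R) (u n) \<le> ennreal \<epsilon>" for n
      using weighted_power_integral_le_S_zero[OF dim V K u, of q1 R n] tail[OF q(1)] R(2)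
      by (meson order_trans)
    then show ?thesis
      using R(1) by (intro exI[of _ "ball 0 R"] exI[of _ R] exI[of _ 1]) auto
  qed
  have tails2: "\<exists>T a b. T \<in> sets lebesgue \<and> a > 0 \<and> - ?Z \<subseteq> T \<union> (cball 0 b - ball 0 a) \<and>
        (\<forall>n. weighted_power_integral K q2 T (u n) \<le> ennreal \<epsilon>)" if \<epsilon>: "\<epsilon> > 0" for \<epsilon>
  proof -
    obtain R where R: "R > 0" "ennreal (B powr q2) * S_infty TYPE('a) V K q2 R \<le> ennreal \<epsilon>"
      by (rule S_tail_small[OF Sinf _ eventually_gt_at_top[of 0], of "B powr q2" \<epsilon>]) (use \<epsilon> in auto)
    have "weighted_power_integral K q2 (- ball 0 R) (u n) \<le> ennreal \<epsilon>" for n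
      using weighted_power_integral_le_S_infty[OF dim V K u, of q2 R n] tail[OF q(2)] R(2)
      by (meson order_trans)
    then show ?thesis
      by (intro exI[of _ "- ball 0 R"] exI[of _ 1] exI[of _ R]) auto
  qed
  let ?d = "\<lambda>n x. u (k n) x - v x"
  have lim1: "(\<lambda>n. weighted_power_integral K q1 ?Z (?d n)) \<longlonglongrightarrow> 0"
  proof (rule integral_tendsto_0_if_small_tails[where u = "\<lambda>n. u (k n)", OF dim K q(1) uD BD v conv])
    fix \<epsilon> :: real assume "\<epsilon> > 0"
    from tails1[OF this] show "\<exists>T a b. T \<in> sets lebesgue \<and> a > 0 \<and> ?Z \<subseteq> T \<union> (cball 0 b - ball 0 a) \<and>
        (\<forall>n. weighted_power_integral K q1 T (u (k n)) \<le> ennreal \<epsilon>)" by metis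
  qed
  have lim2: "(\<lambda>n. weighted_power_integral K q2 (- ?Z) (?d n)) \<longlonglongrightarrow> 0"
  proof (rule integral_tendsto_0_if_small_tails[where u = "\<lambda>n. u (k n)", OF dim K q(2) uD BD v conv])
    fix \<epsilon> :: real assume "\<epsilon> > 0"
    from tails2[OF this] show "\<exists>T a b. T \<in> sets lebesgue \<and> a > 0 \<and> - ?Z \<subseteq> T \<union> (cball 0 b - ball 0 a) \<and>
        (\<forall>n. weighted_power_integral K q2 T (u (k n)) \<le> ennreal \<epsilon>)" by metis
  qed
  have fin: "\<forall>\<^sub>F n in sequentially. weighted_power_integral K q1 ?Z (?d n) < \<infinity> \<and>
      weighted_power_integral K q2 (- ?Z) (?d n) < \<infinity>"
    using order_tendstoD(2)[OF lim1, of \<infinity>] order_tendstoD(2)[OF lim2, of \<infinity>]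
    by (auto intro: eventually_conj)
  have dm: "?d n \<in> borel_measurable lebesgue" for n
    using E_space_measurable[OF u] v by measurable
  have Z: "?Z \<in> sets lebesgue" "- ?Z \<in> sets lebesgue" by auto
  have u_fin: "weighted_power_integral K q Z (u n) < \<infinity>"
    if q0: "q > 0" and tl: "\<And>\<epsilon>. \<epsilon> > 0 \<Longrightarrow> \<exists>T a b. T \<in> sets lebesgue \<and> a > 0 \<and> Z \<subseteq> T \<union> (cball 0 b - ball 0 a) \<and>
        (\<forall>n. weighted_power_integral K q T (u n) \<le> ennreal \<epsilon>)" for q Z n
  proof -
    from tl[of 1] obtain T a b where T: "T \<in> sets lebesgue" "a > 0" "Z \<subseteq> T \<union> (cball 0 b - ball 0 a)"
      "weighted_power_integral K q T (u n) \<le> ennreal 1" by auto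
    obtain C where C: "\<And>u::'a \<Rightarrow> real. u \<in> E_space V \<Longrightarrow>
        weighted_power_integral K q (cball 0 b - ball 0 a) u \<le> ennreal (C * E_norm V u powr q)"
      using annulus_integral_bound[OF dim K T(2) q0] by metis
    have "weighted_power_integral K q Z (u n) \<le> weighted_power_integral K q T (u n) +
        weighted_power_integral K q (cball 0 b - ball 0 a) (u n)"
      using T by (intro weighted_power_integral_Un[OF K E_space_measurable[OF u]]) auto
    also have "\<dots> \<le> ennreal 1 + ennreal (C * E_norm V (u n) powr q)"
      by (intro add_mono T(4) C u)
    also have "\<dots> < \<infinity>" by simp
    finally show ?thesis .
  qed
  have v_sum: "v \<in> sum_space ?M q1 q2"
  proof -
    from fin obtain n where n: "weighted_power_integral K q1 ?Z (?d n) < \<infinity>"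
      "weighted_power_integral K q2 (- ?Z) (?d n) < \<infinity>"
      by (auto dest: eventually_happens)
    have v_fin: "weighted_power_integral K q Z v < \<infinity>"
      if "q > 0" "Z \<in> sets lebesgue" "weighted_power_integral K q Z (u (k n)) < \<infinity>"
        "weighted_power_integral K q Z (?d n) < \<infinity>" for q Z
    proof -
      have "weighted_power_integral K q Z (\<lambda>x. u (k n) x - ?d n x) \<le> ennreal (2 powr q) *
          (weighted_power_integral K q Z (u (k n)) + weighted_power_integral K q Z (?d n))"
        by (rule weighted_power_integral_diff[OF K that(1) E_space_measurable[OF u] dm that(2)])
      also have "\<dots> < \<infinity>" using that by (simp add: ennreal_mult_less_top)
      finally show ?thesis by simp
    qed
    show ?thesis
      by (rule sum_space_split(1)[OF K q v Z(1)
            v_fin[OF q(1) Z(1) u_fin[OF q(1) tails1] n(1)] v_fin[OF q(2) Z(2) u_fin[OF q(2) tails2] n(2)]])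
  qed
  have bound: "\<forall>\<^sub>F n in sequentially. 0 \<le> sum_norm ?M q1 q2 (?d n) \<and> sum_norm ?M q1 q2 (?d n) \<le>
      max (enn2real (weighted_power_integral K q1 ?Z (?d n)) powr (1 / q1))
          (enn2real (weighted_power_integral K q2 (- ?Z) (?d n)) powr (1 / q2))"
    using fin
  proof eventually_elim
    case (elim n)
    note split = sum_space_split[OF K q dm Z(1) elim[THEN conjunct1] elim[THEN conjunct2]]
    from split(2) sum_norm_nonneg[OF split(1)] show ?case by blast
  qed
  have root: "(\<lambda>n. enn2real (I n) powr (1 / q)) \<longlonglongrightarrow> 0" if "I \<longlonglongrightarrow> 0" "q > 0" for I q
  proof -
    have "(\<lambda>n. enn2real (I n)) \<longlonglongrightarrow> 0" using that(1) by (intro tendsto_enn2real) auto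
    then have "(\<lambda>n. enn2real (I n) powr (1 / q)) \<longlonglongrightarrow> 0 powr (1 / q)"
      using that(2) by (intro tendsto_powr' tendsto_const) auto
    then show ?thesis by simp
  qed
  have "(\<lambda>n. max (enn2real (weighted_power_integral K q1 ?Z (?d n)) powr (1 / q1))
          (enn2real (weighted_power_integral K q2 (- ?Z) (?d n)) powr (1 / q2))) \<longlonglongrightarrow> max 0 0"
    by (intro tendsto_max root lim1 lim2 q)
  then have upper: "(\<lambda>n. max (enn2real (weighted_power_integral K q1 ?Z (?d n)) powr (1 / q1))
          (enn2real (weighted_power_integral K q2 (- ?Z) (?d n)) powr (1 / q2))) \<longlonglongrightarrow> 0"
    by (simp only: max.idem)
  have "(\<lambda>n. sum_norm ?M q1 q2 (?d n)) \<longlonglongrightarrow> 0"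
    by (rule real_tendsto_sandwich[OF eventually_mono[OF bound] eventually_mono[OF bound] tendsto_const upper])
      blast+
  then show "\<exists>v\<in>sum_space ?M q1 q2. \<exists>r. strict_mono r \<and>
      (\<lambda>n. sum_norm ?M q1 q2 (\<lambda>x. u (r n) x - v x)) \<longlonglongrightarrow> 0"
    using v_sum k by blast
qed

theorem theorem3p1:
  fixes V K :: "real \<Rightarrow> real" and q1 q2 :: real
  assumes "CARD('n::finite) \<ge> 3"
    and "continuous_on {0<..} V" and "\<forall>r>0. V r \<ge> 0"
    and "continuous_on {0<..} K" and "\<forall>r>0. K r > 0"
    and "\<exists>C>0. \<forall>r\<in>{0<..<1}. V r \<le> C / r\<^sup>2"
    and "q1 > 1" and "q2 > 1"
  shows "((\<exists>R1>0. \<exists>R2>0. S_zero TYPE(real ^ 'n) V K q1 R1 < \<infinity> \<and>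
                          S_infty TYPE(real ^ 'n) V K q2 R2 < \<infinity>) \<longrightarrow>
            continuously_embedded (E_space V :: (real ^ 'n \<Rightarrow> real) set) (E_norm V)
              (sum_space (weighted_measure K) q1 q2) (sum_norm (weighted_measure K) q1 q2))
       \<and> ((S_zero TYPE(real ^ 'n) V K q1 \<longlongrightarrow> 0) (at_right 0) \<and>
          (S_infty TYPE(real ^ 'n) V K q2 \<longlongrightarrow> 0) at_top \<longrightarrow>
            compactly_embedded (E_space V :: (real ^ 'n \<Rightarrow> real) set) (E_norm V)
              (sum_space (weighted_measure K) q1 q2) (sum_norm (weighted_measure K) q1 q2))"
proof -
  have dim: "DIM(real ^ 'n) \<ge> 3" using assms(1) by simp
  have q: "q1 > 0" "q2 > 0" using assms(7,8) by auto
  show ?thesis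
    using continuous_embedding[OF dim assms(2,4) q] compact_embedding[OF dim assms(2,4) q] by blast
qed

end
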